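(* Let $k\ge1$, $0\le b_0\le k$, $l_1,l_2\ge0$ be integers, and let $\lambda$ and $\mu$ be level-$k$ restricted partitions of $l_1$ and $l_2$, respectively. Then $$\varphi_{\lambda,\mu}(\Gamma_{\lambda,\mu})=G_{\lambda,\mu}\cdot(\mathcal S_\lambda(x)\otimes\mathcal S_\mu(y)),$$ where $$\begin{aligned}G_{\lambda,\mu}={}&\prod_{1\le a<a'\le k}\prod_{i,j}(x_i^{(a)}-x_j^{(a')})^{2a}\prod_{a=1}^k\prod_{i<j}(x_i^{(a)}-x_j^{(a)})^{2a}\\ &\times\prod_{1\le b<b'\le k}\prod_{i,j}(y_i^{(b)}-y_j^{(b')})^{2b}\prod_{b=1}^k\prod_{i<j}(y_i^{(b)}-y_j^{(b)})^{2b}\\ &\times\prod_{1\le a,b\le k;\ a+b>k}\ \prod_{i,j}(x_i^{(a)}-y_j^{(b)})^{a+b-k}\prod_{a=1}^k\prod_j(x_j^{(a)})^{(a-b_0)_+}.\end{aligned}$$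
   Context: $(s)_+=\max(s,0)$. Let $I^{(k,3)}_{l_1,l_2}$ be the space of $g(x_1,\dots,x_{l_1};y_1,\dots,y_{l_2})\in\mathbb C[x_1,\dots,x_{l_1}]^{\mathfrak S_{l_1}}\otimes\mathbb C[y_1,\dots,y_{l_2}]^{\mathfrak S_{l_2}}$ such that $g=0$ whenever $x_1=\cdots=x_a=y_1=\cdots=y_b$ for some $a,b\ge0$ with $a+b=k+1$, and $g=0$ whenever $x_1=\cdots=x_{b_0+1}=0$ (conditions involving more variables than available are void). A partition is level-$k$ restricted if all its parts are $\le k$; $m_a(\lambda)$ is the number of parts of $\lambda$ equal to $a$. Put $\mathcal S_\lambda(x)=\bigotimes_{a=1}^k\mathbb C[x^{(a)}_1,\dots,x^{(a)}_{m_a(\lambda)}]^{\mathfrak S_{m_a(\lambda)}}$, and similarly $\mathcal S_\mu(y)$ in variables $y^{(b)}_j$. For a partition $\lambda$ of $n$, $\varphi_\lambda:\mathbb C[x_1,\dots,x_n]^{\mathfrak S_n}\to\mathcal S_\lambda(x)$ is the substitution which partitions the variables into groups indexed by $(a,i)$, $1\le a\le k$, $1\le i\le m_a(\lambda)$, the group $(a,i)$ having $a$ elements, and sets every variable of the group $(a,i)$ equal to $x_i^{(a)}$ (by symmetry the choice is irrelevant). Put $\varphi_{\lambda,\mu}=\varphi_\lambda\otimes\varphi_\mu$, acting on $\mathbb C[x_1,\dots,x_{l_1}]^{\mathfrak S_{l_1}}\otimes\mathbb C[y_1,\dots,y_{l_2}]^{\mathfrak S_{l_2}}$ with values in $\mathcal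 S_\lambda(x)\otimes\mathcal S_\mu(y)$. Lexicographic order on partitions of the same integer: $\nu\succ\lambda$ iff for some $p$, $\nu_j=\lambda_j$ for $j<p$ and $\nu_p>\lambda_p$. On pairs: $(\nu,\kappa)\succ(\lambda,\mu)$ iff $\nu\succ\lambda$, or $\nu=\lambda$ and $\kappa\succ\mu$. Put $\Gamma_{\lambda,\mu}=\bigcap_{(\nu,\kappa)\succ(\lambda,\mu)}\big(\operatorname{Ker}\varphi_{\nu,\kappa}\cap I^{(k,3)}_{l_1,l_2}\big)$, over pairs of level-$k$ restricted partitions of $l_1$ and $l_2$ (an empty intersection means $I^{(k,3)}_{l_1,l_2}$). *)

theory Defs
  imports Complex_Main "HOL-Library.Poly_Mapping" "HOL-Combinatorics.Permutations"
begin

section \<open>Polynomials over the complex numbers\<close>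

text \<open>Monomials are finitely supported exponent functions; the ring structure is the one of
  \<^theory>\<open>HOL-Library.Poly_Mapping\<close>.\<close>

type_synonym 'v mpoly = "('v \<Rightarrow>\<^sub>0 nat) \<Rightarrow>\<^sub>0 complex"

definition Const :: "complex \<Rightarrow> 'v mpoly" where
  "Const c = Poly_Mapping.single 0 c"

definition Var :: "'v \<Rightarrow> 'v mpoly" where
  "Var v = Poly_Mapping.single (Poly_Mapping.single v 1) 1"

definition smul :: "complex \<Rightarrow> 'v mpoly \<Rightarrow> 'v mpoly" where
  "smul c p = Const c * p"

definition vars :: "'v mpoly \<Rightarrow> 'v set" where
  "vars p = (\<Union>m\<in>Poly_Mapping.keys p. Poly_Mapping.keys m)"

definition peval :: "('v \<Rightarrow> complex) \<Rightarrow> 'v mpoly \<Rightarrow> complex" where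
  "peval z p = (\<Sum>m\<in>Poly_Mapping.keys p. Poly_Mapping.lookup p m *
                 (\<Prod>v\<in>Poly_Mapping.keys m. z v ^ Poly_Mapping.lookup m v))"

definition psubst :: "('v \<Rightarrow> 'w mpoly) \<Rightarrow> 'v mpoly \<Rightarrow> 'w mpoly" where
  "psubst f p = (\<Sum>m\<in>Poly_Mapping.keys p. Const (Poly_Mapping.lookup p m) *
                 (\<Prod>v\<in>Poly_Mapping.keys m. f v ^ Poly_Mapping.lookup m v))"

text \<open>The ring of symmetric polynomials in the variables \<open>V\<close>.\<close>

definition sym_polys :: "'v set \<Rightarrow> 'v mpoly set" where
  "sym_polys V = {p. vars p \<subseteq> V \<and> (\<forall>\<pi>. \<pi> permutes V \<longrightarrow> psubst (\<lambda>v. Var (\<pi> v)) p = p)}"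

text \<open>Tensor products are only formed of spaces of polynomials in pairwise disjoint sets of
  variables. Multiplication then identifies the tensor product with the linear span of the
  products of elements of the factors.\<close>

lemma vector_space_smul: "vector_space smul"
  by unfold_locales
    (simp_all add: smul_def Const_def algebra_simps single_add mult_single)

definition tensor :: "'v mpoly set \<Rightarrow> 'v mpoly set \<Rightarrow> 'v mpoly set" where
  "tensor A B = module.span smul {p * q | p q. p \<in> A \<and> q \<in> B}"

definition tensor_fam :: "'i set \<Rightarrow> ('i \<Rightarrow> 'v mpoly set) \<Rightarrow> 'v mpoly set" where
  "tensor_fam I A = module.span smul {\<Prod>i\<in>I. f i | f. \<forall>i\<in>I. f i \<in> A i}"

text \<open>Indices of variables are 1-based: \<open>X i\<close> and \<open>Y j\<close> are the variables $x_i$, $y_j$ when the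
  index type is \<^typ>\<open>nat\<close>; \<open>X (a, i)\<close> and \<open>Y (b, j)\<close> are $x^{(a)}_i$, $y^{(b)}_j$ when it is
  \<^typ>\<open>nat \<times> nat\<close>.\<close>

datatype 'i xy = X 'i | Y 'i


section \<open>The space \<open>I\<close>\<close>

definition sym_xy :: "nat \<Rightarrow> nat \<Rightarrow> nat xy mpoly set" where
  "sym_xy l1 l2 = tensor (sym_polys (X ` {1..l1})) (sym_polys (Y ` {1..l2}))"

definition I_space :: "nat \<Rightarrow> nat \<Rightarrow> nat \<Rightarrow> nat \<Rightarrow> nat xy mpoly set" where
  "I_space k b0 l1 l2 = {g \<in> sym_xy l1 l2.
     (\<forall>a b. a + b = k + 1 \<and> a \<le> l1 \<and> b \<le> l2 \<longrightarrow>
        (\<forall>z t. (\<forall>i\<in>{1..a}. z (X i) = t) \<and> (\<forall>j\<in>{1..b}. z (Y j) = t) \<longrightarrow> peval z g = 0)) \<and>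
     (b0 + 1 \<le> l1 \<longrightarrow> (\<forall>z. (\<forall>i\<in>{1..b0 + 1}. z (X i) = 0) \<longrightarrow> peval z g = 0))}"


section \<open>Restricted partitions\<close>

definition restricted_partition :: "nat \<Rightarrow> nat \<Rightarrow> nat list \<Rightarrow> bool" where
  "restricted_partition k n ps \<longleftrightarrow>
     sorted_wrt (\<ge>) ps \<and> (\<forall>p\<in>set ps. 1 \<le> p \<and> p \<le> k) \<and> sum_list ps = n"

text \<open>Parts are numbered from 0 here, and are 0 beyond the length.\<close>

definition part :: "nat list \<Rightarrow> nat \<Rightarrow> nat" where
  "part ps j = (if j < length ps then ps ! j else 0)"

definition lex_gt :: "nat list \<Rightarrow> nat list \<Rightarrow> bool" where
  "lex_gt \<nu> ps \<longleftrightarrow> (\<exists>p. (\<forall>j<p. part \<nu> j = part ps j) \<and> part \<nu> p > part ps p)"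

definition pair_gt :: "nat list \<times> nat list \<Rightarrow> nat list \<times> nat list \<Rightarrow> bool" where
  "pair_gt = (\<lambda>(\<nu>, \<kappa>) (ps, qs). lex_gt \<nu> ps \<or> (\<nu> = ps \<and> lex_gt \<kappa> qs))"

abbreviation nparts :: "nat list \<Rightarrow> nat \<Rightarrow> nat" where
  "nparts ps a \<equiv> count_list ps a"

definition groups :: "nat \<Rightarrow> nat list \<Rightarrow> (nat \<times> nat) set" where
  "groups k ps = {(a, i). a \<in> {1..k} \<and> i \<in> {1..nparts ps a}}"


section \<open>The substitution maps\<close>

definition is_grouping :: "nat \<Rightarrow> nat list \<Rightarrow> (nat \<Rightarrow> nat \<times> nat) \<Rightarrow> bool" where
  "is_grouping k ps c \<longleftrightarrow>
     (\<forall>r\<in>{1..sum_list ps}. c r \<in> groups k ps) \<and>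
     (\<forall>(a, i)\<in>groups k ps. card {r\<in>{1..sum_list ps}. c r = (a, i)} = a)"

text \<open>On symmetric polynomials the substitution does not depend on the choice of the grouping.\<close>

definition grouping :: "nat \<Rightarrow> nat list \<Rightarrow> nat \<Rightarrow> nat \<times> nat" where
  "grouping k ps = (SOME c. is_grouping k ps c)"

lemma is_grouping_ex:
  assumes "\<forall>p\<in>set ps. 1 \<le> p \<and> p \<le> k"
  shows "\<exists>c. is_grouping k ps c"
  using assms
proof (induction ps)
  case Nil
  show ?case by (simp add: is_grouping_def groups_def)
next
  case (Cons p ps)
  then obtain c where c: "is_grouping k ps c" by auto
  let ?n = "sum_list ps"
  let ?new = "(p, Suc (nparts ps p))"
  define c' where "c' r = (if r \<le> ?n then c r else ?new)" for r
  have pk: "1 \<le> p" "p \<le> k" using Cons.prems by auto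
  have G: "groups k (p # ps) = insert ?new (groups k ps)"
    using pk by (auto simp: groups_def split: if_splits)
  have nin: "?new \<notin> groups k ps" by (simp add: groups_def)
  have cin: "c r \<in> groups k ps" if "r \<in> {1..?n}" for r
    using c that by (auto simp: is_grouping_def)
  have crd: "card {r\<in>{1..?n}. c r = (a, i)} = a" if "(a, i) \<in> groups k ps" for a i
    using c that unfolding is_grouping_def by blast
  have in': "\<forall>r\<in>{1..sum_list (p # ps)}. c' r \<in> groups k (p # ps)"
    using cin by (auto simp: G c'_def)
  have old: "{r\<in>{1..sum_list (p # ps)}. c' r = g} = {r\<in>{1..?n}. c r = g}"
    if "g \<in> groups k ps" for g
    using that nin by (auto simp: c'_def)
  have "{r\<in>{1..sum_list (p # ps)}. c' r = ?new} = {?n<..?n + p}"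
  proof (intro equalityI subsetI)
    fix r assume r: "r \<in> {r\<in>{1..sum_list (p # ps)}. c' r = ?new}"
    have "\<not> r \<le> ?n"
    proof
      assume "r \<le> ?n"
      with r have "r \<in> {1..?n}" "c r = ?new" by (auto simp: c'_def)
      with cin nin show False by metis
    qed
    with r show "r \<in> {?n<..?n + p}" by auto
  qed (auto simp: c'_def)
  then have new: "card {r\<in>{1..sum_list (p # ps)}. c' r = ?new} = p" by simp
  have "card {r\<in>{1..sum_list (p # ps)}. c' r = (a, i)} = a"
    if "(a, i) \<in> groups k (p # ps)" for a i
  proof (cases "(a, i) = ?new")
    case True
    then show ?thesis using new by simp
  next
    case False
    then have "(a, i) \<in> groups k ps" using that G by blast
    then show ?thesis using old crd by simp
  qed
  with in' have "is_grouping k (p # ps) c'" unfolding is_grouping_def by blast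
  then show ?case by blast
qed

text \<open>The tensor product of the two substitutions is the simultaneous substitution in the
  x- and in the y-variables.\<close>

definition phi :: "nat \<Rightarrow> nat list \<Rightarrow> nat list \<Rightarrow> nat xy mpoly \<Rightarrow> (nat \<times> nat) xy mpoly" where
  "phi k ps qs = psubst (\<lambda>v. case v of X i \<Rightarrow> Var (X (grouping k ps i))
                                     | Y j \<Rightarrow> Var (Y (grouping k qs j)))"

definition ker_phi :: "nat \<Rightarrow> nat \<Rightarrow> nat \<Rightarrow> nat list \<Rightarrow> nat list \<Rightarrow> nat xy mpoly set" where
  "ker_phi k l1 l2 ps qs = {g \<in> sym_xy l1 l2. phi k ps qs g = 0}"

text \<open>The intersection with \<^const>\<open>I_space\<close> in front only matters for an empty index set.\<close>

definition Gamma_space ::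
    "nat \<Rightarrow> nat \<Rightarrow> nat \<Rightarrow> nat \<Rightarrow> nat list \<Rightarrow> nat list \<Rightarrow> nat xy mpoly set" where
  "Gamma_space k b0 l1 l2 ps qs = I_space k b0 l1 l2 \<inter>
     (\<Inter>(\<nu>, \<kappa>)\<in>{(\<nu>, \<kappa>). restricted_partition k l1 \<nu> \<and> restricted_partition k l2 \<kappa> \<and>
                      pair_gt (\<nu>, \<kappa>) (ps, qs)}.
        ker_phi k l1 l2 \<nu> \<kappa> \<inter> I_space k b0 l1 l2)"

definition S_space :: "nat \<Rightarrow> (nat \<times> nat \<Rightarrow> (nat \<times> nat) xy) \<Rightarrow> nat list \<Rightarrow> (nat \<times> nat) xy mpoly set"
  where "S_space k V ps = tensor_fam {1..k} (\<lambda>a. sym_polys ((\<lambda>i. V (a, i)) ` {1..nparts ps a}))"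


section \<open>The polynomial \<open>G\<close>\<close>

abbreviation xv :: "nat \<Rightarrow> nat \<Rightarrow> (nat \<times> nat) xy mpoly" where
  "xv a i \<equiv> Var (X (a, i))"

abbreviation yv :: "nat \<Rightarrow> nat \<Rightarrow> (nat \<times> nat) xy mpoly" where
  "yv b j \<equiv> Var (Y (b, j))"

text \<open>Subtraction on \<^typ>\<open>nat\<close> is truncated, so that \<open>a - b0\<close> is $(a-b_0)_+$.\<close>

definition G_poly :: "nat \<Rightarrow> nat \<Rightarrow> nat list \<Rightarrow> nat list \<Rightarrow> (nat \<times> nat) xy mpoly" where
  "G_poly k b0 ps qs =
     (\<Prod>(a, a')\<in>{(a, a'). 1 \<le> a \<and> a < a' \<and> a' \<le> k}.
        \<Prod>i\<in>{1..nparts ps a}. \<Prod>j\<in>{1..nparts ps a'}. (xv a i - xv a' j) ^ (2 * a)) *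
     (\<Prod>a\<in>{1..k}. \<Prod>(i, j)\<in>{(i, j). 1 \<le> i \<and> i < j \<and> j \<le> nparts ps a}.
        (xv a i - xv a j) ^ (2 * a)) *
     (\<Prod>(b, b')\<in>{(b, b'). 1 \<le> b \<and> b < b' \<and> b' \<le> k}.
        \<Prod>i\<in>{1..nparts qs b}. \<Prod>j\<in>{1..nparts qs b'}. (yv b i - yv b' j) ^ (2 * b)) *
     (\<Prod>b\<in>{1..k}. \<Prod>(i, j)\<in>{(i, j). 1 \<le> i \<and> i < j \<and> j \<le> nparts qs b}.
        (yv b i - yv b j) ^ (2 * b)) *
     (\<Prod>(a, b)\<in>{(a, b). 1 \<le> a \<and> a \<le> k \<and> 1 \<le> b \<and> b \<le> k \<and> a + b > k}.
        \<Prod>i\<in>{1..nparts ps a}. \<Prod>j\<in>{1..nparts qs b}. (xv a i - yv b j) ^ (a + b - k)) *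
     (\<Prod>a\<in>{1..k}. \<Prod>j\<in>{1..nparts ps a}. xv a j ^ (a - b0))"

end

theory Submission
  imports Defs "HOL-Computational_Algebra.Polynomial" "HOL-Library.FuncSet"
begin

text \<open>
  Divisibility of \<open>\<phi>(g)\<close> by \<open>G\<close> for \<open>g \<in> \<Gamma>\<close> is checked one linear factor at a time. Moving a single
  variable of a group of size \<open>a\<close> into a group of size \<open>a' \<ge> a\<close> gives a larger partition (or \<open>k + 1\<close>
  equal variables), so \<open>g\<close> vanishes there; by symmetry it vanishes to second order, once for each of
  the \<open>a\<close> variables. In the mixed case \<open>g\<close> vanishes whenever \<open>k + 1 - b\<close> of the \<open>a\<close> variables hit \<open>y\<close>,
  so every monomial of its expansion around \<open>y\<close> involves at least \<open>a + b - k\<close> of them; the powers of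
  \<open>x\<close> are obtained in the same way.

  Conversely, distribute the variables over \<open>k\<close> columns, the \<open>x\<close>-columns having the lengths of the
  conjugate partition and the \<open>y\<close>-columns those of the conjugate partition in reversed order. Sum over
  all such distributions the product of the \<open>u - v\<close> over the pairs in a common column (in both orders
  for pairs of the same sort), of the \<open>x\<close>-variables in the columns beyond \<open>b\<^sub>0\<close>, and of a
  column-symmetric factor. By the pigeonhole principle each term lies in \<open>I\<close> up to symmetry; by a
  Gale-Ryser argument it is killed by all larger partitions, and under \<open>\<phi>\<close> only the extremal
  arrangements of the groups survive, each with product \<open>\<plusminus> G\<close>. Column-symmetric factors realize the
  whole tensor product, because the power sums of the groups of size \<open>a\<close> are differences of the power
  sums of consecutive columns.
\<close>

section \<open>Evaluation of polynomials\<close>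

text \<open>Where the order on partitions enters: if variables of a common column always lie in
  different groups, a group of size p puts at most min(p, r) of its variables into the first r
  columns. So the sum of min(p, r) over the parts bounds the number of variables there, which is the
  same sum for the given partition. A lexicographically larger partition of the same integer
  violates this for r equal to the given part at the first difference. For the given partition
  itself all bounds are attained, which forces the extremal arrangements.

  Why the y-columns are reversed: extremal x-groups of size a fill the first a columns, y-groups of
  size b the last b, and these overlap in exactly max(a + b - k, 0) columns, the mixed exponent of
  G.

  Why nothing cancels: same-sort pairs enter in both orders and mixed pairs always as x - y, so
  every extremal arrangement gives the same polynomial, sign included.

  Polynomials are compared through their values at complex points. Orders of vanishing are read off
  on lines, and unique factorization is replaced by points lying on exactly one of the hyperplanes
  in question.\<close>

abbreviation "keys \<equiv> Poly_Mapping.keys"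
abbreviation "lookup \<equiv> Poly_Mapping.lookup"
abbreviation "single \<equiv> Poly_Mapping.single"

definition mon :: "('v \<Rightarrow> 'a::comm_ring_1) \<Rightarrow> ('v \<Rightarrow>\<^sub>0 nat) \<Rightarrow> 'a" where
  "mon f m = (\<Prod>v\<in>keys m. f v ^ lookup m v)"

text \<open>A common generalization, so that multiplicativity is proved only once: the identity for
  \<open>c\<close> gives \<open>peval\<close>, \<open>Const\<close> gives \<open>psubst\<close>, and
  constant one-variable polynomials give \<open>line\<close> and \<open>expand\<close>.\<close>

definition geval :: "(complex \<Rightarrow> 'a::comm_ring_1) \<Rightarrow> ('v \<Rightarrow> 'a) \<Rightarrow> 'v mpoly \<Rightarrow> 'a" where
  "geval c f p = (\<Sum>m\<in>keys p. c (lookup p m) * mon f m)"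

lemma mon_superset:
  assumes "finite A" "keys m \<subseteq> A"
  shows "mon f m = (\<Prod>v\<in>A. f v ^ lookup m v)"
  unfolding mon_def using assms
  by (intro prod.mono_neutral_left) (auto simp: in_keys_iff)

lemma mon_0 [simp]: "mon f 0 = 1"
  by (simp add: mon_def)

lemma mon_single [simp]: "mon f (single v n) = f v ^ n"
  by (cases "n = 0") (simp_all add: mon_def)

lemma mon_add: "mon f (m + m') = mon f m * mon f m'"
proof -
  let ?A = "keys m \<union> keys m'"
  have "keys (m + m') \<subseteq> ?A" by (rule keys_add)
  then show ?thesis
    by (simp add: mon_superset[of ?A] lookup_add power_add prod.distrib)
qed

locale coeff_hom =
  fixes c :: "complex \<Rightarrow> 'a::comm_ring_1"
  assumes c_add: "c (x + y) = c x + c y" and c_mult: "c (x * y) = c x * c y" and c_1: "c 1 = 1"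
begin

lemma c_0: "c 0 = 0"
  using c_add[of 0 0] by simp

lemma geval_superset:
  assumes "finite A" "keys p \<subseteq> A"
  shows "geval c f p = (\<Sum>m\<in>A. c (lookup p m) * mon f m)"
  unfolding geval_def using assms
  by (intro sum.mono_neutral_left) (auto simp: in_keys_iff c_0)

lemma geval_add: "geval c f (p + q) = geval c f p + geval c f q"
proof -
  let ?A = "keys p \<union> keys q"
  have "keys (p + q) \<subseteq> ?A" by (rule keys_add)
  then show ?thesis
    by (simp add: geval_superset[of ?A] lookup_add c_add sum.distrib algebra_simps)
qed

lemma geval_0: "geval c f 0 = 0"
  by (simp add: geval_def)

lemma geval_single: "geval c f (single m x) = c x * mon f m"
  by (cases "x = 0") (simp_all add: geval_def c_0)

lemma geval_sum: "geval c f (sum p A) = (\<Sum>i\<in>A. geval c f (p i))"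
  by (induction A rule: infinite_finite_induct) (simp_all add: geval_0 geval_add)

lemma geval_Const: "geval c f (Const x) = c x"
  by (simp add: Const_def geval_single)

lemma geval_Var: "geval c f (Var v) = f v"
  by (simp add: Var_def geval_single c_1)

lemma geval_1: "geval c f 1 = 1"
  using geval_Const[of f 1] by (simp add: Const_def c_1)

end

lemma mpoly_sum_singles:
  fixes p :: "'v mpoly"
  shows "p = (\<Sum>m\<in>keys p. single m (lookup p m))"
  by (rule poly_mapping_eqI) (simp add: lookup_sum lookup_single when_def in_keys_iff)

lemma (in coeff_hom) geval_mult: "geval c f (p * q) = geval c f p * geval c f q"
proof -
  let ?P = "keys p" and ?Q = "keys q"
  have "p * q = (\<Sum>m\<in>?P. single m (lookup p m)) *
                (\<Sum>m\<in>?Q. single m (lookup q m))"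
    using mpoly_sum_singles[of p] mpoly_sum_singles[of q] by simp
  also have "\<dots> = (\<Sum>m\<in>?P. \<Sum>m'\<in>?Q. single (m + m') (lookup p m * lookup q m'))"
    by (simp add: sum_product mult_single)
  also have "geval c f \<dots> = (\<Sum>m\<in>?P. c (lookup p m) * mon f m) *
                 (\<Sum>m\<in>?Q. c (lookup q m) * mon f m)"
    by (simp add: geval_sum geval_single mon_add c_mult sum_product algebra_simps)
  finally show ?thesis by (simp add: geval_def)
qed

lemma Var_power: "Var v ^ n = single (single v n) 1"
  by (induction n) (simp_all add: Var_def mult_single single_add[symmetric])

lemma mpoly_single_mon:
  fixes m :: "'v \<Rightarrow>\<^sub>0 nat"
  shows "single m x = Const x * mon Var m"
proof -
  have *: "mon Var m = single m (1::complex)"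
  proof -
    have "(\<Prod>v\<in>A. (Var v :: 'v mpoly) ^ lookup m v) =
          single (\<Sum>v\<in>A. single v (lookup m v)) 1"
      if "finite A" for A :: "'v set"
      using that by induction (simp_all add: Var_power mult_single)
    moreover have "(\<Sum>v\<in>keys m. single v (lookup m v)) = m"
      by (rule poly_mapping_eqI) (simp add: lookup_sum lookup_single when_def in_keys_iff)
    ultimately show ?thesis by (simp add: mon_def)
  qed
  show ?thesis by (simp add: * Const_def mult_single)
qed

text \<open>With this rule an identity between ring homomorphisms needs checking only on constants
  and variables, and monomials disappear from most later proofs.\<close>

lemma mpoly_induct [case_names Const Var add mult]:
  fixes p :: "'v mpoly"
  assumes C: "\<And>x. P (Const x)" and V: "\<And>v. P (Var v)"
    and A: "\<And>p q. P p \<Longrightarrow> P q \<Longrightarrow> P (p + q)" and M: "\<And>p q. P p \<Longrightarrow> P q \<Longrightarrow> P (p * q)"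
  shows "P p"
proof -
  have one: "P 1" using C[of 1] by (simp add: Const_def)
  have zero: "P 0" using C[of 0] by (simp add: Const_def)
  have pow: "P (Var v ^ n)" for v n
    by (induction n) (auto intro: one M V)
  have "P (\<Prod>v\<in>B. Var v ^ lookup m v)" for B and m :: "'v \<Rightarrow>\<^sub>0 nat"
    by (induction B rule: infinite_finite_induct) (auto intro: one M pow)
  then have "P (single m x)" for m x
    by (simp add: mpoly_single_mon mon_def M C)
  then have "P (\<Sum>m\<in>B. single m (lookup p m))" for B
    by (induction B rule: infinite_finite_induct) (auto intro: zero A)
  then show ?thesis using mpoly_sum_singles[of p] by metis
qed

lemma Const_add: "Const (x + y) = Const x + Const y"
  and Const_mult: "Const (x * y) = Const x * Const y"
  and Const_0 [simp]: "Const 0 = 0"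
  and Const_1 [simp]: "Const 1 = 1"
  by (simp_all add: Const_def single_add mult_single)

interpretation id_hom: coeff_hom "\<lambda>x. x"
  by unfold_locales simp_all

interpretation Const_hom: coeff_hom "Const :: complex \<Rightarrow> 'v mpoly"
  by unfold_locales (simp_all add: Const_add Const_mult)

lemma peval_geval: "peval z p = geval (\<lambda>x. x) z p"
  by (simp add: peval_def geval_def mon_def)

lemma psubst_geval: "psubst f p = geval Const f p"
  by (simp add: psubst_def geval_def mon_def)

section \<open>Evaluation and substitution as ring homomorphisms\<close>

lemma peval_0 [simp]: "peval z 0 = 0"
  and peval_1 [simp]: "peval z 1 = 1"
  and peval_Const [simp]: "peval z (Const x) = x"
  and peval_Var [simp]: "peval z (Var v) = z v"
  and peval_add [simp]: "peval z (p + q) = peval z p + peval z q"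
  and peval_mult [simp]: "peval z (p * q) = peval z p * peval z q"
  by (simp_all add: peval_geval id_hom.geval_0 id_hom.geval_1 id_hom.geval_Const id_hom.geval_Var
        id_hom.geval_add id_hom.geval_mult)

lemma peval_power [simp]: "peval z (p ^ n) = peval z p ^ n"
  by (induction n) simp_all

lemma peval_sum [simp]: "peval z (sum p A) = (\<Sum>i\<in>A. peval z (p i))"
  by (induction A rule: infinite_finite_induct) simp_all

lemma peval_prod [simp]: "peval z (prod p A) = (\<Prod>i\<in>A. peval z (p i))"
  by (induction A rule: infinite_finite_induct) simp_all

lemma peval_diff [simp]: "peval z (p - q) = peval z p - peval z q"
  using peval_add[of z "p - q" q] by (simp add: algebra_simps)

lemma peval_smul [simp]: "peval z (smul c p) = c * peval z p"
  by (simp add: smul_def)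

lemma psubst_0 [simp]: "psubst f 0 = 0"
  and psubst_1 [simp]: "psubst f 1 = 1"
  and psubst_Const [simp]: "psubst f (Const x) = Const x"
  and psubst_Var [simp]: "psubst f (Var v) = f v"
  and psubst_add [simp]: "psubst f (p + q) = psubst f p + psubst f q"
  and psubst_mult [simp]: "psubst f (p * q) = psubst f p * psubst f q"
  by (simp_all add: psubst_geval Const_hom.geval_0 Const_hom.geval_1 Const_hom.geval_Const Const_hom.geval_Var
        Const_hom.geval_add Const_hom.geval_mult)

lemma psubst_sum [simp]: "psubst f (sum p A) = (\<Sum>i\<in>A. psubst f (p i))"
  by (induction A rule: infinite_finite_induct) simp_all

lemma psubst_prod [simp]: "psubst f (prod p A) = (\<Prod>i\<in>A. psubst f (p i))"
  by (induction A rule: infinite_finite_induct) simp_all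

lemma peval_psubst [simp]: "peval z (psubst f p) = peval (\<lambda>v. peval z (f v)) p"
  by (induction p rule: mpoly_induct) simp_all

lemma psubst_psubst: "psubst f (psubst g p) = psubst (\<lambda>v. psubst f (g v)) p"
  by (induction p rule: mpoly_induct) simp_all

section \<open>Variables\<close>

lemma vars_add: "vars (p + q) \<subseteq> vars p \<union> vars q"
  using keys_add[of p q] by (fastforce simp: vars_def)

lemma vars_mult: "vars (p * q) \<subseteq> vars p \<union> vars q"
proof
  fix v assume "v \<in> vars (p * q)"
  then obtain m where m: "m \<in> keys (p * q)" "v \<in> keys m"
    by (auto simp: vars_def)
  then obtain a b where "a \<in> keys p" "b \<in> keys q" "m = a + b"
    using keys_mult[of p q] by blast
  moreover have "v \<in> keys a \<union> keys b"
    using m keys_add[of a b] calculation by blast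
  ultimately show "v \<in> vars p \<union> vars q" by (auto simp: vars_def)
qed

lemma vars_Const [simp]: "vars (Const c) = {}"
  by (simp add: vars_def Const_def)

lemma vars_0 [simp]: "vars 0 = {}"
  by (simp add: vars_def)

lemma vars_1 [simp]: "vars 1 = {}"
  by (simp add: vars_def)

lemma vars_Var [simp]: "vars (Var v) = {v}"
  by (simp add: vars_def Var_def)

lemma vars_addI: "vars p \<subseteq> V \<Longrightarrow> vars q \<subseteq> V \<Longrightarrow> vars (p + q) \<subseteq> V"
  using vars_add[of p q] by blast

lemma vars_multI: "vars p \<subseteq> V \<Longrightarrow> vars q \<subseteq> V \<Longrightarrow> vars (p * q) \<subseteq> V"
  using vars_mult[of p q] by blast

lemma vars_uminus [simp]: "vars (- p) = vars (p :: 'v mpoly)"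
  by (simp add: vars_def in_keys_iff set_eq_iff)

lemma vars_diffI: "vars p \<subseteq> V \<Longrightarrow> vars q \<subseteq> V \<Longrightarrow> vars (p - q) \<subseteq> V"
  using vars_addI[of p V "- q"] by simp

lemma vars_powerI: "vars p \<subseteq> V \<Longrightarrow> vars (p ^ n) \<subseteq> V"
  by (induction n) (simp_all add: vars_multI)

lemma vars_sumI: "(\<And>i. i \<in> A \<Longrightarrow> vars (p i) \<subseteq> V) \<Longrightarrow> vars (sum p A) \<subseteq> V"
  by (induction A rule: infinite_finite_induct) (simp_all add: vars_addI)

lemma vars_prodI: "(\<And>i. i \<in> A \<Longrightarrow> vars (p i) \<subseteq> V) \<Longrightarrow> vars (prod p A) \<subseteq> V"
  by (induction A rule: infinite_finite_induct) (simp_all add: vars_multI)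

lemma vars_smulI: "vars p \<subseteq> V \<Longrightarrow> vars (smul c p) \<subseteq> V"
  by (simp add: smul_def vars_multI)

lemma vars_psubstI:
  assumes "\<And>v. v \<in> vars p \<Longrightarrow> vars (f v) \<subseteq> V"
  shows "vars (psubst f p) \<subseteq> V"
  unfolding psubst_def
proof (intro vars_sumI vars_multI vars_prodI vars_powerI assms)
  show "vars (Const (lookup p m)) \<subseteq> V" for m by simp
qed (auto simp: vars_def)

lemma peval_cong: "(\<And>v. v \<in> vars p \<Longrightarrow> z v = w v) \<Longrightarrow> peval z p = peval w p"
  unfolding peval_def vars_def
  by (intro sum.cong prod.cong arg_cong2[where f = "(*)"] arg_cong2[where f = "(^)"]) auto

lemma psubst_cong: "(\<And>v. v \<in> vars p \<Longrightarrow> f v = g v) \<Longrightarrow> psubst f p = psubst g p"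
  unfolding psubst_def vars_def
  by (intro sum.cong prod.cong arg_cong2[where f = "(*)"] arg_cong2[where f = "(^)"]) auto

lemma psubst_Var_id [simp]: "psubst Var p = p"
  by (induction p rule: mpoly_induct) simp_all

lemma finite_vars [simp]: "finite (vars p)"
  by (simp add: vars_def)

section \<open>Expansion in one variable\<close>

text \<open>Expansion in powers of \<open>Var u - b\<close>: the indeterminate of the outer
  polynomial stands for \<open>Var u - b\<close>, hence the image \<open>[:b, 1:]\<close> of
  \<open>u\<close>.\<close>

definition expand :: "'v \<Rightarrow> 'v mpoly \<Rightarrow> 'v mpoly \<Rightarrow> 'v mpoly poly" where
  "expand u b = geval (\<lambda>x. [:Const x:]) (\<lambda>v. if v = u then [:b, 1:] else [:Var v:])"

text \<open>The restriction to the affine line through \<open>z\<close> with direction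
  \<open>d\<close>.\<close>

definition line :: "('v \<Rightarrow> complex) \<Rightarrow> ('v \<Rightarrow> complex) \<Rightarrow> 'v mpoly \<Rightarrow> complex poly" where
  "line z d = geval (\<lambda>x. [:x:]) (\<lambda>v. [:z v, d v:])"

interpretation pCons_hom: coeff_hom "\<lambda>x. [:x::complex:]"
  by unfold_locales (simp_all add: one_pCons)

interpretation pCons_Const_hom: coeff_hom "\<lambda>x. [:Const x :: 'v mpoly:]"
  by unfold_locales (simp_all add: one_pCons Const_add Const_mult)

lemma line_Const [simp]: "line z d (Const x) = [:x:]"
  and line_Var [simp]: "line z d (Var v) = [:z v, d v:]"
  and line_add [simp]: "line z d (p + q) = line z d p + line z d q"
  and line_mult [simp]: "line z d (p * q) = line z d p * line z d q"
  by (simp_all add: line_def pCons_hom.geval_Const pCons_hom.geval_Var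
        pCons_hom.geval_add pCons_hom.geval_mult)

lemma expand_Const [simp]: "expand u b (Const x) = [:Const x:]"
  and expand_Var [simp]: "expand u b (Var v) = (if v = u then [:b, 1:] else [:Var v:])"
  and expand_add [simp]: "expand u b (p + q) = expand u b p + expand u b q"
  and expand_mult [simp]: "expand u b (p * q) = expand u b p * expand u b q"
  by (simp_all add: expand_def pCons_Const_hom.geval_Const pCons_Const_hom.geval_Var
        pCons_Const_hom.geval_add pCons_Const_hom.geval_mult)

lemma poly_line: "poly (line z d p) t = peval (\<lambda>v. z v + t * d v) p"
  by (induction p rule: mpoly_induct) simp_all

lemma poly_expand: "poly (expand u b p) (Var u - b) = p"
  by (induction p rule: mpoly_induct) simp_all

text \<open>Links the two expansions: the values of the polynomial coefficients of
  \<open>expand\<close> are complex coefficients along a line in direction \<open>u\<close> that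
  starts on the hyperplane where \<open>u\<close> equals \<open>b\<close>. Orders of vanishing on
  such lines thus control the coefficients.\<close>

lemma coeff_expand:
  "peval z (coeff (expand u b p) n) =
   coeff (line (z(u := peval z b)) (\<lambda>v. if v = u then 1 else 0) p) n"
proof (induction p arbitrary: n rule: mpoly_induct)
  case (Const x)
  show ?case by (cases n) simp_all
next
  case (Var v)
  show ?case by (auto simp: coeff_pCons split: nat.splits)
next
  case (mult p q)
  then show ?case by (simp add: coeff_mult)
qed simp

lemma vars_coeff_expand:
  assumes "vars p \<subseteq> insert u V" "vars b \<subseteq> V" 
  shows "vars (coeff (expand u b p) n) \<subseteq> V"
proof -
  let ?P = "\<lambda>q :: 'a mpoly poly. \<forall>n. vars (coeff q n) \<subseteq> V"
  have mult: "?P (q * r)" if "?P q" "?P r" for q r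
    using that by (simp add: coeff_mult vars_sumI vars_multI)
  have one: "?P 1" by (auto simp: coeff_1)
  have c: "?P [:Const x:]" for x by (auto simp: coeff_pCons split: nat.splits)
  have pow: "?P (q ^ n)" if "?P q" for q n
  proof (induction n)
    case (Suc n)
    show ?case using mult[OF that Suc] by simp
  qed (simp add: one)
  have v: "?P (if v = u then [:b, 1:] else [:Var v:])" if "v \<in> vars p" for v
    using that assms by (auto simp: coeff_pCons split: nat.splits)
  have prod: "?P (prod f A)" if "\<And>i. i \<in> A \<Longrightarrow> ?P (f i)" for f :: "'a \<Rightarrow> 'a mpoly poly" and A
    using that
  proof (induction A rule: infinite_finite_induct)
    case (insert x F)
    have "?P (f x * prod f F)" by (intro mult insert.IH insert.prems) simp_all
    then show ?case using insert.hyps by simp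
  qed (simp_all add: one)
  have sum: "?P (sum f A)" if "\<And>i. i \<in> A \<Longrightarrow> ?P (f i)" for f :: "('a \<Rightarrow>\<^sub>0 nat) \<Rightarrow> 'a mpoly poly" and A
    using that by (auto simp: coeff_sum intro!: vars_sumI)
  have "?P (expand u b p)"
    unfolding expand_def geval_def mon_def
    by (intro sum mult prod pow c v) (auto simp: vars_def)
  then show ?thesis by blast
qed

text \<open>Induction on the number of variables: the coefficients of the expansion in one variable
  involve only the others, and a complex one-variable polynomial with all values 0 is 0.\<close>

lemma peval_inj_aux:
  assumes "finite V" "vars p \<subseteq> V" "\<And>z. peval z p = 0"
  shows "p = 0"
  using assms
proof (induction V arbitrary: p rule: finite_induct)
  case empty
  have keys: "keys p \<subseteq> {0}"
    using empty.prems(1) by (auto simp: vars_def)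
  have "p = (\<Sum>m\<in>keys p. single m (lookup p m))"
    by (rule mpoly_sum_singles)
  also have "\<dots> = (\<Sum>m\<in>{0}. single m (lookup p m))"
    using keys by (intro sum.mono_neutral_left) (auto simp: in_keys_iff)
  finally have "p = Const (lookup p 0)" by (simp add: Const_def)
  then show ?case using empty.prems(2) by (metis peval_Const Const_0)
next
  case (insert u V)
  have "coeff (expand u 0 p) n = 0" for n
  proof (rule insert.IH)
    show "vars (coeff (expand u 0 p) n) \<subseteq> V"
      using insert.prems by (intro vars_coeff_expand) auto
    fix z
    have "poly (line (z(u := peval z 0)) (\<lambda>v. if v = u then 1 else 0) p) t = 0" for t
      by (simp add: poly_line insert.prems)
    then have "line (z(u := peval z 0)) (\<lambda>v. if v = u then 1 else 0) p = 0"
      using poly_all_0_iff_0 by blast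
    then show "peval z (coeff (expand u 0 p) n) = 0"
      by (simp only: coeff_expand coeff_0)
  qed
  then have "expand u 0 p = 0" by (simp add: poly_eq_iff)
  then show ?case using poly_expand[of u 0 p] by simp
qed

lemma peval_eq_0_imp: "(\<And>z. peval z p = 0) \<Longrightarrow> p = 0"
  using peval_inj_aux[of "vars p" p] by simp

lemma mpoly_eqI: "(\<And>z. peval z p = peval z q) \<Longrightarrow> p = q"
  using peval_eq_0_imp[of "p - q"] by simp

text \<open>Restriction to the line through a non-zero of \<open>p\<close> and a non-zero of
  \<open>q\<close> reduces the claim to one-variable polynomials.\<close>

lemma mpoly_no_zero_divisors:
  fixes p q :: "'v mpoly"
  assumes "p * q = 0" "p \<noteq> 0"
  shows "q = 0"
proof (rule ccontr)
  assume "q \<noteq> 0"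
  with assms obtain z w where zw: "peval z p \<noteq> 0" "peval w q \<noteq> 0"
    using peval_eq_0_imp by metis
  let ?L = "line z (\<lambda>v. w v - z v)"
  have "poly (?L p) 0 \<noteq> 0" "poly (?L q) 1 \<noteq> 0"
    using zw by (simp_all add: poly_line)
  then have "?L p * ?L q \<noteq> 0" by auto
  moreover have "?L p * ?L q = 0"
    using assms line_mult[of z _ p q] line_Const[of z _ 0] by simp
  ultimately show False by simp
qed

lemma mpoly_mult_left_cancel:
  fixes p q r :: "'v mpoly"
  assumes "p * q = p * r" "p \<noteq> 0"
  shows "q = r"
  using mpoly_no_zero_divisors[of p "q - r"] assms by (simp add: algebra_simps)

text \<open>The cofactor \<open>q\<close> may depend on the point \<open>z\<close> in any way: order
  \<open>n\<close> on each line makes the first \<open>n\<close> coefficients of the expansion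
  vanish at every point, hence identically.\<close>

lemma linear_power_dvdI:
  assumes "\<And>z. \<exists>q. \<forall>t. peval (z(u := peval z b + t)) p = t ^ n * poly q t"
  shows "(Var u - b) ^ n dvd p"
proof -
  have 0: "coeff (expand u b p) j = 0" if "j < n" for j
  proof (rule peval_eq_0_imp)
    fix z
    obtain q where q: "\<And>t. peval (z(u := peval z b + t)) p = t ^ n * poly q t"
      using assms by blast
    let ?l = "line (z(u := peval z b)) (\<lambda>v. if v = u then 1 else 0) p"
    have "poly ?l t = poly (monom 1 n * q) t" for t
    proof -
      have "(\<lambda>v. (z(u := peval z b)) v + t * (if v = u then 1 else 0)) = z(u := peval z b + t)"
        by auto
      then show ?thesis by (simp add: poly_line q poly_monom)
    qed
    then have "?l = monom 1 n * q" by (simp add: poly_eq_poly_eq_iff fun_eq_iff flip: poly_eq_poly_eq_iff)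
    then show "peval z (coeff (expand u b p) j) = 0"
      using that by (simp only: coeff_expand) (simp add: coeff_monom_mult)
  qed
  define e where "e = expand u b p"
  \<comment> \<open>Evaluating this factorization at \<open>Var u - b\<close> turns
    \<open>monom 1 n\<close> into the required power and \<open>e\<close> back into
    \<open>p\<close>.\<close>
  have "e = monom 1 n * poly_shift n e"
    using 0 by (intro poly_eqI) (auto simp: coeff_monom_mult coeff_poly_shift e_def)
  then have "poly e (Var u - b) = (Var u - b) ^ n * poly (poly_shift n e) (Var u - b)"
    by (metis poly_mult poly_monom mult_1)
  then show ?thesis by (simp only: e_def poly_expand) (rule dvdI)
qed

section \<open>Orders of vanishing\<close>

definition deg :: "('v \<Rightarrow>\<^sub>0 nat) \<Rightarrow> nat" where
  "deg m = (\<Sum>v\<in>keys m. lookup m v)"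

lemma mon_const: "mon (\<lambda>_. t) m = t ^ deg m"
  by (simp add: mon_def deg_def power_sum)

lemma peval_diagonal_order:
  assumes "\<And>m. m \<in> keys p \<Longrightarrow> N \<le> deg m"
  shows "\<exists>q. \<forall>t. peval (\<lambda>_. t) p = t ^ N * poly q t"
proof (intro exI allI)
  fix t :: complex
  let ?q = "\<Sum>m\<in>keys p. monom (lookup p m) (deg m - N)"
  have "t ^ deg m = t ^ N * t ^ (deg m - N)" if "m \<in> keys p" for m
    using assms[OF that] by (metis le_add_diff_inverse power_add)
  then show "peval (\<lambda>_. t) p = t ^ N * poly ?q t"
    by (simp add: peval_geval geval_def mon_const poly_sum poly_monom sum_distrib_left mult.left_commute)
qed

lemma Var_power_dvd_lookup:
  assumes "Var u ^ n dvd p" "m \<in> keys p"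
  shows "n \<le> lookup m u"
proof -
  obtain q where "p = single (single u n) 1 * q"
    using assms(1) by (auto simp: dvd_def Var_power)
  then have "\<exists>m'. m = single u n + m'"
    using assms(2) keys_mult[of "single (single u n) 1" q] by fastforce
  then show ?thesis by (auto simp: lookup_add)
qed

text \<open>Translates vanishing on a coordinate subspace into a statement on monomials: if the left
  side is zero, every monomial of \<open>p\<close> involves a variable of \<open>C\<close>.\<close>

lemma lookup_psubst_kill:
  "lookup (psubst (\<lambda>v. if v \<in> C then 0 else Var v) p) m =
   (if keys m \<inter> C = {} then lookup p m else 0)"
proof -
  let ?f = "\<lambda>v. if v \<in> C then 0 else Var v"
  have "mon ?f m' = (if keys m' \<inter> C = {} then single m' 1 else 0)" for m'
  proof (cases "keys m' \<inter> C = {}")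
    case True
    then have "mon ?f m' = mon Var m'"
      unfolding mon_def by (intro prod.cong) auto
    then show ?thesis using True mpoly_single_mon[of m' 1] by simp
  next
    case False
    then obtain v where v: "v \<in> keys m'" "v \<in> C" by blast
    then have "?f v ^ lookup m' v = 0"
      by (auto simp: in_keys_iff zero_power)
    then show ?thesis
      using False v(1) unfolding mon_def by (metis (no_types, lifting) finite_keys prod_zero)
  qed
  then have "psubst ?f p = (\<Sum>m'\<in>keys p. if keys m' \<inter> C = {}
      then single m' (lookup p m') else 0)"
    unfolding psubst_geval geval_def
    by (intro sum.cong) (auto simp: Const_def mult_single)
  moreover have "lookup (if keys m' \<inter> C = {}
        then single m' (lookup p m') else 0) m =
      (if m' = m then (if keys m \<inter> C = {} then lookup p m else 0) else 0)" for m'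
    by (auto simp: lookup_single when_def)
  ultimately have "lookup (psubst ?f p) m =
      (\<Sum>m'\<in>keys p. if m' = m then
         (if keys m \<inter> C = {} then lookup p m else 0) else 0)"
    by (simp only: lookup_sum)
  then show ?thesis by (simp add: in_keys_iff)
qed

text \<open>In coordinates centred at \<open>w\<close>, \<open>g\<close> becomes a polynomial
  \<open>F\<close> in the variables \<open>A\<close>. Since \<open>g\<close> vanishes as soon as
  \<open>c\<close> of them equal \<open>w\<close>, no monomial of \<open>F\<close> misses
  \<open>c\<close> variables of \<open>A\<close>. Each therefore involves at least
  \<open>card A + 1 - c\<close> of them, and setting all of them to \<open>t\<close> gives the
  order.\<close>

lemma order_of_coincidence:
  assumes A: "finite A" and c: "c \<le> card A"
    and van: "\<And>\<zeta> C. C \<subseteq> A \<Longrightarrow> card C = c \<Longrightarrow> (\<And>v. v \<in> C \<Longrightarrow> \<zeta> v = w) \<Longrightarrow>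
                (\<And>v. v \<notin> A \<Longrightarrow> \<zeta> v = z v) \<Longrightarrow> peval \<zeta> g = 0"
  shows "\<exists>q. \<forall>t. peval (\<lambda>v. if v \<in> A then w + t else z v) g = t ^ (card A + 1 - c) * poly q t"
proof -
  define f where "f = (\<lambda>v. if v \<in> A then Const w + Var v else Const (z v))"
  have f: "peval s (f v) = (if v \<in> A then w + s v else z v)" for s v
    by (simp add: f_def)
  define F where "F = psubst f g"
  have "vars F \<subseteq> A"
    unfolding F_def by (rule vars_psubstI) (simp add: f_def vars_addI)
  then have keysA: "keys m \<subseteq> A" if "m \<in> keys F" for m
    using that by (auto simp: vars_def)
  have deg: "card A + 1 - c \<le> deg m" if m: "m \<in> keys F" for m
  proof -
    have "card (A - keys m) < c"
    proof (rule ccontr)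
      assume "\<not> ?thesis"
      then obtain C where C: "C \<subseteq> A - keys m" "card C = c"
        by (meson not_less obtain_subset_with_card_n)
      \<comment> \<open>In the centred coordinates, killing \<open>C\<close> puts its variables at
        \<open>w\<close>, where \<open>van\<close> applies.\<close>
      have "psubst (\<lambda>v. if v \<in> C then 0 else Var v) F = 0"
      proof (rule peval_eq_0_imp)
        fix s
        show "peval s (psubst (\<lambda>v. if v \<in> C then 0 else Var v) F) = 0"
          unfolding F_def peval_psubst f
          by (rule van[of C]) (use C in auto)
      qed
      then have "lookup (psubst (\<lambda>v. if v \<in> C then 0 else Var v) F) m = 0"
        by simp
      moreover have "keys m \<inter> C = {}" using C by blast
      ultimately show False
        using m by (simp add: lookup_psubst_kill in_keys_iff)
    qed
    moreover have "card (A - keys m) = card A - card (keys m)"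
      using keysA[OF m] by (simp add: card_Diff_subset)
    moreover have "card (keys m) \<le> deg m"
      using sum_mono[of "keys m" "\<lambda>_. 1" "lookup m"]
      by (simp add: deg_def in_keys_iff Suc_le_eq)
    ultimately show ?thesis by linarith
  qed
  have "\<exists>q. \<forall>t. peval (\<lambda>_. t) F = t ^ (card A + 1 - c) * poly q t"
    by (rule peval_diagonal_order) (rule deg)
  then show ?thesis
    by (simp only: F_def peval_psubst f)
qed

text \<open>The coefficient of index 1 is the directional derivative at \<open>z\<close>; this is
  its additivity in the direction.\<close>

lemma coeff_1_line_add:
  "coeff (line z (\<lambda>v. d v + e v) p) 1 = coeff (line z d p) 1 + coeff (line z e p) 1"
proof -
  have c0: "coeff (line z d p) 0 = peval z p" for d p
    using poly_line[of z d p 0] by (simp add: poly_0_coeff_0)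
  have c1: "coeff (r * s) 1 = coeff r 0 * coeff s 1 + coeff r 1 * coeff s 0" for r s :: "complex poly"
    by (simp add: coeff_mult)
  show ?thesis
    by (induction p rule: mpoly_induct)
      (simp_all only: line_Const line_Var line_add line_mult coeff_add c0 c1, simp_all add: algebra_simps)
qed

lemma coeff_1_line_0: "coeff (line z (\<lambda>_. 0) p) 1 = 0"
  using coeff_1_line_add[of z "\<lambda>_. 0" "\<lambda>_. 0" p] by simp

lemma coeff_1_line_sum:
  "finite B \<Longrightarrow> coeff (line z (\<lambda>v. \<Sum>i\<in>B. d i v) p) 1 = (\<Sum>i\<in>B. coeff (line z (d i) p) 1)"
proof (induction B rule: finite_induct)
  case (insert i B)
  then have "(\<lambda>v. \<Sum>i\<in>insert i B. d i v) = (\<lambda>v. d i v + (\<Sum>i\<in>B. d i v))"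
    by (simp add: fun_eq_iff)
  then show ?case by (simp only: coeff_1_line_add insert.IH sum.insert[OF insert.hyps])
qed (simp only: sum.empty coeff_1_line_0)

text \<open>On the diagonal all first partial derivatives of a symmetric polynomial agree and their sum
  is the derivative along the diagonal, so vanishing on the diagonal is automatically of order 2.\<close>

lemma order_2_of_symmetric:
  assumes B: "finite B" "u \<in> B"
    and sym: "\<And>\<zeta> i j. i \<in> B \<Longrightarrow> j \<in> B \<Longrightarrow> peval (\<zeta> \<circ> transpose i j) g = peval \<zeta> g"
    and van: "\<And>\<zeta> w. (\<And>v. v \<in> B \<Longrightarrow> \<zeta> v = w) \<Longrightarrow> (\<And>v. v \<notin> B \<Longrightarrow> \<zeta> v = z v) \<Longrightarrow> peval \<zeta> g = 0"
  shows "\<exists>q. \<forall>t. peval (\<lambda>v. if v = u then w + t else if v \<in> B then w else z v) g = t ^ 2 * poly q t"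
proof -
  define y where "y = (\<lambda>v. if v \<in> B then w else z v)"
  define e where "e i = (\<lambda>v. if v = i then 1 else 0 :: complex)" for i :: 'a
  have same: "line y (e i) g = line y (e u) g" if "i \<in> B" for i
  proof -
    have "peval (\<lambda>v. y v + t * e i v) g = peval (\<lambda>v. y v + t * e u v) g" for t
    proof -
      have "(\<lambda>v. y v + t * e i v) \<circ> transpose i u = (\<lambda>v. y v + t * e u v)"
        using that B(2) by (auto simp: fun_eq_iff y_def e_def transpose_def)
      then show ?thesis using sym[OF that B(2), of "\<lambda>v. y v + t * e i v"] by simp
    qed
    then show ?thesis by (simp add: poly_line fun_eq_iff flip: poly_eq_poly_eq_iff)
  qed
  have "line y (\<lambda>v. \<Sum>i\<in>B. e i v) g = 0"
  proof -
    have "peval (\<lambda>v. y v + t * (\<Sum>i\<in>B. e i v)) g = 0" for t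
      by (rule van[of _ "w + t"]) (use B in \<open>auto simp: y_def e_def\<close>)
    then show ?thesis by (simp add: poly_line flip: poly_all_0_iff_0)
  qed
  then have "(\<Sum>i\<in>B. coeff (line y (e i) g) 1) = 0"
    using coeff_1_line_sum[OF B(1), of y e g] by simp
  moreover have "(\<Sum>i\<in>B. coeff (line y (e i) g) 1) = of_nat (card B) * coeff (line y (e u) g) 1"
    by (simp add: same)
  ultimately have c1: "coeff (line y (e u) g) 1 = 0"
    using B by auto
  have "peval y g = 0"
    by (rule van[of _ w]) (auto simp: y_def)
  then have c0: "coeff (line y (e u) g) 0 = 0"
    using poly_line[of y "e u" g 0] by (simp add: poly_0_coeff_0)
  have "line y (e u) g = monom 1 2 * poly_shift 2 (line y (e u) g)"
  proof (rule poly_eqI)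
    show "coeff (line y (e u) g) n = coeff (monom 1 2 * poly_shift 2 (line y (e u) g)) n" for n
    proof (cases "n < 2")
      case True
      then show ?thesis using c0 c1 by (auto simp: coeff_monom_mult less_2_cases_iff)
    next
      case False
      then have "n - 2 + 2 = n" by simp
      with False show ?thesis by (simp only: coeff_monom_mult coeff_poly_shift if_False mult_1)
    qed
  qed
  then have "poly (line y (e u) g) t = t ^ 2 * poly (poly_shift 2 (line y (e u) g)) t" for t
    by (metis poly_mult poly_monom mult_1)
  moreover have "(\<lambda>v. y v + t * e u v) = (\<lambda>v. if v = u then w + t else if v \<in> B then w else z v)" for t
    using B by (auto simp: y_def e_def)
  ultimately show ?thesis by (auto simp: poly_line)
qed

text \<open>Each \<open>u\<close> of \<open>A\<close> is treated alone: when it reaches the common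
  value of \<open>B\<close>, symmetry in \<open>insert u B\<close> gives order 2, so
  \<open>Var u ^ 2\<close> divides the centred polynomial \<open>F\<close>. Hence every monomial of
  \<open>F\<close> has exponent at least 2 in each variable of \<open>A\<close>.\<close>

lemma order_of_joining:
  assumes A: "finite A" and B: "finite B" and AB: "A \<inter> B = {}"
    and sym: "\<And>\<zeta> i j. i \<in> A \<union> B \<Longrightarrow> j \<in> A \<union> B \<Longrightarrow> peval (\<zeta> \<circ> transpose i j) g = peval \<zeta> g"
    and van: "\<And>\<zeta> u w. u \<in> A \<Longrightarrow> (\<And>v. v \<in> insert u B \<Longrightarrow> \<zeta> v = w) \<Longrightarrow>
                (\<And>v. v \<notin> A \<union> B \<Longrightarrow> \<zeta> v = z v) \<Longrightarrow> peval \<zeta> g = 0"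
  shows "\<exists>q. \<forall>t. peval (\<lambda>v. if v \<in> A then w + t else if v \<in> B then w else z v) g =
               t ^ (2 * card A) * poly q t"
proof -
  define f where "f = (\<lambda>v. if v \<in> A then Const w + Var v else if v \<in> B then Const w else Const (z v))"
  have f: "peval s (f v) = (if v \<in> A then w + s v else if v \<in> B then w else z v)" for s v
    by (simp add: f_def)
  define F where "F = psubst f g"
  have "Var u ^ 2 dvd F" if u: "u \<in> A" for u
  proof -
    have "(Var u - 0) ^ 2 dvd F"
    proof (rule linear_power_dvdI)
      fix s
      \<comment> \<open>The other variables of \<open>A\<close> stay at arbitrary values:
        \<open>van\<close> prescribes values only for \<open>u\<close>, on \<open>B\<close>, and
        outside \<open>A \<union> B\<close>. This freedom is what allows the variables to be treated
        one at a time.\<close>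
      define y where "y = (\<lambda>v. if v \<in> A then w + s v else z v)"
      have "\<exists>q. \<forall>t. peval (\<lambda>v. if v = u then w + t else if v \<in> insert u B then w else y v) g = t ^ 2 * poly q t"
      proof (rule order_2_of_symmetric)
        show "peval (\<zeta> \<circ> transpose i j) g = peval \<zeta> g" if "i \<in> insert u B" "j \<in> insert u B" for \<zeta> i j
          using sym[of i j \<zeta>] that u by blast
        show "peval \<zeta> g = 0" if "\<And>v. v \<in> insert u B \<Longrightarrow> \<zeta> v = w" "\<And>v. v \<notin> insert u B \<Longrightarrow> \<zeta> v = y v" for \<zeta> w
        proof (rule van[OF u])
          show "\<zeta> v = z v" if "v \<notin> A \<union> B" for v
            using \<open>\<And>v. v \<notin> insert u B \<Longrightarrow> \<zeta> v = y v\<close>[of v] that u by (auto simp: y_def)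
        qed (rule that(1))
      qed (use B in auto)
      moreover have "(\<lambda>v. peval (s(u := peval s 0 + t)) (f v)) =
          (\<lambda>v. if v = u then w + t else if v \<in> insert u B then w else y v)" for t
        using u AB by (auto simp: f y_def fun_eq_iff)
      ultimately show "\<exists>q. \<forall>t. peval (s(u := peval s 0 + t)) F = t ^ 2 * poly q t"
        by (simp only: F_def peval_psubst)
    qed
    then show ?thesis by simp
  qed
  then have 2: "2 \<le> lookup m u" if "u \<in> A" "m \<in> keys F" for u m
    using that by (intro Var_power_dvd_lookup)
  have deg: "2 * card A \<le> deg m" if m: "m \<in> keys F" for m
  proof -
    have "A \<subseteq> keys m" using 2[OF _ m] by (fastforce simp: in_keys_iff)
    then have "(\<Sum>v\<in>A. lookup m v) \<le> deg m"
      unfolding deg_def by (intro sum_mono2) auto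
    moreover have "(\<Sum>v\<in>A. 2) \<le> (\<Sum>v\<in>A. lookup m v)"
      by (intro sum_mono 2 m)
    ultimately show ?thesis by (simp add: mult.commute)
  qed
  have "\<exists>q. \<forall>t. peval (\<lambda>_. t) F = t ^ (2 * card A) * poly q t"
    by (rule peval_diagonal_order) (rule deg)
  then show ?thesis
    by (simp only: F_def peval_psubst f)
qed

section \<open>Partitions and groupings\<close>

definition parts_in :: "nat \<Rightarrow> nat list \<Rightarrow> bool" where
  "parts_in k ps \<longleftrightarrow> (\<forall>p\<in>set ps. 1 \<le> p \<and> p \<le> k)"

lemma finite_groups [simp]: "finite (groups k ps)"
proof -
  have "groups k ps = Sigma {1..k} (\<lambda>a. {1..nparts ps a})" by (auto simp: groups_def)
  then show ?thesis by simp
qed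

lemma sum_groups:
  fixes f :: "nat \<Rightarrow> nat"
  assumes "parts_in k ps"
  shows "(\<Sum>e\<in>groups k ps. f (fst e)) = sum_list (map f ps)"
proof -
  have "groups k ps = Sigma {1..k} (\<lambda>a. {1..nparts ps a})" by (auto simp: groups_def)
  then have "(\<Sum>e\<in>groups k ps. f (fst e)) = (\<Sum>a\<in>{1..k}. count_list ps a * f a)"
    using sum.Sigma[of "{1..k}" "\<lambda>a. {1..nparts ps a}" "\<lambda>a _. f a"]
    by (simp add: case_prod_beta)
  also have "\<dots> = (\<Sum>a\<in>set ps. count_list ps a * f a)"
    using assms by (intro sum.mono_neutral_right) (auto simp: parts_in_def count_list_0_iff)
  finally show ?thesis by (simp add: sum_list_map_eq_sum_count)
qed

lemma card_groups:
  assumes "parts_in k ps"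
  shows "card {e \<in> groups k ps. P (fst e)} = length (filter P ps)"
proof -
  have "card {e \<in> groups k ps. P (fst e)} = (\<Sum>e\<in>groups k ps. if P (fst e) then 1 else 0)"
    by (simp add: sum.If_cases Int_def)
  also have "\<dots> = sum_list (map (\<lambda>a. if P a then 1 else 0) ps)"
    by (rule sum_groups[OF assms, of "\<lambda>a. if P a then 1 else 0"])
  also have "\<dots> = length (filter P ps)"
    by (induction ps) simp_all
  finally show ?thesis .
qed

lemma is_grouping_grouping:
  assumes "parts_in k ps"
  shows "is_grouping k ps (grouping k ps)"
  using is_grouping_ex[of ps k] assms unfolding grouping_def parts_in_def by (metis someI_ex)

lemma grouping_in:
  "parts_in k ps \<Longrightarrow> r \<in> {1..sum_list ps} \<Longrightarrow> grouping k ps r \<in> groups k ps"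
  using is_grouping_grouping unfolding is_grouping_def by blast

lemma card_grouping:
  assumes "parts_in k ps" "e \<in> groups k ps"
  shows "card {r\<in>{1..sum_list ps}. grouping k ps r = e} = fst e"
  using is_grouping_grouping[OF assms(1)] assms(2) unfolding is_grouping_def by (cases e) auto

lemma restricted_partitionD:
  assumes "restricted_partition k n ps"
  shows "parts_in k ps" "sum_list ps = n" "sorted_wrt (\<ge>) ps"
  using assms by (auto simp: restricted_partition_def parts_in_def)

text \<open>The source of all permutations below: symmetric polynomials do not distinguish
  arrangements whose classes have the same sizes.\<close>

lemma permutes_matching:
  assumes "finite S" and "\<And>j. card {i\<in>S. c i = j} = card {i\<in>S. d i = j}"
  shows "\<exists>\<pi>. \<pi> permutes S \<and> (\<forall>i\<in>S. c (\<pi> i) = d i)"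
proof -
  have count: "count (image_mset f (mset_set S)) j = card {i\<in>S. f i = j}" for f :: "'a \<Rightarrow> 'b" and j
  proof -
    have "f -` {j} \<inter> S = {i\<in>S. f i = j}" by auto
    then show ?thesis using assms(1)
      by (simp add: count_image_mset)
  qed
  have "image_mset d (mset_set S) = image_mset c (mset_set S)"
    by (rule multiset_eqI) (simp add: count assms(2))
  then show ?thesis using image_mset_eq_implies_permutes[OF assms(1)] by metis
qed

text \<open>Makes the chosen grouping as good as any other: up to a permutation, a coloring factors
  through the grouping of the partition formed by its class sizes. A symmetric polynomial killed by
  the specialization at that partition therefore vanishes at all points that are constant on the
  color classes.\<close>

lemma shape_of_coloring:
  fixes c :: "nat \<Rightarrow> 'j" and n :: nat
  defines "fib \<equiv> (\<lambda>j. card {i\<in>{1..n}. c i = j})"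
  assumes k: "\<And>j. fib j \<le> k"
  obtains \<nu> \<pi> \<delta> where "restricted_partition k n \<nu>"
    and "\<And>a. count_list \<nu> a = card {j\<in>c ` {1..n}. fib j = a}"
    and "\<pi> permutes {1..n}" and "\<And>i. i \<in> {1..n} \<Longrightarrow> c (\<pi> i) = \<delta> (grouping k \<nu> i)"
proof -
  let ?J = "c ` {1..n}"
  define M where "M = image_mset fib (mset_set ?J)"
  define \<nu> where "\<nu> = rev (sorted_list_of_multiset M)"
  have mset: "mset \<nu> = M" by (simp add: \<nu>_def)
  have cnt: "count_list \<nu> a = card {j\<in>?J. fib j = a}" for a
  proof -
    have "fib -` {a} \<inter> ?J = {j\<in>?J. fib j = a}" by auto
    then show ?thesis
      by (simp add: count_mset[symmetric] mset M_def count_image_mset)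
  qed
  have pos: "1 \<le> fib j" if "j \<in> ?J" for j
    using that by (auto simp: fib_def Suc_le_eq card_gt_0_iff)
  have part: "restricted_partition k n \<nu>"
    unfolding restricted_partition_def
  proof (intro conjI)
    show "sorted_wrt (\<ge>) \<nu>" by (simp add: \<nu>_def sorted_wrt_rev)
    show "\<forall>p\<in>set \<nu>. 1 \<le> p \<and> p \<le> k"
      using pos k by (auto simp: set_mset_mset[symmetric] mset M_def simp del: set_mset_mset)
    have "sum_list \<nu> = (\<Sum>j\<in>?J. fib j)"
      by (simp add: sum_mset_sum_list[symmetric] mset M_def sum_unfold_sum_mset)
    also have "\<dots> = card (\<Union>j\<in>?J. {i\<in>{1..n}. c i = j})"
      unfolding fib_def by (intro card_UN_disjoint[symmetric]) auto
    also have "(\<Union>j\<in>?J. {i\<in>{1..n}. c i = j}) = {1..n}" by auto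
    finally show "sum_list \<nu> = n" by simp
  qed
  note P = restricted_partitionD[OF part]
  have "\<exists>h. bij_betw h {e \<in> groups k \<nu>. fst e = a} {j\<in>?J. fib j = a}" for a
  proof -
    have "card {e \<in> groups k \<nu>. fst e = a} = length (filter (\<lambda>x. x = a) \<nu>)"
      by (rule card_groups[OF P(1)])
    also have "\<dots> = count_list \<nu> a"
      by (induction \<nu>) auto
    finally show ?thesis using cnt by (intro finite_same_card_bij) auto
  qed
  \<comment> \<open>Groups are matched with colors separately for each size; \<open>\<delta>\<close>
    below glues these bijections together.\<close>
  then have "\<exists>h. \<forall>a. bij_betw (h a) {e \<in> groups k \<nu>. fst e = a} {j\<in>?J. fib j = a}"
    by (intro choice allI)
  then obtain h where h: "\<And>a. bij_betw (h a) {e \<in> groups k \<nu>. fst e = a} {j\<in>?J. fib j = a}"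
    by blast
  define \<delta> where "\<delta> e = h (fst e) e" for e
  have \<delta>_fib: "\<delta> e \<in> ?J \<and> fib (\<delta> e) = fst e" if "e \<in> groups k \<nu>" for e
    using h[of "fst e"] that unfolding bij_betw_def \<delta>_def by blast
  have \<delta>_inj: "e = e'" if "e \<in> groups k \<nu>" "e' \<in> groups k \<nu>" "\<delta> e = \<delta> e'" for e e'
  proof -
    have "fst e = fst e'" using \<delta>_fib that by metis
    then show ?thesis
      using bij_betw_imp_inj_on[OF h[of "fst e"]] that by (auto simp: \<delta>_def dest: inj_onD)
  qed
  have \<delta>_surj: "\<exists>e\<in>groups k \<nu>. \<delta> e = j" if "j \<in> ?J" for j
  proof -
    have "j \<in> h (fib j) ` {e \<in> groups k \<nu>. fst e = fib j}"
      using h[of "fib j"] that unfolding bij_betw_def by blast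
    then obtain e where "e \<in> groups k \<nu>" "fst e = fib j" "j = h (fib j) e" by blast
    then show ?thesis unfolding \<delta>_def by metis
  qed
  have "\<exists>\<pi>. \<pi> permutes {1..n} \<and> (\<forall>i\<in>{1..n}. c (\<pi> i) = \<delta> (grouping k \<nu> i))"
  proof (rule permutes_matching)
    fix j
    show "card {i\<in>{1..n}. c i = j} = card {i\<in>{1..n}. \<delta> (grouping k \<nu> i) = j}"
    proof (cases "j \<in> ?J")
      case True
      then obtain e where e: "e \<in> groups k \<nu>" "\<delta> e = j" using \<delta>_surj by blast
      have "\<delta> (grouping k \<nu> i) = j \<longleftrightarrow> grouping k \<nu> i = e" if "i \<in> {1..n}" for i
        using \<delta>_inj[OF grouping_in[OF P(1), of i] e(1)] that P(2) e(2) by metis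
      then have "{i\<in>{1..n}. \<delta> (grouping k \<nu> i) = j} = {i\<in>{1..n}. grouping k \<nu> i = e}"
        by auto
      then show ?thesis
        using card_grouping[OF P(1) e(1)] \<delta>_fib[OF e(1)] e(2) P(2) by (simp add: fib_def)
    next
      case False
      moreover have "\<delta> (grouping k \<nu> i) \<in> ?J" if "i \<in> {1..n}" for i
        using \<delta>_fib[OF grouping_in[OF P(1), of i]] that P(2) by blast
      ultimately have "{i\<in>{1..n}. c i = j} = {}" "{i\<in>{1..n}. \<delta> (grouping k \<nu> i) = j} = {}"
        by blast+
      then show ?thesis by (simp only:)
    qed
  qed simp
  then obtain \<pi> where "\<pi> permutes {1..n}" "\<And>i. i \<in> {1..n} \<Longrightarrow> c (\<pi> i) = \<delta> (grouping k \<nu> i)"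
    by blast
  with part cnt show thesis by (rule that)
qed

section \<open>Lexicographic order, truncated sums and conjugate partitions\<close>

lemma sorted_split_at:
  fixes xs :: "nat list"
  assumes "sorted_wrt (\<ge>) xs"
  shows "xs = filter (\<lambda>x. x > T) xs @ replicate (count_list xs T) T @ filter (\<lambda>x. x < T) xs"
  using assms
proof (induction xs)
  case (Cons x xs)
  consider "x > T" | "x = T" | "x < T" by linarith
  then show ?case
  proof cases
    case 1
    then show ?thesis using Cons by simp
  next
    case 2
    then have "filter (\<lambda>x. x > T) xs = []" using Cons.prems by (auto simp: filter_empty_conv)
    then show ?thesis using 2 Cons by simp
  next
    case 3
    then have "filter (\<lambda>x. x > T) xs = []" "count_list xs T = 0"
      using Cons.prems by (auto simp: filter_empty_conv count_list_0_iff)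
    then show ?thesis using 3 Cons by simp
  qed
qed simp

text \<open>Both lists start with the same parts above \<open>T\<close>, followed by their copies of
  \<open>T\<close>. They first differ where \<open>ps\<close> has used up its copies: there
  \<open>\<nu>\<close> still has \<open>T\<close>, while \<open>ps\<close> has a smaller part,
  possibly the default 0 beyond its end.\<close>

lemma lex_gtI:
  assumes sorted: "sorted_wrt (\<ge>) \<nu>" "sorted_wrt (\<ge>) ps" and T: "1 \<le> T"
    and above: "\<And>s. s > T \<Longrightarrow> count_list \<nu> s = count_list ps s"
    and at: "count_list ps T < count_list \<nu> T"
  shows "lex_gt \<nu> ps"
proof -
  let ?F = "filter (\<lambda>x. x > T)"
  have "mset (?F \<nu>) = mset (?F ps)"
    by (rule multiset_eqI) (auto simp: count_mset above)
  moreover have "sorted (rev (?F \<nu>))" "sorted (rev (?F ps))"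
    using sorted by (auto simp: sorted_wrt_rev intro: sorted_wrt_filter)
  ultimately have F: "?F \<nu> = ?F ps"
    by (metis mset_rev properties_for_sort rev_rev_ident)
  define m n where "m = count_list ps T" and "n = count_list \<nu> T"
  define L where "L = ?F ps"
  have ps: "ps = L @ replicate m T @ filter (\<lambda>x. x < T) ps"
    unfolding L_def m_def by (rule sorted_split_at[OF sorted(2)])
  have \<nu>: "\<nu> = L @ replicate n T @ filter (\<lambda>x. x < T) \<nu>"
    unfolding L_def n_def F[symmetric] by (rule sorted_split_at[OF sorted(1)])
  have mn: "m < n" using at by (simp add: m_def n_def)
  let ?p = "length L + m"
  have part_\<nu>: "part \<nu> j = (if j < length L then L ! j else T)" if "j < length L + n" for j
    using that by (subst \<nu>) (auto simp: part_def nth_append)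
  have part_ps: "part ps j = (if j < length L then L ! j else T)" if "j < ?p" for j
    using that by (subst ps) (auto simp: part_def nth_append)
  have "part ps ?p < T"
  proof (cases "filter (\<lambda>x. x < T) ps")
    case Nil
    then have "length ps = ?p" using arg_cong[OF ps, of length] by simp
    then show ?thesis using T by (simp add: part_def)
  next
    case (Cons x xs)
    then have "x < T" by (metis (mono_tags, lifting) filter_eq_ConsD)
    moreover have "part ps ?p = x"
      using Cons by (subst ps) (auto simp: part_def nth_append)
    ultimately show ?thesis by simp
  qed
  moreover have "part \<nu> ?p = T" using part_\<nu>[of ?p] mn by simp
  moreover have "part \<nu> j = part ps j" if "j < ?p" for j
    using part_\<nu>[of j] part_ps[of j] that mn by simp
  ultimately show ?thesis unfolding lex_gt_def by metis
qed

lemma sum_list_parts: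
  fixes f :: "nat \<Rightarrow> nat"
  assumes "f 0 = 0" "length xs \<le> N"
  shows "sum_list (map f xs) = (\<Sum>j<N. f (part xs j))"
proof -
  have "sum_list (map f xs) = (\<Sum>j<length xs. f (part xs j))"
    by (simp add: sum_list_sum_nth atLeast0LessThan part_def)
  also have "\<dots> = (\<Sum>j<N. f (part xs j))"
    using assms by (intro sum.mono_neutral_left) (auto simp: part_def)
  finally show ?thesis .
qed

text \<open>Take for \<open>r\<close> the part of \<open>ps\<close> at the first difference. Later
  parts of \<open>ps\<close> do not exceed \<open>r\<close> and earlier parts agree, so the total
  excess over \<open>r\<close> is strictly larger for \<open>\<nu>\<close>. The integers being
  equal, the total of the truncated parts is strictly smaller.\<close>

lemma lex_gt_min_sum:
  assumes "lex_gt \<nu> ps" "sorted_wrt (\<ge>) ps" "sum_list \<nu> = sum_list ps"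
  shows "\<exists>r. sum_list (map (\<lambda>x. min x r) \<nu>) < sum_list (map (\<lambda>x. min x r) ps)"
proof -
  obtain p where p: "\<And>j. j < p \<Longrightarrow> part \<nu> j = part ps j" "part ps p < part \<nu> p"
    using assms(1) by (auto simp: lex_gt_def)
  define r where "r = part ps p"
  \<comment> \<open>Long enough to cover both lists and the index \<open>p\<close>, which lets the
    sums be compared termwise after padding with zero parts.\<close>
  define N where "N = Suc (max p (max (length \<nu>) (length ps)))"
  have above: "sum_list (map (\<lambda>x. x - r) xs) + sum_list (map (\<lambda>x. min x r) xs) = sum_list xs" for xs
    by (induction xs) auto
  have "part ps j \<le> r" if "p \<le> j" for j
    using assms(2) that
    by (auto simp: r_def part_def sorted_wrt_iff_nth_less le_less)
  then have "(\<Sum>j<N. part ps j - r) < (\<Sum>j<N. part \<nu> j - r)"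
  proof (intro sum_strict_mono_ex1)
    show "\<forall>j\<in>{..<N}. part ps j - r \<le> part \<nu> j - r"
      using p(1) \<open>\<And>j. p \<le> j \<Longrightarrow> part ps j \<le> r\<close> by (metis diff_is_0_eq le_refl not_le zero_le)
    show "\<exists>j\<in>{..<N}. part ps j - r < part \<nu> j - r"
      using p(2) by (intro bexI[of _ p]) (auto simp: r_def N_def)
  qed simp
  then have "sum_list (map (\<lambda>x. x - r) ps) < sum_list (map (\<lambda>x. x - r) \<nu>)"
  proof -
    have "length ps \<le> N" "length \<nu> \<le> N" by (simp_all add: N_def)
    then show ?thesis
      using sum_list_parts[of "\<lambda>x. x - r" ps N] sum_list_parts[of "\<lambda>x. x - r" \<nu> N]
        \<open>(\<Sum>j<N. part ps j - r) < (\<Sum>j<N. part \<nu> j - r)\<close> by simp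
  qed
  then show ?thesis using above[of ps] above[of \<nu>] assms(3) by (intro exI[of _ r]) linarith
qed

text \<open>Counts the boxes in the first \<open>r\<close> columns of the Young diagram by rows and
  by columns.\<close>

lemma sum_list_min_conjugate:
  "sum_list (map (\<lambda>x. min x r) ps) = (\<Sum>c\<in>{1..r}. length (filter (\<lambda>p. c \<le> p) ps))"
proof (induction ps)
  case (Cons x ps)
  have "(\<Sum>c\<in>{1..r}. if c \<le> x then 1 else 0) = card {1..min x r}"
  proof -
    have "{1..r} \<inter> {c. c \<le> x} = {1..min x r}" by auto
    then show ?thesis by (simp add: sum.If_cases)
  qed
  moreover have "length (filter (\<lambda>p. c \<le> p) (x # ps)) = (if c \<le> x then 1 else 0) + length (filter (\<lambda>p. c \<le> p) ps)" for c
    by simp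
  ultimately show ?case using Cons by (simp only: sum.distrib list.map sum_list.Cons card_atLeastAtMost)
qed simp

section \<open>Invariants\<close>

interpretation mpoly: vector_space "smul :: complex \<Rightarrow> 'v mpoly \<Rightarrow> 'v mpoly"
  by (rule vector_space_smul)

abbreviation act :: "('v \<Rightarrow> 'v) \<Rightarrow> 'v mpoly \<Rightarrow> 'v mpoly" where
  "act \<pi> \<equiv> psubst (\<lambda>v. Var (\<pi> v))"

lemma psubst_smul [simp]: "psubst f (smul c p) = smul c (psubst f p)"
  by (simp add: smul_def)

lemma psubst_diff [simp]: "psubst f (p - q) = psubst f p - psubst f q"
  using psubst_add[of f "p - q" q] by (simp add: algebra_simps)

lemma psubst_power [simp]: "psubst f (p ^ n) = psubst f p ^ n"
  by (induction n) simp_all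

lemma peval_of_nat [simp]: "peval z (of_nat n) = of_nat n"
  by (induction n) simp_all

lemma act_act: "act \<sigma> (act \<pi> p) = act (\<sigma> \<circ> \<pi>) p"
  by (simp add: psubst_psubst o_def)

lemma vars_act: "\<pi> permutes V \<Longrightarrow> vars p \<subseteq> V \<Longrightarrow> vars (act \<pi> p) \<subseteq> V"
  by (rule vars_psubstI) (auto simp: permutes_in_image)

lemma act_disjoint: "\<pi> permutes V \<Longrightarrow> vars p \<inter> V = {} \<Longrightarrow> act \<pi> p = p"
  using psubst_cong[of p "\<lambda>v. Var (\<pi> v)" Var] permutes_not_in[of \<pi> V]
  by (metis disjoint_iff psubst_Var_id)

lemma sym_polysD:
  "p \<in> sym_polys V \<Longrightarrow> vars p \<subseteq> V" "p \<in> sym_polys V \<Longrightarrow> \<pi> permutes V \<Longrightarrow> act \<pi> p = p"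
  by (auto simp: sym_polys_def)

text \<open>The Reynolds operator of the symmetric group on \<open>V\<close>.\<close>

definition sym_avg :: "'v set \<Rightarrow> 'v mpoly \<Rightarrow> 'v mpoly" where
  "sym_avg V p = smul (1 / fact (card V)) (\<Sum>\<pi>\<in>{\<pi>. \<pi> permutes V}. act \<pi> p)"

lemma sym_avg_linear:
  "sym_avg V (p + q) = sym_avg V p + sym_avg V q"
  "sym_avg V (smul c p) = smul c (sym_avg V p)"
  "sym_avg V 0 = 0"
  by (simp_all add: sym_avg_def sum.distrib mpoly.scale_right_distrib mpoly.scale_sum_right mult.commute)

lemma sym_avg_in_sym_polys:
  assumes "finite V" "vars p \<subseteq> V"
  shows "sym_avg V p \<in> sym_polys V"
proof -
  have "act \<sigma> (sym_avg V p) = sym_avg V p" if "\<sigma> permutes V" for \<sigma>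
  proof -
    have "act \<sigma> (sym_avg V p) = smul (1 / fact (card V)) (\<Sum>\<pi>\<in>{\<pi>. \<pi> permutes V}. act (\<sigma> \<circ> \<pi>) p)"
      by (simp add: sym_avg_def act_act)
    then show ?thesis
      by (simp only: sym_avg_def flip: setum_permutations_compose_left[OF that, of "\<lambda>\<pi>. act \<pi> p"])
  qed
  moreover have "vars (sym_avg V p) \<subseteq> V"
    unfolding sym_avg_def using assms by (intro vars_smulI vars_sumI vars_act) auto
  ultimately show ?thesis by (simp add: sym_polys_def)
qed

lemma sym_avg_invariant:
  assumes "finite V" "\<And>\<pi>. \<pi> permutes V \<Longrightarrow> act \<pi> p = p"
  shows "sym_avg V p = p"
proof (rule mpoly_eqI)
  fix z
  have "(\<Sum>\<pi>\<in>{\<pi>. \<pi> permutes V}. peval z (act \<pi> p)) = (\<Sum>\<pi>\<in>{\<pi>. \<pi> permutes V}. peval z p)"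
    using assms(2) by (intro sum.cong) (simp_all del: peval_psubst)
  then show "peval z (sym_avg V p) = peval z p"
    using card_permutations[OF refl assms(1)] by (simp add: sym_avg_def del: peval_psubst)
qed

lemma sym_avg_mult:
  assumes "vars q \<inter> V = {}"
  shows "sym_avg V (p * q) = sym_avg V p * q"
proof -
  have "act \<pi> (p * q) = act \<pi> p * q" if "\<pi> permutes V" for \<pi>
    using act_disjoint[OF that assms] by simp
  then have "(\<Sum>\<pi>\<in>{\<pi>. \<pi> permutes V}. act \<pi> (p * q)) = (\<Sum>\<pi>\<in>{\<pi>. \<pi> permutes V}. act \<pi> p) * q"
    by (simp add: sum_distrib_right)
  then show ?thesis by (simp add: sym_avg_def smul_def mult.assoc)
qed

text \<open>The invariants of a product of symmetric groups on disjoint blocks form the tensor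
  product of the invariants of the blocks. Monomials are products over the blocks; averaging over
  one block changes only the factor belonging to it and fixes \<open>p\<close>.\<close>

lemma invariants_in_span:
  assumes E: "finite E" and V: "\<And>e. e \<in> E \<Longrightarrow> finite (V e)"
    and disj: "\<And>e e'. e \<in> E \<Longrightarrow> e' \<in> E \<Longrightarrow> e \<noteq> e' \<Longrightarrow> V e \<inter> V e' = {}"
    and vars: "vars p \<subseteq> (\<Union>e\<in>E. V e)"
    and inv: "\<And>e \<pi>. e \<in> E \<Longrightarrow> \<pi> permutes V e \<Longrightarrow> act \<pi> p = p"
  shows "p \<in> mpoly.span {\<Prod>e\<in>E. f e | f. \<forall>e\<in>E. f e \<in> sym_polys (V e)}"
proof -
  \<comment> \<open>Products whose factors are already symmetric for the blocks in \<open>F\<close>;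
    the induction enlarges \<open>F\<close> from the empty set to \<open>E\<close>.\<close>
  define Gen where "Gen F = {\<Prod>e\<in>E. f e | f. \<forall>e\<in>E. vars (f e) \<subseteq> V e \<and>
      (e \<in> F \<longrightarrow> f e \<in> sym_polys (V e))}" for F
  have step: "sym_avg (V e0) q \<in> mpoly.span (Gen (insert e0 F))"
    if "q \<in> mpoly.span (Gen F)" "e0 \<in> E" for q e0 F
    using that(1)
  proof (rule mpoly.span_induct)
    show "mpoly.subspace {q. sym_avg (V e0) q \<in> mpoly.span (Gen (insert e0 F))}"
      by (auto simp: mpoly.subspace_def sym_avg_linear mpoly.span_zero mpoly.span_add mpoly.span_scale)
  next
    fix q assume "q \<in> Gen F"
    then obtain f where f: "q = (\<Prod>e\<in>E. f e)"
      "\<And>e. e \<in> E \<Longrightarrow> vars (f e) \<subseteq> V e \<and> (e \<in> F \<longrightarrow> f e \<in> sym_polys (V e))"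
      by (auto simp: Gen_def)
    define f' where "f' = f(e0 := sym_avg (V e0) (f e0))"
    have avg: "sym_avg (V e0) (f e0) \<in> sym_polys (V e0)"
      using f(2) that(2) V by (intro sym_avg_in_sym_polys) auto
    have "vars (\<Prod>e\<in>E - {e0}. f e) \<subseteq> (\<Union>e\<in>E - {e0}. V e)"
      using f(2) by (intro vars_prodI) blast
    then have "vars (\<Prod>e\<in>E - {e0}. f e) \<inter> V e0 = {}"
      using disj that(2) by blast
    then have "sym_avg (V e0) q = sym_avg (V e0) (f e0) * (\<Prod>e\<in>E - {e0}. f e)"
      using sym_avg_mult prod.remove[OF E that(2), of f] f(1) by metis
    also have "\<dots> = (\<Prod>e\<in>E. f' e)"
      using prod.remove[OF E that(2), of f'] by (simp add: f'_def)
    also have "\<dots> \<in> Gen (insert e0 F)"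
      unfolding Gen_def using f(2) avg sym_polysD(1)[OF avg]
      by (intro CollectI exI[of _ f']) (auto simp: f'_def)
    finally show "sym_avg (V e0) q \<in> mpoly.span (Gen (insert e0 F))"
      by (rule mpoly.span_base)
  qed
  have "p \<in> mpoly.span (Gen F)" if "F \<subseteq> E" "finite F" for F
    using that(2,1)
  proof (induction F rule: finite_induct)
    case empty
    have "p = (\<Sum>m\<in>keys p. smul (lookup p m) (mon Var m))"
      using mpoly_sum_singles[of p] by (simp add: smul_def mpoly_single_mon[symmetric])
    moreover have "mon Var m \<in> Gen {}" if "m \<in> keys p" for m
    proof -
      have "keys m \<subseteq> (\<Union>e\<in>E. V e)" using vars that by (auto simp: vars_def)
      then have "mon Var m = (\<Prod>v\<in>(\<Union>e\<in>E. V e). Var v ^ lookup m v)"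
        using E V by (intro mon_superset) auto
      also have "\<dots> = (\<Prod>e\<in>E. \<Prod>v\<in>V e. Var v ^ lookup m v)"
        using E V disj by (intro prod.UNION_disjoint) auto
      finally show ?thesis unfolding Gen_def
        by (intro CollectI exI[of _ "\<lambda>e. \<Prod>v\<in>V e. Var v ^ lookup m v"])
          (auto intro!: vars_prodI vars_powerI)
    qed
    ultimately show ?case
      by (metis (no_types, lifting) mpoly.span_sum mpoly.span_scale mpoly.span_base)
  next
    case (insert e F)
    have "e \<in> E" using insert.prems by blast
    then have "sym_avg (V e) p = p" by (intro sym_avg_invariant V inv)
    then show ?case using step[of p F e] insert.IH insert.prems by simp
  qed
  from this[OF subset_refl E] have "p \<in> mpoly.span (Gen E)" .
  moreover have "Gen E \<subseteq> {\<Prod>e\<in>E. f e | f. \<forall>e\<in>E. f e \<in> sym_polys (V e)}"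
    unfolding Gen_def by auto
  ultimately show ?thesis using mpoly.span_mono by blast
qed

text \<open>Induction on the number of variables in a symmetrized monomial. Multiplying by a power
  sum either attaches a new variable or raises the exponent of one already present. The first kind
  of term occurs \<open>card (V - D)\<close> times, which is invertible in characteristic 0, and the
  second is covered by the induction hypothesis.\<close>

lemma power_sums_generate:
  fixes V :: "'v set" and Alg :: "'v mpoly set"
  assumes V: "finite V" and p: "p \<in> sym_polys V"
    and C: "\<And>c. Const c \<in> Alg" and add: "\<And>p q. p \<in> Alg \<Longrightarrow> q \<in> Alg \<Longrightarrow> p + q \<in> Alg"
    and mult: "\<And>p q. p \<in> Alg \<Longrightarrow> q \<in> Alg \<Longrightarrow> p * q \<in> Alg"
    and pow: "\<And>m. (\<Sum>v\<in>V. Var v ^ m) \<in> Alg"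
  shows "p \<in> Alg"
proof -
  have zero: "0 \<in> Alg" using C[of 0] by simp
  have sum: "sum f A \<in> Alg" if "\<And>i. i \<in> A \<Longrightarrow> f i \<in> Alg" for f :: "'i \<Rightarrow> 'v mpoly" and A
    using that by (induction A rule: infinite_finite_induct) (simp_all add: zero add)
  have diff: "p - q \<in> Alg" if "p \<in> Alg" "q \<in> Alg" for p q
  proof -
    have "p - q = p + Const (-1) * q" by (rule mpoly_eqI) simp
    then show ?thesis using that add mult C by metis
  qed
  define P where "P = {\<pi>. \<pi> permutes V}"
  \<comment> \<open>The symmetrized monomial with exponents \<open>\<alpha>\<close> on the variables
    \<open>D\<close>, without normalization.\<close>
  define S where "S D \<alpha> = (\<Sum>\<pi>\<in>P. \<Prod>v\<in>D. (Var (\<pi> v) :: 'v mpoly) ^ \<alpha> v)" for D and \<alpha> :: "'v \<Rightarrow> nat"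
  have S: "S D \<alpha> \<in> Alg" if "D \<subseteq> V" for D \<alpha>
    using finite_subset[OF that V] that
  proof (induction D arbitrary: \<alpha> rule: finite_induct)
    case empty
    have "S {} \<alpha> = Const (of_nat (card P))"
      by (rule mpoly_eqI) (simp add: S_def)
    then show ?case using C by simp
  next
    case (insert d D)
    \<comment> \<open>The part of the product of the power sum and \<open>S D \<alpha>\<close> in
      which the extra power falls on the image of \<open>w\<close>. It is a new variable if
      \<open>w\<close> lies outside \<open>D\<close>, and merges with a present one
      otherwise.\<close>
    define T where "T w = (\<Sum>\<pi>\<in>P. Var (\<pi> w) ^ \<alpha> d * (\<Prod>v\<in>D. (Var (\<pi> v) :: 'v mpoly) ^ \<alpha> v))" for w
    have fD: "finite D" "D \<subseteq> V" "d \<in> V" "d \<notin> D" using insert by auto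
    have "(\<Sum>v\<in>V. Var v ^ \<alpha> d) * S D \<alpha> =
        (\<Sum>\<pi>\<in>P. (\<Sum>w\<in>V. Var (\<pi> w) ^ \<alpha> d) * (\<Prod>v\<in>D. Var (\<pi> v) ^ \<alpha> v))"
      unfolding S_def sum_distrib_left
    proof (rule sum.cong[OF refl])
      fix \<pi> assume "\<pi> \<in> P"
      then have "bij_betw \<pi> V V" by (simp add: P_def permutes_imp_bij)
      then have "(\<Sum>w\<in>V. Var (\<pi> w) ^ \<alpha> d) = (\<Sum>v\<in>V. Var v ^ \<alpha> d :: 'v mpoly)"
        by (rule sum.reindex_bij_betw)
      then show "(\<Sum>v\<in>V. Var v ^ \<alpha> d) * (\<Prod>v\<in>D. (Var (\<pi> v) :: 'v mpoly) ^ \<alpha> v) =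
          (\<Sum>w\<in>V. Var (\<pi> w) ^ \<alpha> d) * (\<Prod>v\<in>D. Var (\<pi> v) ^ \<alpha> v)"
        by simp
    qed
    also have "\<dots> = (\<Sum>w\<in>V. T w)"
      unfolding T_def sum_distrib_right by (rule sum.swap)
    also have "\<dots> = (\<Sum>w\<in>V - D. T w) + (\<Sum>w\<in>D. T w)"
      using V fD by (intro sum.subset_diff) auto
    also have "(\<Sum>w\<in>V - D. T w) = (\<Sum>w\<in>V - D. S (insert d D) \<alpha>)"
    proof (rule sum.cong[OF refl])
      fix w assume w: "w \<in> V - D"
      define g where "g \<pi> = Var (\<pi> d) ^ \<alpha> d * (\<Prod>v\<in>D. (Var (\<pi> v) :: 'v mpoly) ^ \<alpha> v)" for \<pi>
      have "transpose d w permutes V" using fD w by (intro permutes_swap_id) auto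
      then have "sum g P = (\<Sum>\<pi>\<in>P. g (\<pi> \<circ> transpose d w))"
        unfolding P_def by (rule sum_permutations_compose_right)
      also have "\<dots> = T w"
        unfolding T_def g_def using fD w
        by (intro sum.cong refl arg_cong2[where f = "(*)"] prod.cong) (auto simp: transpose_def)
      also have "sum g P = S (insert d D) \<alpha>"
        using fD by (simp add: S_def g_def)
      finally show "T w = S (insert d D) \<alpha>" by simp
    qed
    finally have eq: "(\<Sum>v\<in>V. Var v ^ \<alpha> d) * S D \<alpha> - (\<Sum>w\<in>D. T w) =
        Const (of_nat (card (V - D))) * S (insert d D) \<alpha>"
      by (intro mpoly_eqI) (simp add: algebra_simps)
    have T: "T w \<in> Alg" if w: "w \<in> D" for w
    proof -
      have "Var (\<pi> w) ^ \<alpha> d * (\<Prod>v\<in>D. (Var (\<pi> v) :: 'v mpoly) ^ \<alpha> v) =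
            (\<Prod>v\<in>D. Var (\<pi> v) ^ (\<alpha>(w := \<alpha> w + \<alpha> d)) v)" for \<pi>
        using prod.remove[OF fD(1) w, of "\<lambda>v. (Var (\<pi> v) :: 'v mpoly) ^ \<alpha> v"]
          prod.remove[OF fD(1) w, of "\<lambda>v. (Var (\<pi> v) :: 'v mpoly) ^ (\<alpha>(w := \<alpha> w + \<alpha> d)) v"]
        by (simp add: power_add algebra_simps)
      then have "T w = S D (\<alpha>(w := \<alpha> w + \<alpha> d))" by (simp add: T_def S_def)
      then show ?thesis using insert.IH fD by simp
    qed
    have "card (V - D) \<noteq> 0" using V fD by auto
    then have "S (insert d D) \<alpha> = Const (1 / of_nat (card (V - D))) *
        ((\<Sum>v\<in>V. Var v ^ \<alpha> d) * S D \<alpha> - (\<Sum>w\<in>D. T w))"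
      unfolding eq by (intro mpoly_eqI) simp
    also have "\<dots> \<in> Alg"
      by (intro mult C diff pow sum T insert.IH fD)
    finally show ?case .
  qed
  have "p = sym_avg V p"
    using sym_avg_invariant[OF V] sym_polysD(2)[OF p] by metis
  also have "\<dots> = Const (1 / fact (card V)) * (\<Sum>m\<in>keys p.
      Const (lookup p m) * S (keys m) (lookup m))"
    unfolding sym_avg_def smul_def P_def[symmetric] psubst_def S_def sum_distrib_left
    by (subst sum.swap) (rule refl)
  also have "\<dots> \<in> Alg"
    using sym_polysD(1)[OF p] by (intro mult sum C S) (auto simp: vars_def)
  finally show ?thesis .
qed

section \<open>Tensor products as spaces of invariants\<close>

lemma subspace_invariants:
  "mpoly.subspace {p. vars p \<subseteq> W \<and> (\<forall>\<pi>. Q \<pi> \<longrightarrow> act \<pi> p = p)}"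
  by (simp add: mpoly.subspace_def vars_addI vars_smulI)

text \<open>Replaces the span in the definition of the tensor product by a condition that can be
  checked on a given polynomial. The converse is \<open>invariants_in_span\<close> with two blocks,
  indexed by the booleans.\<close>

lemma sym_xy_iff:
  "g \<in> sym_xy l1 l2 \<longleftrightarrow> vars g \<subseteq> X ` {1..l1} \<union> Y ` {1..l2} \<and>
     (\<forall>\<pi>. \<pi> permutes X ` {1..l1} \<or> \<pi> permutes Y ` {1..l2} \<longrightarrow> act \<pi> g = g)" (is "_ \<longleftrightarrow> ?R g")
proof
  let ?X = "X ` {1..l1} :: nat xy set" and ?Y = "Y ` {1..l2} :: nat xy set"
  assume "g \<in> sym_xy l1 l2"
  then have "g \<in> mpoly.span {p * q | p q. p \<in> sym_polys ?X \<and> q \<in> sym_polys ?Y}"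
    by (simp add: sym_xy_def tensor_def)
  then show "?R g"
  proof (rule mpoly.span_induct)
    fix h assume "h \<in> {p * q | p q. p \<in> sym_polys ?X \<and> q \<in> sym_polys ?Y}"
    then obtain p q where h: "h = p * q" and p: "p \<in> sym_polys ?X" and q: "q \<in> sym_polys ?Y" by blast
    have "vars p \<inter> ?Y = {}" "vars q \<inter> ?X = {}"
      using sym_polysD(1)[OF p] sym_polysD(1)[OF q] by auto
    then have "act \<pi> p = p" "act \<pi> q = q" if "\<pi> permutes ?X \<or> \<pi> permutes ?Y" for \<pi>
      using that sym_polysD(2)[OF p, of \<pi>] sym_polysD(2)[OF q, of \<pi>]
        act_disjoint[of \<pi> ?X q] act_disjoint[of \<pi> ?Y p] by auto
    then show "?R h"
      using sym_polysD(1)[OF p] sym_polysD(1)[OF q] by (simp add: h vars_multI le_supI1 le_supI2)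
  qed (rule subspace_invariants)
next
  assume R: "?R g"
  define V where "V b = (if b then X ` {1..l1} else Y ` {1..l2} :: nat xy set)" for b
  have "g \<in> mpoly.span {\<Prod>b\<in>UNIV. f b | f. \<forall>b\<in>UNIV. f b \<in> sym_polys (V b)}"
    using R by (intro invariants_in_span) (auto simp: V_def UNIV_bool split: if_splits)
  also have "{\<Prod>b\<in>UNIV. f b | f. \<forall>b\<in>UNIV. f b \<in> sym_polys (V b)} \<subseteq>
      {p * q | p q. p \<in> sym_polys (X ` {1..l1}) \<and> q \<in> sym_polys (Y ` {1..l2})}"
  proof clarify
    fix f assume "\<forall>b\<in>UNIV. f b \<in> sym_polys (V b)"
    then have "f True \<in> sym_polys (V True)" "f False \<in> sym_polys (V False)"
      by blast+
    then have "f True \<in> sym_polys (X ` {1..l1})" "f False \<in> sym_polys (Y ` {1..l2})"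
      by (simp_all add: V_def)
    then show "\<exists>p q. (\<Prod>b\<in>UNIV. f b) = p * q \<and> p \<in> sym_polys (X ` {1..l1}) \<and> q \<in> sym_polys (Y ` {1..l2})"
      by (intro exI[of _ "f True"] exI[of _ "f False"]) (simp add: UNIV_bool mult.commute)
  qed
  finally (mpoly.span_mono[THEN subsetD, rotated]) show "g \<in> sym_xy l1 l2"
    by (simp add: sym_xy_def tensor_def)
qed

abbreviation group_vars :: "(nat \<times> nat \<Rightarrow> (nat \<times> nat) xy) \<Rightarrow> nat list \<Rightarrow> nat \<Rightarrow> (nat \<times> nat) xy set" where
  "group_vars V ps a \<equiv> (\<lambda>i. V (a, i)) ` {1..nparts ps a}"

lemma in_tensor_S_space:
  assumes vars: "vars p \<subseteq> X ` groups k ps \<union> Y ` groups k qs"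
    and invX: "\<And>a \<pi>. a \<in> {1..k} \<Longrightarrow> \<pi> permutes group_vars X ps a \<Longrightarrow> act \<pi> p = p"
    and invY: "\<And>b \<pi>. b \<in> {1..k} \<Longrightarrow> \<pi> permutes group_vars Y qs b \<Longrightarrow> act \<pi> p = p"
  shows "p \<in> tensor (S_space k X ps) (S_space k Y qs)"
proof -
  define V where "V = case_sum (group_vars X ps) (group_vars Y qs)"
  define E where "E = {1..k} <+> {1..k}"
  have "p \<in> mpoly.span {\<Prod>e\<in>E. f e | f. \<forall>e\<in>E. f e \<in> sym_polys (V e)}"
  proof (rule invariants_in_span)
    show "vars p \<subseteq> (\<Union>e\<in>E. V e)"
    proof
      fix v assume "v \<in> vars p"
      with vars consider a i where "v = X (a, i)" "(a, i) \<in> groups k ps"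
        | b j where "v = Y (b, j)" "(b, j) \<in> groups k qs" by fast
      then show "v \<in> (\<Union>e\<in>E. V e)"
      proof cases
        case 1
        then show ?thesis by (intro UN_I[of "Inl a"]) (auto simp: V_def E_def groups_def)
      next
        case 2
        then show ?thesis by (intro UN_I[of "Inr b"]) (auto simp: V_def E_def groups_def)
      qed
    qed
    show "act \<pi> p = p" if "e \<in> E" "\<pi> permutes V e" for e \<pi>
      using that invX invY by (cases e) (auto simp: V_def E_def)
    show "finite E" by (simp add: E_def)
    show "finite (V e)" for e by (cases e) (simp_all add: V_def)
    show "V e \<inter> V e' = {}" if "e \<noteq> e'" for e e'
      using that by (cases e; cases e') (auto simp: V_def)
  qed
  moreover have "{\<Prod>e\<in>E. f e | f. \<forall>e\<in>E. f e \<in> sym_polys (V e)} \<subseteq>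
     {p * q | p q. p \<in> S_space k X ps \<and> q \<in> S_space k Y qs}"
  proof clarify
    fix f assume f: "\<forall>e\<in>E. f e \<in> sym_polys (V e)"
    have fX: "f (Inl a) \<in> sym_polys (group_vars X ps a)"
      and fY: "f (Inr a) \<in> sym_polys (group_vars Y qs a)" if "a \<in> {1..k}" for a
      using bspec[OF f[unfolded E_def], OF InlI[OF that]] bspec[OF f[unfolded E_def], OF InrI[OF that]]
      by (simp_all add: V_def)
    have "(\<Prod>e\<in>E. f e) = (\<Prod>a\<in>{1..k}. f (Inl a)) * (\<Prod>b\<in>{1..k}. f (Inr b))"
      unfolding E_def by (simp add: prod.Plus)
    moreover have "(\<Prod>a\<in>{1..k}. f (Inl a)) \<in> S_space k X ps"
      unfolding S_space_def tensor_fam_def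
      by (rule mpoly.span_base) (use fX in blast)
    moreover have "(\<Prod>b\<in>{1..k}. f (Inr b)) \<in> S_space k Y qs"
      unfolding S_space_def tensor_fam_def
      by (rule mpoly.span_base) (use fY in blast)
    ultimately show "\<exists>p q. (\<Prod>e\<in>E. f e) = p * q \<and> p \<in> S_space k X ps \<and> q \<in> S_space k Y qs" by blast
  qed
  ultimately show ?thesis using mpoly.span_mono unfolding tensor_def by blast
qed

text \<open>Reduces the realization of arbitrary cofactors to that of the power sums of the groups
  of one size.\<close>

lemma tensor_S_space_subset:
  fixes Alg :: "(nat \<times> nat) xy mpoly set"
  assumes C: "\<And>c. Const c \<in> Alg" and add: "\<And>p q. p \<in> Alg \<Longrightarrow> q \<in> Alg \<Longrightarrow> p + q \<in> Alg"
    and mult: "\<And>p q. p \<in> Alg \<Longrightarrow> q \<in> Alg \<Longrightarrow> p * q \<in> Alg"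
    and powX: "\<And>a m. a \<in> {1..k} \<Longrightarrow> (\<Sum>v\<in>group_vars X ps a. Var v ^ m) \<in> Alg"
    and powY: "\<And>b m. b \<in> {1..k} \<Longrightarrow> (\<Sum>v\<in>group_vars Y qs b. Var v ^ m) \<in> Alg"
  shows "tensor (S_space k X ps) (S_space k Y qs) \<subseteq> Alg"
proof -
  have zero: "0 \<in> Alg" and one: "1 \<in> Alg" using C[of 0] C[of 1] by simp_all
  have sub: "mpoly.subspace Alg"
    unfolding mpoly.subspace_def smul_def using zero C add mult by blast
  have prod: "prod f A \<in> Alg" if "\<And>i. i \<in> A \<Longrightarrow> f i \<in> Alg" for f :: "nat \<Rightarrow> (nat \<times> nat) xy mpoly" and A
    using that by (induction A rule: infinite_finite_induct) (simp_all add: one mult)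
  have S: "S_space k V rs \<subseteq> Alg"
    if "\<And>a m. a \<in> {1..k} \<Longrightarrow> (\<Sum>v\<in>group_vars V rs a. Var v ^ m) \<in> Alg" for V rs
    unfolding S_space_def tensor_fam_def
  proof (rule mpoly.span_minimal[OF _ sub], clarify)
    fix f assume "\<forall>a\<in>{1..k}. f a \<in> sym_polys (group_vars V rs a)"
    then have f: "f a \<in> sym_polys (group_vars V rs a)" if "a \<in> {1..k}" for a
      using that by blast
    show "(\<Prod>a\<in>{1..k}. f a) \<in> Alg"
    proof (rule prod)
      fix a assume a: "a \<in> {1..k}"
      have "finite (group_vars V rs a)" by simp
      from power_sums_generate[OF this f[OF a] C add mult that[OF a]] show "f a \<in> Alg" .
    qed
  qed
  show ?thesis
    unfolding tensor_def
  proof (rule mpoly.span_minimal[OF _ sub], clarify)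
    fix p q assume "p \<in> S_space k X ps" "q \<in> S_space k Y qs"
    then show "p * q \<in> Alg" using S[OF powX] S[OF powY] mult by blast
  qed
qed

section \<open>Products of linear forms\<close>

lemma linear_dvdI:
  assumes u: "u \<notin> vars b" and Q: "psubst (Var(u := b)) Q = 0"
  shows "Var u - b dvd Q"
proof -
  have "(Var u - b) ^ 1 dvd Q"
  proof (rule linear_power_dvdI)
    fix z
    let ?l = "line (z(u := peval z b)) (\<lambda>v. if v = u then 1 else 0) Q"
    have "peval z (psubst (Var(u := b)) Q) = poly ?l 0"
      by (simp add: poly_line) (intro peval_cong, simp)
    then have "[:0, 1:] dvd ?l" using Q poly_eq_0_iff_dvd[of ?l 0] by simp
    then obtain q where q: "?l = [:0, 1:] * q" by (auto simp: dvd_def)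
    have "peval (z(u := peval z b + t)) Q = t ^ 1 * poly q t" for t
    proof -
      have "(\<lambda>v. (z(u := peval z b)) v + t * (if v = u then 1 else 0)) = z(u := peval z b + t)"
        by auto
      then have "peval (z(u := peval z b + t)) Q = poly ?l t" by (simp only: poly_line)
      then show ?thesis by (simp add: q)
    qed
    then show "\<exists>q. \<forall>t. peval (z(u := peval z b + t)) Q = t ^ 1 * poly q t" by blast
  qed
  then show ?thesis by simp
qed

text \<open>Stands in for the primality of \<open>Var u - b\<close>. Substituting \<open>b\<close>
  for \<open>u\<close> kills the product but not \<open>M\<close>, because \<open>M\<close> is
  non-zero at a point of the hyperplane; so it kills \<open>Q\<close>, and one linear factor can be
  cancelled at a time.\<close>

lemma linear_power_dvd_cofactor:
  assumes u: "u \<notin> vars b" and z: "z u = peval z b" "peval z M \<noteq> 0"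
    and dvd: "(Var u - b) ^ n dvd M * Q"
  shows "(Var u - b) ^ n dvd Q"
  using dvd
proof (induction n arbitrary: Q)
  case (Suc n)
  let ?E = "psubst (Var(u := b))"
  have b: "?E b = b"
    using psubst_cong[of b "Var(u := b)" Var] u by (metis fun_upd_other psubst_Var_id)
  obtain K where K: "M * Q = (Var u - b) ^ Suc n * K" using Suc.prems by (auto simp: dvd_def)
  then have "?E M * ?E Q = 0"
    using b by (simp add: psubst_mult[symmetric] del: psubst_mult) (simp add: psubst_mult)
  moreover have "peval z (?E M) = peval z M"
    using z(1) by (simp, intro peval_cong) simp
  then have "?E M \<noteq> 0" using z(2) by (metis peval_0)
  ultimately have "?E Q = 0" by (rule mpoly_no_zero_divisors)
  then obtain Q' where Q': "Q = (Var u - b) * Q'" using linear_dvdI[OF u] by (auto simp: dvd_def)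
  have "peval (z(u := z u + 1)) b = peval z b" using u by (intro peval_cong) auto
  then have "peval (z(u := z u + 1)) (Var u - b) \<noteq> 0" using z(1) by simp
  then have "Var u - b \<noteq> 0" by (metis peval_0)
  moreover have "(Var u - b) * (M * Q') = (Var u - b) * ((Var u - b) ^ n * K)"
    using K Q' by (simp add: algebra_simps)
  ultimately have "M * Q' = (Var u - b) ^ n * K" using mpoly_mult_left_cancel by blast
  then show ?case using Suc.IH[of Q'] Q' by (simp add: mult_dvd_mono)
qed simp

text \<open>Coprimality of the linear forms is expressed by \<open>pt\<close>: each hyperplane has a
  point that lies on none of the others.\<close>

lemma prod_linear_powers_dvd:
  assumes "finite I" and u: "\<And>i. i \<in> I \<Longrightarrow> u i \<notin> vars (b i)"
    and pt: "\<And>i. i \<in> I \<Longrightarrow> \<exists>z. z (u i) = peval z (b i) \<and> (\<forall>j\<in>I - {i}. z (u j) \<noteq> peval z (b j))"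
    and dvd: "\<And>i. i \<in> I \<Longrightarrow> (Var (u i) - b i) ^ n i dvd P"
  shows "(\<Prod>i\<in>I. (Var (u i) - b i) ^ n i) dvd P"
proof -
  have "(\<Prod>i\<in>J. (Var (u i) - b i) ^ n i) dvd P" if "J \<subseteq> I" for J
    using finite_subset[OF that assms(1)] that
  proof (induction J rule: finite_induct)
    case (insert i J)
    let ?M = "\<Prod>i\<in>J. (Var (u i) - b i) ^ n i"
    obtain Q where Q: "P = ?M * Q" using insert by (auto simp: dvd_def)
    obtain z where z: "z (u i) = peval z (b i)" "\<forall>j\<in>I - {i}. z (u j) \<noteq> peval z (b j)"
      using pt[of i] insert.prems by auto
    have "peval z ?M \<noteq> 0"
      using z(2) insert.hyps insert.prems by auto
    then have "(Var (u i) - b i) ^ n i dvd Q"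
      using linear_power_dvd_cofactor[OF u z(1), of ?M "n i" Q] dvd[of i] Q insert.prems by auto
    then show ?case using insert.hyps Q by (simp add: mult.commute mult_dvd_mono)
  qed simp
  then show ?thesis by blast
qed

lemma prod_differences_dvd:
  fixes P :: "'v mpoly"
  assumes R: "finite R" "\<And>u v. (u, v) \<in> R \<Longrightarrow> u \<noteq> v \<and> (v, u) \<notin> R" and U: "finite U"
    and dvdR: "\<And>u v. (u, v) \<in> R \<Longrightarrow> (Var u - Var v) ^ n u v dvd P"
    and dvdU: "\<And>u. u \<in> U \<Longrightarrow> Var u ^ m u dvd P"
  shows "(\<Prod>(u, v)\<in>R. (Var u - Var v) ^ n u v) * (\<Prod>u\<in>U. Var u ^ m u) dvd P"
proof -
  define I where "I = R <+> U"
  define u :: "('v \<times> 'v) + 'v \<Rightarrow> 'v" where "u = case_sum fst (\<lambda>x. x)"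
  define b :: "('v \<times> 'v) + 'v \<Rightarrow> 'v mpoly" where "b = case_sum (\<lambda>p. Var (snd p)) (\<lambda>_. 0)"
  define N where "N = case_sum (\<lambda>p. n (fst p) (snd p)) m"
  define W where "W = fst ` R \<union> snd ` R \<union> U"
  have W: "finite W" using R U by (simp add: W_def)
  then obtain f :: "'v \<Rightarrow> nat" where f: "inj_on f W" using finite_imp_inj_to_nat_seg by metis
  \<comment> \<open>Pairwise different values on \<open>W\<close>, and none of them zero because of
    \<open>Suc\<close>, so \<open>y\<close> avoids all the hyperplanes.\<close>
  define y where "y v = (of_nat (Suc (f v)) :: complex)" for v
  have y: "y v \<noteq> 0" for v unfolding y_def by (simp del: of_nat_Suc)
  have inj: "v = w" if "y v = y w" "v \<in> W" "w \<in> W" for v w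
    using that f by (auto simp: y_def dest: inj_onD simp del: of_nat_Suc)
  have mem: "fst p \<in> W" "snd p \<in> W" if "p \<in> R" for p using that by (auto simp: W_def)
  have "(\<Prod>i\<in>I. (Var (u i) - b i) ^ N i) dvd P"
  proof (rule prod_linear_powers_dvd)
    show "finite I" using R U by (simp add: I_def)
    show "u i \<notin> vars (b i)" if "i \<in> I" for i
      using that R(2) by (cases i) (auto simp: I_def u_def b_def)
    show "(Var (u i) - b i) ^ N i dvd P" if "i \<in> I" for i
      using that dvdR dvdU by (cases i) (auto simp: I_def u_def b_def N_def)
    fix i assume i: "i \<in> I"
    show "\<exists>z. z (u i) = peval z (b i) \<and> (\<forall>j\<in>I - {i}. z (u j) \<noteq> peval z (b j))"
    proof (cases i)
      case (Inl p)
      then obtain v w where p: "p = (v, w)" "(v, w) \<in> R" using i by (cases p) (auto simp: I_def)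
      have vw: "v \<in> W" "w \<in> W" "v \<noteq> w" "(w, v) \<notin> R" using mem p R(2) by force+
      \<comment> \<open>Identifies \<open>v\<close> with \<open>w\<close> and nothing else; only the
        pair \<open>(v, w)\<close> and its reverse vanish here, and the reverse is not in
        \<open>R\<close>.\<close>
      let ?z = "y(v := y w)"
      have "?z (u j) \<noteq> peval ?z (b j)" if jI: "j \<in> I - {i}" for j
      proof (cases j)
        case (Inl q)
        then obtain v' w' where q: "q = (v', w')" "(v', w') \<in> R" "(v', w') \<noteq> (v, w)"
          using jI p \<open>i = Inl p\<close> by (cases q) (auto simp: I_def)
        have q': "v' \<in> W" "w' \<in> W" "v' \<noteq> w'" "(v', w') \<noteq> (w, v)"
          using mem q R(2) vw by force+
        show ?thesis
          using q q' vw inj[of w' w] inj[of v' w] inj[of v' w'] inj[of w w']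
          by (auto simp: Inl u_def b_def)
      next
        case (Inr x)
        then show ?thesis using y by (simp add: u_def b_def)
      qed
      then show ?thesis using Inl p vw by (intro exI[of _ ?z]) (auto simp: u_def b_def)
    next
      case (Inr x)
      let ?z = "y(x := 0)"
      have "?z (u j) \<noteq> peval ?z (b j)" if jI: "j \<in> I - {i}" for j
      proof (cases j)
        case (Inl q)
        then obtain v' w' where q: "q = (v', w')" "(v', w') \<in> R"
          using jI by (cases q) (auto simp: I_def)
        have q': "v' \<in> W" "w' \<in> W" "v' \<noteq> w'" using mem q R(2) by force+
        show ?thesis using q q' inj[of v' w'] y by (auto simp: Inl u_def b_def dest: sym)
      next
        case (Inr x')
        then show ?thesis using y jI \<open>i = Inr x\<close> by (auto simp: u_def b_def)
      qed
      then show ?thesis using Inr by (intro exI[of _ ?z]) (auto simp: u_def b_def)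
    qed
  qed
  moreover have "(\<Prod>i\<in>I. (Var (u i) - b i) ^ N i) =
      (\<Prod>(u, v)\<in>R. (Var u - Var v) ^ n u v) * (\<Prod>u\<in>U. Var u ^ m u)"
    using R U by (simp add: I_def prod.Plus u_def b_def N_def case_prod_beta)
  ultimately show ?thesis by simp
qed

section \<open>The polynomial \<open>G\<close>\<close>

text \<open>Selects each unordered pair of distinct groups once, smaller size first, so that the
  smaller size appears in the exponent as in \<open>G_poly\<close>.\<close>

definition lex_less :: "nat \<times> nat \<Rightarrow> nat \<times> nat \<Rightarrow> bool" where
  "lex_less e f \<longleftrightarrow> fst e < fst f \<or> (fst e = fst f \<and> snd e < snd f)"

definition lex_pairs :: "nat \<Rightarrow> nat list \<Rightarrow> ((nat \<times> nat) \<times> (nat \<times> nat)) set" where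
  "lex_pairs k ps = {(e, f). e \<in> groups k ps \<and> f \<in> groups k ps \<and> lex_less e f}"

definition lin_pairs :: "nat \<Rightarrow> nat list \<Rightarrow> nat list \<Rightarrow> ((nat \<times> nat) xy \<times> (nat \<times> nat) xy) set" where
  "lin_pairs k ps qs = map_prod X X ` lex_pairs k ps \<union> map_prod Y Y ` lex_pairs k qs \<union>
     map_prod X Y ` (groups k ps \<times> groups k qs)"

fun expo :: "nat \<Rightarrow> (nat \<times> nat) xy \<Rightarrow> (nat \<times> nat) xy \<Rightarrow> nat" where
  "expo k (X e) (X f) = 2 * min (fst e) (fst f)"
| "expo k (Y e) (Y f) = 2 * min (fst e) (fst f)"
| "expo k (X e) (Y f) = fst e + fst f - k"
| "expo k (Y e) (X f) = fst e + fst f - k"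

section \<open>The polynomial \<open>G\<close> as a single product over pairs of groups\<close>

lemma prod_groups:
  "(\<Prod>e\<in>groups k ps. h e) = (\<Prod>a\<in>{1..k}. \<Prod>i\<in>{1..nparts ps a}. h (a, i))"
proof -
  have "groups k ps = Sigma {1..k} (\<lambda>a. {1..nparts ps a})" by (auto simp: groups_def)
  then show ?thesis by (simp add: prod.Sigma)
qed

lemma finite_lex_pairs [simp]: "finite (lex_pairs k ps)"
  by (rule finite_subset[of _ "groups k ps \<times> groups k ps"]) (auto simp: lex_pairs_def)

lemma prod_lex_pairs:
  "(\<Prod>(e, f)\<in>lex_pairs k ps. h e f) =
     (\<Prod>(a, a')\<in>{(a, a'). 1 \<le> a \<and> a < a' \<and> a' \<le> k}.
        \<Prod>i\<in>{1..nparts ps a}. \<Prod>j\<in>{1..nparts ps a'}. h (a, i) (a', j)) *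
     (\<Prod>a\<in>{1..k}. \<Prod>(i, j)\<in>{(i, j). 1 \<le> i \<and> i < j \<and> j \<le> nparts ps a}. h (a, i) (a, j))"
proof -
  let ?P = "{(a, a'). 1 \<le> a \<and> a < a' \<and> a' \<le> k}"
  let ?Q = "\<lambda>a. {(i, j). 1 \<le> i \<and> i < j \<and> j \<le> nparts ps a}"
  define A where "A = {(e, f) \<in> lex_pairs k ps. fst e < fst f}"
  define B where "B = {(e, f) \<in> lex_pairs k ps. fst e = fst f}"
  have finP: "finite ?P" by (rule finite_subset[of _ "{1..k} \<times> {1..k}"]) auto
  have finQ: "finite (?Q a)" for a
    by (rule finite_subset[of _ "{1..nparts ps a} \<times> {1..nparts ps a}"]) auto
  have AB: "lex_pairs k ps = A \<union> B" "A \<inter> B = {}" "finite A" "finite B"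
    by (auto simp: A_def B_def lex_pairs_def lex_less_def intro: finite_subset[OF _ finite_lex_pairs[of k ps]])
  have "(\<Prod>(e, f)\<in>A. h e f) =
      (\<Prod>(p, q)\<in>Sigma ?P (\<lambda>p. {1..nparts ps (fst p)} \<times> {1..nparts ps (snd p)}). h (fst p, fst q) (snd p, snd q))"
    by (rule prod.reindex_bij_witness[where
          i = "\<lambda>(p, q). ((fst p, fst q), (snd p, snd q))" and j = "\<lambda>(e, f). ((fst e, fst f), (snd e, snd f))"])
      (auto simp: A_def lex_pairs_def lex_less_def groups_def)
  also have "\<dots> = (\<Prod>p\<in>?P. \<Prod>q\<in>{1..nparts ps (fst p)} \<times> {1..nparts ps (snd p)}. h (fst p, fst q) (snd p, snd q))"
    by (rule prod.Sigma[symmetric, OF finP]) simp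
  also have "\<dots> = (\<Prod>(a, a')\<in>?P. \<Prod>i\<in>{1..nparts ps a}. \<Prod>j\<in>{1..nparts ps a'}. h (a, i) (a', j))"
    by (simp add: case_prod_beta prod.cartesian_product)
  finally have 1: "(\<Prod>(e, f)\<in>A. h e f) = \<dots>" .
  have "(\<Prod>(e, f)\<in>B. h e f) = (\<Prod>(a, q)\<in>Sigma {1..k} ?Q. h (a, fst q) (a, snd q))"
    by (rule prod.reindex_bij_witness[where
          i = "\<lambda>(a, q). ((a, fst q), (a, snd q))" and j = "\<lambda>(e, f). (fst e, (snd e, snd f))"])
      (auto simp: B_def lex_pairs_def lex_less_def groups_def)
  also have "\<dots> = (\<Prod>a\<in>{1..k}. \<Prod>q\<in>?Q a. h (a, fst q) (a, snd q))"
    by (rule prod.Sigma[symmetric]) (use finQ in blast)+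
  finally have 2: "(\<Prod>(e, f)\<in>B. h e f) = (\<Prod>a\<in>{1..k}. \<Prod>(i, j)\<in>?Q a. h (a, i) (a, j))"
    by (simp add: case_prod_beta)
  show ?thesis using AB 1 2 by (simp add: prod.union_disjoint)
qed

lemma prod_lex_pairs_power:
  fixes D :: "nat \<times> nat \<Rightarrow> 'v"
  shows "(\<Prod>(e, f)\<in>lex_pairs k ps. (Var (D e) - Var (D f)) ^ (2 * min (fst e) (fst f))) =
     (\<Prod>(a, a')\<in>{(a, a'). 1 \<le> a \<and> a < a' \<and> a' \<le> k}.
        \<Prod>i\<in>{1..nparts ps a}. \<Prod>j\<in>{1..nparts ps a'}. (Var (D (a, i)) - Var (D (a', j))) ^ (2 * a)) *
     (\<Prod>a\<in>{1..k}. \<Prod>(i, j)\<in>{(i, j). 1 \<le> i \<and> i < j \<and> j \<le> nparts ps a}.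
        (Var (D (a, i)) - Var (D (a, j))) ^ (2 * a))"
  by (subst prod_lex_pairs) (simp add: case_prod_beta min_def cong: prod.cong_simp)

lemma G_poly_eq:
  "G_poly k b0 ps qs = (\<Prod>(u, v)\<in>lin_pairs k ps qs. (Var u - Var v) ^ expo k u v) *
     (\<Prod>u\<in>X ` groups k ps. Var u ^ (case u of X e \<Rightarrow> fst e - b0 | Y e \<Rightarrow> 0))"
proof -
  let ?h = "\<lambda>(u, v). (Var u - Var v :: (nat \<times> nat) xy mpoly) ^ expo k u v"
  have U: "prod ?h (lin_pairs k ps qs) = prod ?h (map_prod X X ` lex_pairs k ps) *
      prod ?h (map_prod Y Y ` lex_pairs k qs) * prod ?h (map_prod X Y ` (groups k ps \<times> groups k qs))"
    unfolding lin_pairs_def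
    by (subst prod.union_disjoint, auto)+
  have XX: "prod ?h (map_prod X X ` lex_pairs k ps) =
      (\<Prod>(e, f)\<in>lex_pairs k ps. (Var (X e) - Var (X f)) ^ (2 * min (fst e) (fst f)))"
    by (subst prod.reindex) (auto simp: inj_on_def case_prod_beta intro!: prod.cong)
  have YY: "prod ?h (map_prod Y Y ` lex_pairs k qs) =
      (\<Prod>(e, f)\<in>lex_pairs k qs. (Var (Y e) - Var (Y f)) ^ (2 * min (fst e) (fst f)))"
    by (subst prod.reindex) (auto simp: inj_on_def case_prod_beta intro!: prod.cong)
  have "prod ?h (map_prod X Y ` (groups k ps \<times> groups k qs)) =
      (\<Prod>e\<in>groups k ps. \<Prod>f\<in>groups k qs. (Var (X e) - Var (Y f)) ^ (fst e + fst f - k))"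
    by (subst prod.reindex) (auto simp: inj_on_def case_prod_beta prod.cartesian_product intro!: prod.cong)
  also have "\<dots> = (\<Prod>a\<in>{1..k}. \<Prod>b\<in>{1..k}. \<Prod>i\<in>{1..nparts ps a}. \<Prod>j\<in>{1..nparts qs b}.
        (xv a i - yv b j) ^ (a + b - k))"
    unfolding prod_groups fst_conv by (rule prod.cong[OF refl], rule prod.swap)
  also have "\<dots> = (\<Prod>(a, b)\<in>{1..k} \<times> {1..k}. \<Prod>i\<in>{1..nparts ps a}. \<Prod>j\<in>{1..nparts qs b}.
        (xv a i - yv b j) ^ (a + b - k))"
    by (simp add: prod.cartesian_product)
  also have "\<dots> = (\<Prod>(a, b)\<in>{(a, b). 1 \<le> a \<and> a \<le> k \<and> 1 \<le> b \<and> b \<le> k \<and> a + b > k}.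
        \<Prod>i\<in>{1..nparts ps a}. \<Prod>j\<in>{1..nparts qs b}. (xv a i - yv b j) ^ (a + b - k))"
  \<comment> \<open>For \<open>a + b\<close> at most \<open>k\<close> the truncated exponent is 0,
    so these pairs contribute the factor 1.\<close>
  proof (rule prod.mono_neutral_right)
    have "(\<Prod>i\<in>{1..nparts ps a}. \<Prod>j\<in>{1..nparts qs b}. (xv a i - yv b j) ^ (a + b - k)) = 1"
      if "\<not> k < a + b" for a b
      using that by simp
    then show "\<forall>p\<in>{1..k} \<times> {1..k} - {(a, b). 1 \<le> a \<and> a \<le> k \<and> 1 \<le> b \<and> b \<le> k \<and> a + b > k}.
        (case p of (a, b) \<Rightarrow> \<Prod>i\<in>{1..nparts ps a}. \<Prod>j\<in>{1..nparts qs b}.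
          (xv a i - yv b j) ^ (a + b - k)) = 1"
      by fastforce
  qed auto
  finally have XY: "prod ?h (map_prod X Y ` (groups k ps \<times> groups k qs)) = \<dots>" .
  have "(\<Prod>u\<in>X ` groups k ps. (Var u :: (nat \<times> nat) xy mpoly) ^ (case u of X e \<Rightarrow> fst e - b0 | Y e \<Rightarrow> 0)) =
      (\<Prod>a\<in>{1..k}. \<Prod>j\<in>{1..nparts ps a}. xv a j ^ (a - b0))"
    by (subst prod.reindex) (auto simp: inj_on_def prod_groups)
  then show ?thesis
    unfolding G_poly_def U XX YY XY prod_lex_pairs_power by (simp only: mult.assoc)
qed

section \<open>Divisibility of the specializations\<close>

definition gmap :: "nat \<Rightarrow> nat list \<Rightarrow> nat list \<Rightarrow> nat xy \<Rightarrow> (nat \<times> nat) xy" where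
  "gmap k ps qs v = (case v of X i \<Rightarrow> X (grouping k ps i) | Y j \<Rightarrow> Y (grouping k qs j))"

lemma gmap_simps [simp]:
  "gmap k ps qs (X i) = X (grouping k ps i)" "gmap k ps qs (Y j) = Y (grouping k qs j)"
  by (simp_all add: gmap_def)

lemma phi_eq: "phi k ps qs g = psubst (\<lambda>v. Var (gmap k ps qs v)) g"
  unfolding phi_def by (rule psubst_cong) (simp add: gmap_def split: xy.splits)

lemma peval_phi: "peval z (phi k ps qs g) = peval (\<lambda>v. z (gmap k ps qs v)) g"
  by (simp add: phi_eq)


definition perm_xy :: "(nat \<Rightarrow> nat) \<Rightarrow> (nat \<Rightarrow> nat) \<Rightarrow> nat xy \<Rightarrow> nat xy" where
  "perm_xy \<pi> \<rho> v = (case v of X i \<Rightarrow> X (\<pi> i) | Y j \<Rightarrow> Y (\<rho> j))"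

lemma perm_xy_simps [simp]: "perm_xy \<pi> \<rho> (X i) = X (\<pi> i)" "perm_xy \<pi> \<rho> (Y j) = Y (\<rho> j)"
  by (simp_all add: perm_xy_def)

lemma perm_xy_permutes:
  assumes "\<pi> permutes S"
  shows "perm_xy \<pi> id permutes X ` S" "perm_xy id \<pi> permutes Y ` S"
proof -
  note p = permutes_image[OF assms] permutes_inj[OF assms] permutes_not_in[OF assms]
  show "perm_xy \<pi> id permutes X ` S"
  proof (rule bij_imp_permutes)
    have "perm_xy \<pi> id ` X ` S = X ` \<pi> ` S" by (simp add: image_image)
    then show "bij_betw (perm_xy \<pi> id) (X ` S) (X ` S)"
      using p(1) injD[OF p(2)] by (auto simp: bij_betw_def intro!: inj_onI)
    show "perm_xy \<pi> id v = v" if "v \<notin> X ` S" for v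
      using that p(3) by (cases v) auto
  qed
  show "perm_xy id \<pi> permutes Y ` S"
  proof (rule bij_imp_permutes)
    have "perm_xy id \<pi> ` Y ` S = Y ` \<pi> ` S" by (simp add: image_image)
    then show "bij_betw (perm_xy id \<pi>) (Y ` S) (Y ` S)"
      using p(1) injD[OF p(2)] by (auto simp: bij_betw_def intro!: inj_onI)
    show "perm_xy id \<pi> v = v" if "v \<notin> Y ` S" for v
      using that p(3) by (cases v) auto
  qed
qed

lemma sym_xy_peval:
  assumes "g \<in> sym_xy l1 l2" "\<pi> permutes X ` {1..l1} \<or> \<pi> permutes Y ` {1..l2}"
  shows "peval (\<lambda>v. z (\<pi> v)) g = peval z g"
proof -
  have "act \<pi> g = g" using assms by (auto simp: sym_xy_iff)
  then show ?thesis using peval_psubst[of z "\<lambda>v. Var (\<pi> v)" g] by simp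
qed

lemma sym_xy_peval_perm:
  assumes "g \<in> sym_xy l1 l2" "\<pi> permutes {1..l1}" "\<rho> permutes {1..l2}"
  shows "peval (\<lambda>v. z (perm_xy \<pi> \<rho> v)) g = peval z g"
proof -
  have "peval (\<lambda>v. z (perm_xy \<pi> id v)) g = peval z g"
    by (rule sym_xy_peval[OF assms(1)]) (use perm_xy_permutes(1)[OF assms(2)] in blast)
  moreover have "peval (\<lambda>v. (\<lambda>v. z (perm_xy \<pi> id v)) (perm_xy id \<rho> v)) g = peval (\<lambda>v. z (perm_xy \<pi> id v)) g"
    by (rule sym_xy_peval[OF assms(1)]) (use perm_xy_permutes(2)[OF assms(3)] in blast)
  moreover have "perm_xy \<pi> id (perm_xy id \<rho> v) = perm_xy \<pi> \<rho> v" for v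
    by (cases v) simp_all
  ultimately show ?thesis by simp
qed

lemma sym_xy_vars: "g \<in> sym_xy l1 l2 \<Longrightarrow> vars g \<subseteq> X ` {1..l1} \<union> Y ` {1..l2}"
  by (simp add: sym_xy_iff)

text \<open>Carries the conditions in \<open>I_space\<close>, stated for the first few variables,
  over to arbitrary sets of variables of the same size.\<close>

lemma permutes_onto:
  assumes "A \<subseteq> {1..n}"
  shows "\<exists>\<pi>. \<pi> permutes {1..n} \<and> (\<forall>i\<in>{1..card A}. \<pi> i \<in> A)"
proof -
  have le: "card A \<le> n" using card_mono[OF _ assms] by simp
  have "\<exists>\<pi>. \<pi> permutes {1..n} \<and> (\<forall>i\<in>{1..n}. (\<pi> i \<in> A) = (i \<in> {1..card A}))"
  proof (rule permutes_matching)
    fix b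
    have "{i \<in> {1..n}. i \<in> A} = A" "{i \<in> {1..n}. i \<notin> A} = {1..n} - A"
      "{i \<in> {1..n}. i \<in> {1..card A}} = {1..card A}"
      "{i \<in> {1..n}. i \<notin> {1..card A}} = {1..n} - {1..card A}" using assms le by auto
    moreover have "card ({1..n} - A) = n - card A" "card ({1..n} - {1..card A}) = n - card A"
      using assms le by (auto simp: card_Diff_subset finite_subset)
    ultimately show "card {i \<in> {1..n}. (i \<in> A) = b} = card {i \<in> {1..n}. (i \<in> {1..card A}) = b}"
      by (cases b) (simp_all only: simp_thms, simp)
  qed simp
  then show ?thesis using le by (meson atLeastAtMost_iff order_trans)
qed

lemma I_spaceD:
  assumes "g \<in> I_space k b0 l1 l2"
  shows "g \<in> sym_xy l1 l2"
    and "a + b = k + 1 \<Longrightarrow> a \<le> l1 \<Longrightarrow> b \<le> l2 \<Longrightarrow> \<forall>i\<in>{1..a}. z (X i) = t \<Longrightarrow>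
      \<forall>j\<in>{1..b}. z (Y j) = t \<Longrightarrow> peval z g = 0"
    and "b0 + 1 \<le> l1 \<Longrightarrow> \<forall>i\<in>{1..b0 + 1}. z (X i) = 0 \<Longrightarrow> peval z g = 0"
  using assms unfolding I_space_def by blast+

lemma I_space_vanish:
  assumes g: "g \<in> I_space k b0 l1 l2" and A: "A \<subseteq> {1..l1}" and B: "B \<subseteq> {1..l2}"
    and card: "card A + card B = k + 1"
    and z: "\<And>i. i \<in> A \<Longrightarrow> z (X i) = t" "\<And>j. j \<in> B \<Longrightarrow> z (Y j) = t"
  shows "peval z g = 0"
proof -
  obtain \<pi> \<rho> where \<pi>: "\<pi> permutes {1..l1}" "\<forall>i\<in>{1..card A}. \<pi> i \<in> A"
    and \<rho>: "\<rho> permutes {1..l2}" "\<forall>i\<in>{1..card B}. \<rho> i \<in> B"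
    using permutes_onto[OF A] permutes_onto[OF B] by blast
  have "card A \<le> l1" "card B \<le> l2" using card_mono[OF _ A] card_mono[OF _ B] by simp_all
  then have "peval (\<lambda>v. z (perm_xy \<pi> \<rho> v)) g = 0"
    using I_spaceD(2)[OF g card, of "\<lambda>v. z (perm_xy \<pi> \<rho> v)" t] z \<pi>(2) \<rho>(2) by simp
  then show ?thesis using sym_xy_peval_perm[OF I_spaceD(1)[OF g] \<pi>(1) \<rho>(1)] by simp
qed

lemma I_space_vanish_0:
  assumes g: "g \<in> I_space k b0 l1 l2" and A: "A \<subseteq> {1..l1}" and card: "card A = b0 + 1"
    and z: "\<And>i. i \<in> A \<Longrightarrow> z (X i) = 0"
  shows "peval z g = 0"
proof -
  obtain \<pi> where \<pi>: "\<pi> permutes {1..l1}" "\<forall>i\<in>{1..card A}. \<pi> i \<in> A"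
    using permutes_onto[OF A] by blast
  have "card A \<le> l1" using card_mono[OF _ A] by simp
  then have "peval (\<lambda>v. z (perm_xy \<pi> id v)) g = 0"
    using I_spaceD(3)[OF g, of "\<lambda>v. z (perm_xy \<pi> id v)"] card z \<pi>(2) by simp
  then show ?thesis using sym_xy_peval_perm[OF I_spaceD(1)[OF g] \<pi>(1) permutes_id] by simp
qed

text \<open>\<open>Inl\<close> is the color of an old group, \<open>Inr i\<close> makes the variable
  \<open>i\<close> a class of its own. The variables left behind in \<open>e\<close> become
  singletons because \<open>order_of_joining\<close> needs vanishing at arbitrary values of
  them.\<close>

definition joined :: "nat \<Rightarrow> nat list \<Rightarrow> nat \<times> nat \<Rightarrow> nat \<times> nat \<Rightarrow> nat \<Rightarrow> nat \<Rightarrow> (nat \<times> nat) + nat" where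
  "joined k ps e f u i = (if i = u then Inl f else if grouping k ps i = e then Inr i else Inl (grouping k ps i))"

text \<open>Moving one variable \<open>u\<close> from the group \<open>e\<close> to a group \<open>f\<close> which is at least as large, and
  making singletons of the rest of \<open>e\<close>, gives a larger partition.\<close>

lemma joining_partition:
  assumes ps: "restricted_partition k n ps" and ef: "e \<in> groups k ps" "f \<in> groups k ps" "e \<noteq> f"
    and le: "fst e \<le> fst f" "fst f < k" and u: "u \<in> {1..n}" "grouping k ps u = e"
  obtains \<nu> \<pi> \<delta> where "restricted_partition k n \<nu>" "lex_gt \<nu> ps" "\<pi> permutes {1..n}"
    "\<And>i. i \<in> {1..n} \<Longrightarrow> joined k ps e f u (\<pi> i) = \<delta> (grouping k \<nu> i)"
proof -
  note P = restricted_partitionD[OF ps]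
  let ?c = "joined k ps e f u"
  let ?fib = "\<lambda>j. card {i\<in>{1..n}. ?c i = j}"
  have grp: "grouping k ps i \<in> groups k ps" if "i \<in> {1..n}" for i
    using grouping_in[OF P(1)] that P(2) by simp
  have cg: "card {i\<in>{1..n}. grouping k ps i = h} = fst h" if "h \<in> groups k ps" for h
    using card_grouping[OF P(1) that] P(2) by simp
  have "{i\<in>{1..n}. ?c i = Inl f} = insert u {i\<in>{1..n}. grouping k ps i = f}"
    using u ef by (auto simp: joined_def)
  then have fib_f: "?fib (Inl f) = Suc (fst f)"
    using cg[OF ef(2)] u ef by simp
  have "{i\<in>{1..n}. ?c i = Inl h} = {i\<in>{1..n}. grouping k ps i = h}" if "h \<noteq> e" "h \<noteq> f" for h
    using that u by (auto simp: joined_def)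
  then have fib_h: "?fib (Inl h) = fst h" if "h \<in> groups k ps" "h \<noteq> e" "h \<noteq> f" for h
    using cg that by simp
  have "{i\<in>{1..n}. ?c i = Inr r} \<subseteq> {r}" for r by (auto simp: joined_def split: if_splits)
  then have "?fib (Inr r) \<le> card {r}" for r by (intro card_mono) auto
  then have fib_r: "?fib (Inr r) \<le> 1" for r by simp
  have none: "?fib (Inl h) = 0" if "h \<notin> groups k ps \<or> h = e" for h
    using that ef grp by (auto simp: joined_def split: if_splits)
  have lek: "fst h \<le> k" if "h \<in> groups k ps" for h using that by (auto simp: groups_def)
  have posf: "1 \<le> fst f" using ef by (auto simp: groups_def)
  have fibk: "?fib j \<le> k" for j
  proof (cases j)
    case (Inl h)
    consider "h = f" | "h \<in> groups k ps" "h \<noteq> e" "h \<noteq> f" | "h \<notin> groups k ps \<or> h = e" by blast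
    then have "?fib (Inl h) \<le> k"
    proof cases
      case 1
      then show ?thesis using fib_f le by simp
    next
      case 2
      then show ?thesis using fib_h[OF 2] lek[OF 2(1)] by simp
    next
      case 3
      from none[OF this] show ?thesis by linarith
    qed
    then show ?thesis by (simp only: Inl)
  next
    case (Inr r)
    then show ?thesis using fib_r[of r] le by simp
  qed
  obtain \<nu> \<pi> \<delta> where \<nu>: "restricted_partition k n \<nu>"
    and cnt: "\<And>a. count_list \<nu> a = card {j\<in>?c ` {1..n}. ?fib j = a}"
    and \<pi>: "\<pi> permutes {1..n}" "\<And>i. i \<in> {1..n} \<Longrightarrow> ?c (\<pi> i) = \<delta> (grouping k \<nu> i)"
    by (rule shape_of_coloring[of n ?c k, OF fibk], rule that)
  have in_c: "j \<in> ?c ` {1..n} \<longleftrightarrow> ?fib j \<noteq> 0" for j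
  proof -
    have "j \<in> ?c ` {1..n} \<longleftrightarrow> {i\<in>{1..n}. ?c i = j} \<noteq> {}" by blast
    moreover have "finite {i\<in>{1..n}. ?c i = j}" by simp
    ultimately show ?thesis by (simp only: card_eq_0_iff) blast
  qed
  have cps: "count_list ps s = card {h \<in> groups k ps. fst h = s}" for s
  proof -
    have "card {h \<in> groups k ps. fst h = s} = length (filter (\<lambda>x. x = s) ps)"
      by (rule card_groups[OF P(1)])
    also have "\<dots> = count_list ps s" by (induction ps) auto
    finally show ?thesis by simp
  qed
  \<comment> \<open>The group \<open>f\<close> has grown to size \<open>Suc (fst f)\<close>, and
    \<open>e\<close> was not larger than \<open>f\<close>. So multiplicities are unchanged beyond
    this size and increase at it, the situation of \<open>lex_gtI\<close>.\<close>
  have above: "count_list \<nu> s = count_list ps s" if s: "s > Suc (fst f)" for s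
  proof -
    have "j \<in> ?c ` {1..n} \<and> ?fib j = s \<longleftrightarrow> j \<in> Inl ` {h \<in> groups k ps. fst h = s}" for j
    proof (cases j)
      case (Inl h)
      consider "h = f" | "h \<in> groups k ps" "h \<noteq> e" "h \<noteq> f" | "h \<notin> groups k ps \<or> h = e" by blast
      then have fib_s: "?fib (Inl h) = s \<longleftrightarrow> h \<in> groups k ps \<and> fst h = s"
      proof cases
        case 1
        then show ?thesis using fib_f s by simp
      next
        case 2
        then show ?thesis using fib_h[OF 2] by simp
      next
        case 3
        have "?fib (Inl h) \<noteq> s" using none[OF 3] s by linarith
        moreover have "fst e \<noteq> s" using le s by linarith
        ultimately show ?thesis using 3 by blast
      qed
      have "j \<in> ?c ` {1..n} \<and> ?fib j = s \<longleftrightarrow> ?fib (Inl h) = s"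
        unfolding Inl in_c using s by linarith
      also have "\<dots> \<longleftrightarrow> h \<in> groups k ps \<and> fst h = s" by (rule fib_s)
      also have "\<dots> \<longleftrightarrow> j \<in> Inl ` {h \<in> groups k ps. fst h = s}" unfolding Inl by blast
      finally show ?thesis .
    next
      case (Inr r)
      have "?fib (Inr r) \<noteq> s" using fib_r[of r] s by linarith
      then show ?thesis unfolding Inr by blast
    qed
    then have "{j\<in>?c ` {1..n}. ?fib j = s} = Inl ` {h \<in> groups k ps. fst h = s}" by blast
    then show ?thesis by (simp add: cnt cps card_image)
  qed
  have at: "count_list ps (Suc (fst f)) < count_list \<nu> (Suc (fst f))"
  proof -
    let ?S = "{h \<in> groups k ps. fst h = Suc (fst f)}"
    let ?I = "Inl ` insert f ?S :: ((nat \<times> nat) + nat) set"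
    have "?I \<subseteq> {j\<in>?c ` {1..n}. ?fib j = Suc (fst f)}"
    proof
      fix j :: "(nat \<times> nat) + nat" assume "j \<in> ?I"
      then obtain h where h: "j = Inl h" "h = f \<or> h \<in> ?S" by blast
      from h(2) have "?fib (Inl h) = Suc (fst f)"
      proof
        assume hS: "h \<in> ?S"
        then have "h \<noteq> e" "h \<noteq> f" using le by auto
        then show ?thesis using fib_h[of h] hS by simp
      qed (use fib_f in simp)
      then have "?fib j = Suc (fst f)" by (simp only: h(1))
      moreover from this have "j \<in> ?c ` {1..n}" unfolding in_c by linarith
      ultimately show "j \<in> {j\<in>?c ` {1..n}. ?fib j = Suc (fst f)}" by blast
    qed
    then have "card ?I \<le> count_list \<nu> (Suc (fst f))"
      unfolding cnt by (rule card_mono[rotated]) simp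
    moreover have "card ?I = Suc (card ?S)"
    proof -
      have "card ?I = card (insert f ?S)" by (rule card_image) (auto simp: inj_on_def)
      also have "\<dots> = Suc (card ?S)" by simp
      finally show ?thesis .
    qed
    ultimately show ?thesis by (simp add: cps)
  qed
  have "lex_gt \<nu> ps"
    using restricted_partitionD(3)[OF \<nu>] P(3) above at by (intro lex_gtI[where T = "Suc (fst f)"]) auto
  then show thesis using that \<nu> \<pi> by blast
qed

text \<open>After the permutation such a point depends only on the groups of \<open>\<nu>\<close>,
  so evaluating a symmetric polynomial there is evaluating its specialization at
  \<open>\<nu>\<close>.\<close>

lemma joining_partition_values:
  assumes \<pi>: "\<pi> permutes {1..n}" "\<forall>i\<in>{1..n}. joined k ps e f u (\<pi> i) = \<delta> (grouping k \<nu> i)"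
    and w: "\<forall>i\<in>{1..n}. i = u \<or> grouping k ps i = f \<longrightarrow> \<zeta> i = w"
    and z: "\<forall>i\<in>{1..n}. grouping k ps i \<noteq> e \<and> grouping k ps i \<noteq> f \<longrightarrow> \<zeta> i = z (grouping k ps i)"
  shows "\<exists>z'. \<forall>i\<in>{1..n}. \<zeta> (\<pi> i) = z' (grouping k \<nu> i)"
proof (intro exI ballI)
  fix i assume i: "i \<in> {1..n}"
  define \<xi> where "\<xi> = case_sum (z(f := w)) \<zeta>"
  have \<pi>i: "\<pi> i \<in> {1..n}" using i \<pi>(1) by (simp add: permutes_in_image del: atLeastAtMost_iff)
  have "\<zeta> (\<pi> i) = \<xi> (joined k ps e f u (\<pi> i))"
    using bspec[OF w \<pi>i] bspec[OF z \<pi>i] by (auto simp: \<xi>_def joined_def)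
  then show "\<zeta> (\<pi> i) = (\<lambda>h. case_sum (z(f := w)) \<zeta> (\<delta> h)) (grouping k \<nu> i)"
    using bspec[OF \<pi>(2) i] by (simp add: \<xi>_def)
qed

text \<open>The injections \<open>C\<close> of the indices and \<open>D\<close> of the groups make
  the statement serve the x- and the y-variables alike. What remains to be supplied is
  \<open>van\<close>: vanishing once a single variable of \<open>e\<close> has joined
  \<open>f\<close>.\<close>

lemma joining_dvd:
  fixes g :: "nat xy mpoly" and C :: "nat \<Rightarrow> nat xy" and D :: "nat \<times> nat \<Rightarrow> (nat \<times> nat) xy"
  assumes rs: "restricted_partition k n rs" and ef: "e \<in> groups k rs" "f \<in> groups k rs" "e \<noteq> f"
    and inj: "inj C" "inj D" and \<gamma>C: "\<And>i. \<gamma> (C i) = D (grouping k rs i)"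
    and \<gamma>D: "\<And>v. v \<in> vars g \<Longrightarrow> v \<notin> C ` {1..n} \<Longrightarrow> \<gamma> v \<notin> range D"
    and sym: "\<And>\<zeta> i j. i \<in> {1..n} \<Longrightarrow> j \<in> {1..n} \<Longrightarrow> peval (\<zeta> \<circ> transpose (C i) (C j)) g = peval \<zeta> g"
    and van: "\<And>\<zeta> z u w. u \<in> {1..n} \<Longrightarrow> grouping k rs u = e \<Longrightarrow>
        (\<And>i. i \<in> {1..n} \<Longrightarrow> i = u \<or> grouping k rs i = f \<Longrightarrow> \<zeta> (C i) = w) \<Longrightarrow>
        (\<And>i. i \<in> {1..n} \<Longrightarrow> grouping k rs i \<noteq> e \<Longrightarrow> grouping k rs i \<noteq> f \<Longrightarrow> \<zeta> (C i) = z (D (grouping k rs i))) \<Longrightarrow>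
        (\<And>v. v \<in> vars g \<Longrightarrow> v \<notin> C ` {1..n} \<Longrightarrow> \<zeta> v = z (\<gamma> v)) \<Longrightarrow> peval \<zeta> g = 0"
  shows "(Var (D e) - Var (D f)) ^ (2 * fst e) dvd psubst (\<lambda>v. Var (\<gamma> v)) g"
proof (rule linear_power_dvdI)
  fix z :: "(nat \<times> nat) xy \<Rightarrow> complex"
  note P = restricted_partitionD[OF rs]
  define F where "F h = {i\<in>{1..n}. grouping k rs i = h}" for h
  let ?A = "C ` F e" and ?B = "C ` F f" and ?w = "z (D f)"
  have cardA: "card ?A = fst e"
    using card_grouping[OF P(1) ef(1)] P(2) inj(1) by (simp add: F_def card_image inj_on_subset)
  have "\<exists>q. \<forall>t. peval (\<lambda>v. if v \<in> ?A then ?w + t else if v \<in> ?B then ?w else z (\<gamma> v)) g =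
               t ^ (2 * card ?A) * poly q t"
  proof (rule order_of_joining)
    show "?A \<inter> ?B = {}" using ef inj by (auto simp: F_def dest: injD)
    show "peval (\<zeta> \<circ> transpose i j) g = peval \<zeta> g" if "i \<in> ?A \<union> ?B" "j \<in> ?A \<union> ?B" for \<zeta> i j
      using that sym by (auto simp: F_def)
    fix \<zeta> v w assume *: "v \<in> ?A" "\<And>v'. v' \<in> insert v ?B \<Longrightarrow> \<zeta> v' = w"
      "\<And>v. v \<notin> ?A \<union> ?B \<Longrightarrow> \<zeta> v = z (\<gamma> v)"
    then obtain u where u: "u \<in> {1..n}" "grouping k rs u = e" "v = C u" by (auto simp: F_def)
    show "peval \<zeta> g = 0"
    proof (rule van[OF u(1,2)])
      show "\<zeta> (C i) = w" if "i \<in> {1..n}" "i = u \<or> grouping k rs i = f" for i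
        using * that u by (auto simp: F_def)
      show "\<zeta> (C i) = z (D (grouping k rs i))"
        if "i \<in> {1..n}" "grouping k rs i \<noteq> e" "grouping k rs i \<noteq> f" for i
      proof -
        have "C i \<notin> ?A \<union> ?B" using that inj by (auto simp: F_def dest: injD)
        from *(3)[OF this] show ?thesis by (simp add: \<gamma>C)
      qed
      show "\<zeta> v = z (\<gamma> v)" if "v \<in> vars g" "v \<notin> C ` {1..n}" for v
        using that by (intro *(3)) (auto simp: F_def)
    qed
  qed (auto simp: F_def)
  moreover have "peval (z(D e := peval z (Var (D f)) + t)) (psubst (\<lambda>v. Var (\<gamma> v)) g) =
      peval (\<lambda>v. if v \<in> ?A then ?w + t else if v \<in> ?B then ?w else z (\<gamma> v)) g" for t
    unfolding peval_psubst
  proof (rule peval_cong)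
    fix v assume v: "v \<in> vars g"
    show "peval (z(D e := peval z (Var (D f)) + t)) (Var (\<gamma> v)) =
        (if v \<in> ?A then ?w + t else if v \<in> ?B then ?w else z (\<gamma> v))"
    proof (cases "v \<in> C ` {1..n}")
      case True
      then obtain i where i: "v = C i" "i \<in> {1..n}" by blast
      have "C i \<in> C ` F h \<longleftrightarrow> grouping k rs i = h" for h
        using i inj(1) by (auto simp: F_def dest: injD)
      then show ?thesis using inj(2) by (auto simp: i \<gamma>C dest: injD)
    next
      case False
      then have "v \<notin> ?A" "v \<notin> ?B" by (auto simp: F_def)
      moreover have "\<gamma> v \<noteq> D e" using \<gamma>D[OF v False] by auto
      ultimately show ?thesis by simp
    qed
  qed
  ultimately show "\<exists>q. \<forall>t. peval (z(D e := peval z (Var (D f)) + t)) (psubst (\<lambda>v. Var (\<gamma> v)) g) =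
      t ^ (2 * fst e) * poly q t"
    by (simp only: cardA)
qed

text \<open>In the extremal arrangement of the variables into \<open>k\<close> columns, the group \<open>X (a, i)\<close> occupies the first
  \<open>a\<close> columns and the group \<open>Y (b, j)\<close> the last \<open>b\<close> columns. The exponents in \<open>G\<close> count common columns.\<close>

fun columns :: "nat \<Rightarrow> (nat \<times> nat) xy \<Rightarrow> nat set" where
  "columns k (X e) = {1..fst e}"
| "columns k (Y e) = {k + 1 - fst e..k}"

section \<open>\<open>G\<close> up to sign as a product over common columns\<close>

fun is_X :: "'i xy \<Rightarrow> bool" where
  "is_X (X _) = True"
| "is_X (Y _) = False"

definition group_var_set :: "nat \<Rightarrow> nat list \<Rightarrow> nat list \<Rightarrow> (nat \<times> nat) xy set" where
  "group_var_set k ps qs = X ` groups k ps \<union> Y ` groups k qs"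

text \<open>For \<open>is_X\<close> this excludes the diagonal and the pairs that lead from a y to
  an x. Same-sort pairs occur in both orders, which doubles their exponent and makes the product
  independent of any ordering of the groups; mixed pairs occur once.\<close>

definition ord_pairs :: "'v set \<Rightarrow> ('v \<Rightarrow> bool) \<Rightarrow> ('v \<times> 'v) set" where
  "ord_pairs V P = {(u, v). u \<in> V \<and> v \<in> V \<and> u \<noteq> v \<and> (P u \<or> \<not> P v)}"

definition G_ord :: "nat \<Rightarrow> nat \<Rightarrow> nat list \<Rightarrow> nat list \<Rightarrow> (nat \<times> nat) xy mpoly" where
  "G_ord k b0 ps qs =
     (\<Prod>(u, v)\<in>ord_pairs (group_var_set k ps qs) is_X. (Var u - Var v) ^ card (columns k u \<inter> columns k v)) *
     (\<Prod>u\<in>X ` groups k ps. Var u ^ card (columns k u \<inter> {b0<..}))"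

lemma finite_group_var_set [simp]: "finite (group_var_set k ps qs)"
  by (simp add: group_var_set_def)

lemma finite_ord_pairs [simp]: "finite V \<Longrightarrow> finite (ord_pairs V P)"
  by (rule finite_subset[of _ "V \<times> V"]) (auto simp: ord_pairs_def)

lemma card_columns:
  "fst f \<le> k \<Longrightarrow> card (columns k (X e) \<inter> columns k (X f)) = min (fst e) (fst f)"
  "fst e \<le> k \<Longrightarrow> fst f \<le> k \<Longrightarrow> card (columns k (Y e) \<inter> columns k (Y f)) = min (fst e) (fst f)"
  "fst f \<le> k \<Longrightarrow> fst e \<le> k \<Longrightarrow> card (columns k (X e) \<inter> columns k (Y f)) = fst e + fst f - k"
  "card (columns k (X e) \<inter> {b0<..}) = fst e - b0"
proof -
  have "columns k (X e) \<inter> columns k (X f) = {1..min (fst e) (fst f)}" by auto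
  then show "card (columns k (X e) \<inter> columns k (X f)) = min (fst e) (fst f)" by simp
  have "columns k (X e) \<inter> {b0<..} = {b0<..fst e}" by auto
  then show "card (columns k (X e) \<inter> {b0<..}) = fst e - b0" by simp
next
  assume "fst e \<le> k" "fst f \<le> k"
  then have "columns k (Y e) \<inter> columns k (Y f) = {k + 1 - min (fst e) (fst f)..k}" by auto
  then show "card (columns k (Y e) \<inter> columns k (Y f)) = min (fst e) (fst f)"
    using \<open>fst e \<le> k\<close> by simp
next
  assume "fst f \<le> k" "fst e \<le> k"
  moreover from this have "columns k (X e) \<inter> columns k (Y f) = {k + 1 - fst f..fst e}" by auto
  ultimately show "card (columns k (X e) \<inter> columns k (Y f)) = fst e + fst f - k" by simp
qed

text \<open>The two orders of a pair give powers of opposite linear forms, so \<open>s\<close> is a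
  product of signs.\<close>

lemma prod_ordered_pairs:
  fixes D :: "nat \<times> nat \<Rightarrow> (nat \<times> nat) xy"
  assumes "inj D"
  shows "\<exists>s. s \<noteq> 0 \<and> (\<Prod>(e, f)\<in>{(e, f). e \<in> groups k ps \<and> f \<in> groups k ps \<and> e \<noteq> f}.
           (Var (D e) - Var (D f)) ^ min (fst e) (fst f)) =
         Const s * (\<Prod>(e, f)\<in>lex_pairs k ps. (Var (D e) - Var (D f)) ^ (2 * min (fst e) (fst f)))"
proof -
  let ?h = "\<lambda>(e, f). (Var (D e) - Var (D f)) ^ min (fst e) (fst f)"
  let ?L = "lex_pairs k ps"
  have "{(e, f). e \<in> groups k ps \<and> f \<in> groups k ps \<and> e \<noteq> f} = ?L \<union> prod.swap ` ?L"
    by (auto simp: lex_pairs_def lex_less_def image_iff)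
  moreover have "?L \<inter> prod.swap ` ?L = {}"
    by (auto simp: lex_pairs_def lex_less_def)
  ultimately have "prod ?h {(e, f). e \<in> groups k ps \<and> f \<in> groups k ps \<and> e \<noteq> f} =
      prod ?h ?L * prod ?h (prod.swap ` ?L)"
    by (simp add: prod.union_disjoint)
  also have "prod ?h (prod.swap ` ?L) = (\<Prod>(e, f)\<in>?L. ?h (f, e))"
    by (subst prod.reindex) (auto simp: case_prod_beta)
  also have "prod ?h ?L * \<dots> = (\<Prod>(e, f)\<in>?L. Const ((-1) ^ min (fst e) (fst f)) *
      (Var (D e) - Var (D f)) ^ (2 * min (fst e) (fst f)))"
    unfolding prod.distrib[symmetric]
  proof (rule prod.cong[OF refl], clarify)
    fix a i b j :: nat
    let ?m = "min a b"
    have *: "(x - y) ^ ?m * (y - x) ^ ?m = (-1) ^ ?m * (x - y) ^ (2 * ?m)" for x y :: complex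
    proof -
      have "(x - y) * (y - x) = (-1) * (x - y) ^ 2" by (simp add: power2_eq_square algebra_simps)
      then show ?thesis by (simp only: power_mult_distrib[symmetric] power_mult)
    qed
    have "(Var (D (a, i)) - Var (D (b, j))) ^ ?m * (Var (D (b, j)) - Var (D (a, i))) ^ ?m =
        Const ((-1) ^ ?m) * (Var (D (a, i)) - Var (D (b, j))) ^ (2 * ?m)"
      by (rule mpoly_eqI) (simp only: peval_mult peval_power peval_diff peval_Const *)
    then show "(Var (D (a, i)) - Var (D (b, j))) ^ min (fst (a, i)) (fst (b, j)) *
        (Var (D (b, j)) - Var (D (a, i))) ^ min (fst (b, j)) (fst (a, i)) =
        Const ((-1) ^ min (fst (a, i)) (fst (b, j))) *
        (Var (D (a, i)) - Var (D (b, j))) ^ (2 * min (fst (a, i)) (fst (b, j)))"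
      by (simp add: min.commute)
  qed
  also have "\<dots> = (\<Prod>(e, f)\<in>?L. Const ((-1) ^ min (fst e) (fst f))) *
      (\<Prod>(e, f)\<in>?L. (Var (D e) - Var (D f)) ^ (2 * min (fst e) (fst f)))"
    by (simp add: prod.distrib case_prod_beta)
  also have "(\<Prod>(e, f)\<in>?L. Const ((-1) ^ min (fst e) (fst f)) :: (nat \<times> nat) xy mpoly) =
      Const (\<Prod>(e, f)\<in>?L. (-1) ^ min (fst e) (fst f))"
    by (rule mpoly_eqI) (simp add: case_prod_beta)
  finally show ?thesis by (intro exI[of _ "\<Prod>(e, f)\<in>?L. (-1) ^ min (fst e) (fst f)"]) auto
qed

lemma groups_le: "e \<in> groups k ps \<Longrightarrow> fst e \<le> k"
  by (auto simp: groups_def)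

lemma card_columns_groups:
  "f \<in> groups k ps \<Longrightarrow> card (columns k (X e) \<inter> columns k (X f)) = min (fst e) (fst f)"
  "e \<in> groups k ps \<Longrightarrow> f \<in> groups k ps \<Longrightarrow> card (columns k (Y e) \<inter> columns k (Y f)) = min (fst e) (fst f)"
  "e \<in> groups k ps \<Longrightarrow> f \<in> groups k qs \<Longrightarrow> card (columns k (X e) \<inter> columns k (Y f)) = fst e + fst f - k"
  by (intro card_columns groups_le; assumption)+

lemma G_ord_eq: "\<exists>s. s \<noteq> 0 \<and> G_ord k b0 ps qs = Const s * G_poly k b0 ps qs"
proof -
  let ?V = "group_var_set k ps qs"
  let ?N = "\<lambda>u v. card (columns k u \<inter> columns k v)"
  let ?h = "\<lambda>(u, v). (Var u - Var v :: (nat \<times> nat) xy mpoly) ^ ?N u v"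
  let ?D = "\<lambda>ps. {(e, f). e \<in> groups k ps \<and> f \<in> groups k ps \<and> e \<noteq> f}"
  let ?XY = "map_prod X Y ` (groups k ps \<times> groups k qs)"
  have fin: "finite (?D ps)" for ps by (rule finite_subset[of _ "groups k ps \<times> groups k ps"]) auto
  have "ord_pairs ?V is_X = map_prod X X ` ?D ps \<union> map_prod Y Y ` ?D qs \<union> ?XY"
    by (auto simp: ord_pairs_def group_var_set_def image_iff)
  then have U: "prod ?h (ord_pairs ?V is_X) = prod ?h (map_prod X X ` ?D ps) * prod ?h (map_prod Y Y ` ?D qs) * prod ?h ?XY"
    by (simp only:) (subst prod.union_disjoint, auto simp: fin)+
  have XX: "prod ?h (map_prod X X ` ?D ps) = (\<Prod>(e, f)\<in>?D ps. (Var (X e) - Var (X f)) ^ min (fst e) (fst f))"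
    by (subst prod.reindex) (auto simp: inj_on_def case_prod_beta card_columns_groups simp del: columns.simps intro!: prod.cong)
  have YY: "prod ?h (map_prod Y Y ` ?D qs) = (\<Prod>(e, f)\<in>?D qs. (Var (Y e) - Var (Y f)) ^ min (fst e) (fst f))"
    by (subst prod.reindex) (auto simp: inj_on_def case_prod_beta card_columns_groups simp del: columns.simps intro!: prod.cong)
  let ?g = "\<lambda>(u, v). (Var u - Var v :: (nat \<times> nat) xy mpoly) ^ expo k u v"
  have XY: "prod ?h ?XY = prod ?g ?XY"
    by (intro prod.cong) (auto simp: card_columns_groups simp del: columns.simps)
  have gXX: "prod ?g (map_prod X X ` lex_pairs k ps) = (\<Prod>(e, f)\<in>lex_pairs k ps. (Var (X e) - Var (X f)) ^ (2 * min (fst e) (fst f)))"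
    by (subst prod.reindex) (auto simp: inj_on_def case_prod_beta intro!: prod.cong)
  have gYY: "prod ?g (map_prod Y Y ` lex_pairs k qs) = (\<Prod>(e, f)\<in>lex_pairs k qs. (Var (Y e) - Var (Y f)) ^ (2 * min (fst e) (fst f)))"
    by (subst prod.reindex) (auto simp: inj_on_def case_prod_beta intro!: prod.cong)
  have gU: "prod ?g (lin_pairs k ps qs) = prod ?g (map_prod X X ` lex_pairs k ps) *
      prod ?g (map_prod Y Y ` lex_pairs k qs) * prod ?g ?XY"
    unfolding lin_pairs_def by (subst prod.union_disjoint, auto)+
  obtain s where s: "s \<noteq> 0" "prod ?h (map_prod X X ` ?D ps) = Const s * prod ?g (map_prod X X ` lex_pairs k ps)"
    using prod_ordered_pairs[of X k ps] unfolding XX gXX by (auto simp: inj_def)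
  obtain t where t: "t \<noteq> 0" "prod ?h (map_prod Y Y ` ?D qs) = Const t * prod ?g (map_prod Y Y ` lex_pairs k qs)"
    using prod_ordered_pairs[of Y k qs] unfolding YY gYY by (auto simp: inj_def)
  have m: "(\<Prod>u\<in>X ` groups k ps. Var u ^ card (columns k u \<inter> {b0<..})) =
      (\<Prod>u\<in>X ` groups k ps. (Var u :: (nat \<times> nat) xy mpoly) ^ (case u of X e \<Rightarrow> fst e - b0 | Y e \<Rightarrow> 0))"
    by (intro prod.cong) (auto simp: card_columns simp del: columns.simps)
  have "G_ord k b0 ps qs = Const (s * t) * G_poly k b0 ps qs"
    unfolding G_ord_def G_poly_eq U gU s t XY m Const_mult by (simp only: mult.assoc mult.left_commute mult.commute)
  then show ?thesis using s t by (intro exI[of _ "s * t"]) simp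
qed

text \<open>Sort and size, which are preserved by the permutations inside the blocks of
  \<open>S_space\<close> and determine the columns of a group; this is why \<open>G_ord\<close> is
  invariant under them.\<close>

fun var_level :: "(nat \<times> nat) xy \<Rightarrow> bool \<times> nat" where
  "var_level (X e) = (True, fst e)"
| "var_level (Y e) = (False, fst e)"

lemma var_level_columns: "var_level u = var_level v \<Longrightarrow> columns k u = columns k v"
  and var_level_is_X: "var_level u = var_level v \<Longrightarrow> is_X u = is_X v"
  by (cases u; cases v; simp)+

lemma permutes_cases: "\<pi> permutes S \<Longrightarrow> \<pi> v = v \<or> v \<in> S \<and> \<pi> v \<in> S"
  using permutes_in_image[of \<pi> S v] permutes_not_in[of \<pi> S v] by blast

lemma group_vars_permutes:
  assumes "a \<in> {1..k}" "\<pi> permutes group_vars X ps a \<or> \<pi> permutes group_vars Y qs a"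
  shows "var_level (\<pi> v) = var_level v" "\<pi> v \<in> group_var_set k ps qs \<longleftrightarrow> v \<in> group_var_set k ps qs"
proof -
  have "\<pi> v = v \<or> v \<in> group_vars X ps a \<and> \<pi> v \<in> group_vars X ps a \<or>
      v \<in> group_vars Y qs a \<and> \<pi> v \<in> group_vars Y qs a"
    using assms(2) permutes_cases[of \<pi> "group_vars X ps a" v] permutes_cases[of \<pi> "group_vars Y qs a" v]
    by meson
  then show "var_level (\<pi> v) = var_level v" "\<pi> v \<in> group_var_set k ps qs \<longleftrightarrow> v \<in> group_var_set k ps qs"
    using assms(1) by (auto simp: group_var_set_def groups_def)
qed

lemma act_G_ord:
  assumes \<pi>: "inj \<pi>" and level: "\<And>v. var_level (\<pi> v) = var_level v"
    and V: "\<And>v. \<pi> v \<in> group_var_set k ps qs \<longleftrightarrow> v \<in> group_var_set k ps qs"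
  shows "act \<pi> (G_ord k b0 ps qs) = G_ord k b0 ps qs"
proof -
  let ?O = "ord_pairs (group_var_set k ps qs) is_X" and ?U = "X ` groups k ps :: (nat \<times> nat) xy set"
  note col = var_level_columns[OF level] and isX = var_level_is_X[OF level]
  have "map_prod \<pi> \<pi> ` ?O = ?O"
  proof (rule endo_inj_surj)
    show "map_prod \<pi> \<pi> ` ?O \<subseteq> ?O" by (auto simp: ord_pairs_def V isX dest: injD[OF \<pi>])
    show "inj_on (map_prod \<pi> \<pi>) ?O" by (auto simp: inj_on_def dest: injD[OF \<pi>])
  qed simp
  then have "bij_betw (map_prod \<pi> \<pi>) ?O ?O"
    by (auto simp: bij_betw_def inj_on_def dest: injD[OF \<pi>])
  from prod.reindex_bij_betw[OF this, of "\<lambda>(u, v). (Var u - Var v) ^ card (columns k u \<inter> columns k v)"]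
  have 1: "(\<Prod>(u, v)\<in>?O. (Var (\<pi> u) - Var (\<pi> v)) ^ card (columns k u \<inter> columns k v)) =
      (\<Prod>(u, v)\<in>?O. (Var u - Var v) ^ card (columns k u \<inter> columns k v))"
    by (simp add: case_prod_beta col)
  have U: "v \<in> ?U \<longleftrightarrow> is_X v \<and> v \<in> group_var_set k ps qs" for v
    by (cases v) (auto simp: group_var_set_def)
  have "\<pi> ` ?U = ?U"
  proof (rule endo_inj_surj)
    show "\<pi> ` ?U \<subseteq> ?U" using V isX U by blast
    show "inj_on \<pi> ?U" using \<pi> by (rule inj_on_subset) simp
  qed simp
  then have "bij_betw \<pi> ?U ?U" using inj_on_subset[OF \<pi>] by (auto simp: bij_betw_def)
  from prod.reindex_bij_betw[OF this, of "\<lambda>u. Var u ^ card (columns k u \<inter> {b0<..})"]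
  have 2: "(\<Prod>u\<in>?U. Var (\<pi> u) ^ card (columns k u \<inter> {b0<..})) = (\<Prod>u\<in>?U. Var u ^ card (columns k u \<inter> {b0<..}))"
    by (simp add: col)
  show ?thesis
    unfolding G_ord_def case_prod_beta by (simp only: psubst_mult psubst_prod psubst_power psubst_diff psubst_Var 1[unfolded case_prod_beta] 2)
qed

lemma vars_G_ord: "vars (G_ord k b0 ps qs) \<subseteq> group_var_set k ps qs"
  unfolding G_ord_def
proof (intro vars_multI vars_prodI)
  fix p assume "p \<in> ord_pairs (group_var_set k ps qs) is_X"
  then show "vars (case p of (u, v) \<Rightarrow> (Var u - Var v) ^ card (columns k u \<inter> columns k v)) \<subseteq> group_var_set k ps qs"
    by (cases p) (simp add: ord_pairs_def vars_powerI vars_diffI)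
next
  fix u assume "u \<in> X ` groups k ps"
  then show "vars (Var u ^ card (columns k u \<inter> {b0<..})) \<subseteq> group_var_set k ps qs"
    by (intro vars_powerI) (auto simp: group_var_set_def)
qed

lemma G_ord_nonzero: "G_ord k b0 ps qs \<noteq> 0"
proof -
  obtain f :: "(nat \<times> nat) xy \<Rightarrow> nat" where f: "inj_on f (group_var_set k ps qs)"
    using finite_imp_inj_to_nat_seg[OF finite_group_var_set] by metis
  have "peval (\<lambda>v. of_nat (Suc (f v))) (G_ord k b0 ps qs) \<noteq> 0"
  proof -
    have "f u \<noteq> f v" if "(u, v) \<in> ord_pairs (group_var_set k ps qs) is_X" for u v
      using that inj_onD[OF f] by (auto simp: ord_pairs_def)
    then have "peval (\<lambda>v. of_nat (Suc (f v))) (case p of (u, v) \<Rightarrow>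
        (Var u - Var v) ^ card (columns k u \<inter> columns k v)) \<noteq> 0"
      if "p \<in> ord_pairs (group_var_set k ps qs) is_X" for p
      using that by (cases p) simp
    moreover have "finite (ord_pairs (group_var_set k ps qs) is_X)" by simp
    moreover have "finite (X ` groups k ps)" by simp
    ultimately show ?thesis
      unfolding G_ord_def peval_mult peval_prod
      by (simp only: mult_eq_0_iff prod_zero_iff peval_power peval_Var power_eq_0_iff) (simp del: of_nat_Suc)
  qed
  then show ?thesis by (metis peval_0)
qed

lemma card_fibre_X:
  assumes "restricted_partition k l1 ps"
  shows "card {i \<in> {1..l1}. gmap k ps qs (X i) = v} =
    (if v \<in> group_var_set k ps qs \<and> is_X v then snd (var_level v) else 0)"
proof (cases v)
  case (X e)
  note P = restricted_partitionD[OF assms]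
  show ?thesis
  proof (cases "e \<in> groups k ps")
    case True
    then show ?thesis using X card_grouping[OF P(1) True] P(2) by (auto simp: group_var_set_def)
  next
    case False
    then have "{i \<in> {1..l1}. gmap k ps qs (X i) = v} = {}"
      using X grouping_in[OF P(1)] P(2) by auto
    then have "card {i \<in> {1..l1}. gmap k ps qs (X i) = v} = 0" by (simp only: card.empty)
    then show ?thesis using X False by (auto simp: group_var_set_def)
  qed
qed simp

lemma card_fibre_Y:
  assumes "restricted_partition k l2 qs"
  shows "card {i \<in> {1..l2}. gmap k ps qs (Y i) = v} =
    (if v \<in> group_var_set k ps qs \<and> \<not> is_X v then snd (var_level v) else 0)"
proof (cases v)
  case (Y e)
  note P = restricted_partitionD[OF assms]
  show ?thesis
  proof (cases "e \<in> groups k qs")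
    case True
    then show ?thesis using Y card_grouping[OF P(1) True] P(2) by (auto simp: group_var_set_def)
  next
    case False
    then have "{i \<in> {1..l2}. gmap k ps qs (Y i) = v} = {}"
      using Y grouping_in[OF P(1)] P(2) by auto
    then have "card {i \<in> {1..l2}. gmap k ps qs (Y i) = v} = 0" by (simp only: card.empty)
    then show ?thesis using Y False by (auto simp: group_var_set_def)
  qed
qed simp

lemma gmap_in:
  assumes "restricted_partition k l1 ps" "restricted_partition k l2 qs" "v \<in> X ` {1..l1} \<union> Y ` {1..l2}"
  shows "gmap k ps qs v \<in> group_var_set k ps qs"
  using assms(3) grouping_in restricted_partitionD[OF assms(1)] restricted_partitionD[OF assms(2)]
  by (auto simp: group_var_set_def)

lemma Gamma_spaceD:
  assumes "g \<in> Gamma_space k b0 l1 l2 ps qs"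
  shows "g \<in> I_space k b0 l1 l2"
    and "restricted_partition k l1 \<nu> \<Longrightarrow> restricted_partition k l2 \<kappa> \<Longrightarrow> pair_gt (\<nu>, \<kappa>) (ps, qs) \<Longrightarrow>
      phi k \<nu> \<kappa> g = 0"
  using assms unfolding Gamma_space_def ker_phi_def by auto

lemma transpose_peval:
  assumes "g \<in> sym_xy l1 l2" and "i \<in> X ` {1..l1} \<and> j \<in> X ` {1..l1} \<or> i \<in> Y ` {1..l2} \<and> j \<in> Y ` {1..l2}"
  shows "peval (\<zeta> \<circ> transpose i j) g = peval \<zeta> g"
proof -
  have "transpose i j permutes X ` {1..l1} \<or> transpose i j permutes Y ` {1..l2}"
    using assms(2)
  proof (elim disjE conjE)
    assume "i \<in> X ` {1..l1}" "j \<in> X ` {1..l1}"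
    then show ?thesis by (rule disjI1[OF permutes_swap_id])
  next
    assume "i \<in> Y ` {1..l2}" "j \<in> Y ` {1..l2}"
    then show ?thesis by (rule disjI2[OF permutes_swap_id])
  qed
  from sym_xy_peval[OF assms(1) this, of \<zeta>] show ?thesis by (simp add: o_def)
qed

section \<open>Divisibility for a fixed element of \<open>Gamma_space\<close>\<close>

context
  fixes k b0 l1 l2 :: nat and ps qs :: "nat list" and g :: "nat xy mpoly"
  assumes ps: "restricted_partition k l1 ps" and qs: "restricted_partition k l2 qs"
    and g: "g \<in> Gamma_space k b0 l1 l2 ps qs"
begin

lemma g_sym: "g \<in> sym_xy l1 l2"
  using Gamma_spaceD(1)[OF g] by (rule I_spaceD(1))

lemma Gamma_dvd_XX:
  assumes ef: "e \<in> groups k ps" "f \<in> groups k ps" "e \<noteq> f" "fst e \<le> fst f"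
  shows "(Var (X e) - Var (X f)) ^ (2 * fst e) dvd phi k ps qs g"
  unfolding phi_eq
proof (rule joining_dvd[OF ps ef(1-3), where C = X])
  show "gmap k ps qs v \<notin> range X" if "v \<in> vars g" "v \<notin> X ` {1..l1}" for v
    using that sym_xy_vars[OF g_sym] by auto
  show "peval (\<zeta> \<circ> transpose (X i) (X j)) g = peval \<zeta> g" if "i \<in> {1..l1}" "j \<in> {1..l1}" for \<zeta> i j
    using that by (intro transpose_peval[OF g_sym]) blast
next
  fix \<zeta> :: "nat xy \<Rightarrow> complex" and z u w
  assume u: "u \<in> {1..l1}" "grouping k ps u = e"
    and w: "\<And>i. i \<in> {1..l1} \<Longrightarrow> i = u \<or> grouping k ps i = f \<Longrightarrow> \<zeta> (X i) = w"
    and z: "\<And>i. i \<in> {1..l1} \<Longrightarrow> grouping k ps i \<noteq> e \<Longrightarrow> grouping k ps i \<noteq> f \<Longrightarrow> \<zeta> (X i) = z (X (grouping k ps i))"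
    and rest: "\<And>v. v \<in> vars g \<Longrightarrow> v \<notin> X ` {1..l1} \<Longrightarrow> \<zeta> v = z (gmap k ps qs v)"
  show "peval \<zeta> g = 0"
  proof (cases "fst f < k")
    case True
    obtain \<nu> \<pi> \<delta> where \<nu>: "restricted_partition k l1 \<nu>" "lex_gt \<nu> ps"
      and \<pi>: "\<pi> permutes {1..l1}" "\<And>i. i \<in> {1..l1} \<Longrightarrow> joined k ps e f u (\<pi> i) = \<delta> (grouping k \<nu> i)"
      by (rule joining_partition[OF ps ef True u], rule that)
    have "\<forall>i\<in>{1..l1}. joined k ps e f u (\<pi> i) = \<delta> (grouping k \<nu> i)"
      "\<forall>i\<in>{1..l1}. i = u \<or> grouping k ps i = f \<longrightarrow> \<zeta> (X i) = w"
      "\<forall>i\<in>{1..l1}. grouping k ps i \<noteq> e \<and> grouping k ps i \<noteq> f \<longrightarrow> \<zeta> (X i) = z (X (grouping k ps i))"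
      using \<pi>(2) w z by blast+
    from joining_partition_values[OF \<pi>(1) this(1), where \<zeta> = "\<lambda>i. \<zeta> (X i)" and z = "\<lambda>h. z (X h)", OF this(2,3)]
    obtain z' where z': "\<forall>i\<in>{1..l1}. \<zeta> (X (\<pi> i)) = z' (grouping k \<nu> i)"
      by blast
    define y where "y v = (case v of X h \<Rightarrow> z' h | Y h \<Rightarrow> z (Y h))" for v
    \<comment> \<open>The first component decides the order of pairs, so the second one can stay at
      \<open>qs\<close>.\<close>
    have "phi k \<nu> qs g = 0"
      using Gamma_spaceD(2)[OF g \<nu>(1) qs] \<nu>(2) by (simp add: pair_gt_def)
    then have "peval (\<lambda>v. y (gmap k \<nu> qs v)) g = 0" by (metis peval_phi peval_0)
    moreover have "peval (\<lambda>v. \<zeta> (perm_xy \<pi> id v)) g = peval (\<lambda>v. y (gmap k \<nu> qs v)) g"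
    proof (rule peval_cong)
      fix v assume v: "v \<in> vars g"
      show "\<zeta> (perm_xy \<pi> id v) = y (gmap k \<nu> qs v)"
      proof (cases v)
        case (X i)
        then show ?thesis using v sym_xy_vars[OF g_sym] z' by (auto simp: y_def)
      next
        case (Y j)
        then show ?thesis using rest[OF v] by (auto simp: y_def)
      qed
    qed
    moreover have "peval (\<lambda>v. \<zeta> (perm_xy \<pi> id v)) g = peval \<zeta> g"
      by (rule sym_xy_peval_perm[OF g_sym \<pi>(1) permutes_id])
    ultimately show ?thesis by simp
  next
    case False
    then have k: "fst f = k" using groups_le[OF ef(2)] by simp
    let ?F = "{i \<in> {1..l1}. grouping k ps i = f}"
    have "card ?F = k"
      using card_grouping[OF restricted_partitionD(1)[OF ps] ef(2)] restricted_partitionD(2)[OF ps] k by simp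
    moreover have "u \<notin> ?F" using u ef by auto
    \<comment> \<open>A full group together with \<open>u\<close> consists of \<open>k + 1\<close>
      equal x-variables, the case of the vanishing condition without y-variables.\<close>
    ultimately have "card (insert u ?F) = k + 1" by simp
    then show ?thesis
      using u w by (intro I_space_vanish[OF Gamma_spaceD(1)[OF g], of "insert u ?F" "{}" \<zeta> w]) auto
  qed
qed (simp_all add: inj_def)

lemma Gamma_dvd_YY:
  assumes ef: "e \<in> groups k qs" "f \<in> groups k qs" "e \<noteq> f" "fst e \<le> fst f"
  shows "(Var (Y e) - Var (Y f)) ^ (2 * fst e) dvd phi k ps qs g"
  unfolding phi_eq
proof (rule joining_dvd[OF qs ef(1-3), where C = Y])
  show "gmap k ps qs v \<notin> range Y" if "v \<in> vars g" "v \<notin> Y ` {1..l2}" for v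
    using that sym_xy_vars[OF g_sym] by auto
  show "peval (\<zeta> \<circ> transpose (Y i) (Y j)) g = peval \<zeta> g" if "i \<in> {1..l2}" "j \<in> {1..l2}" for \<zeta> i j
    using that by (intro transpose_peval[OF g_sym]) blast
next
  fix \<zeta> :: "nat xy \<Rightarrow> complex" and z u w
  assume u: "u \<in> {1..l2}" "grouping k qs u = e"
    and w: "\<And>i. i \<in> {1..l2} \<Longrightarrow> i = u \<or> grouping k qs i = f \<Longrightarrow> \<zeta> (Y i) = w"
    and z: "\<And>i. i \<in> {1..l2} \<Longrightarrow> grouping k qs i \<noteq> e \<Longrightarrow> grouping k qs i \<noteq> f \<Longrightarrow> \<zeta> (Y i) = z (Y (grouping k qs i))"
    and rest: "\<And>v. v \<in> vars g \<Longrightarrow> v \<notin> Y ` {1..l2} \<Longrightarrow> \<zeta> v = z (gmap k ps qs v)"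
  show "peval \<zeta> g = 0"
  proof (cases "fst f < k")
    case True
    obtain \<nu> \<pi> \<delta> where \<nu>: "restricted_partition k l2 \<nu>" "lex_gt \<nu> qs"
      and \<pi>: "\<pi> permutes {1..l2}" "\<And>i. i \<in> {1..l2} \<Longrightarrow> joined k qs e f u (\<pi> i) = \<delta> (grouping k \<nu> i)"
      by (rule joining_partition[OF qs ef True u], rule that)
    have "\<forall>i\<in>{1..l2}. joined k qs e f u (\<pi> i) = \<delta> (grouping k \<nu> i)"
      "\<forall>i\<in>{1..l2}. i = u \<or> grouping k qs i = f \<longrightarrow> \<zeta> (Y i) = w"
      "\<forall>i\<in>{1..l2}. grouping k qs i \<noteq> e \<and> grouping k qs i \<noteq> f \<longrightarrow> \<zeta> (Y i) = z (Y (grouping k qs i))"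
      using \<pi>(2) w z by blast+
    from joining_partition_values[OF \<pi>(1) this(1), where \<zeta> = "\<lambda>i. \<zeta> (Y i)" and z = "\<lambda>h. z (Y h)", OF this(2,3)]
    obtain z' where z': "\<forall>i\<in>{1..l2}. \<zeta> (Y (\<pi> i)) = z' (grouping k \<nu> i)"
      by blast
    define y where "y v = (case v of X h \<Rightarrow> z (X h) | Y h \<Rightarrow> z' h)" for v
    \<comment> \<open>With the first components equal, the order of pairs compares the second
      ones.\<close>
    have "phi k ps \<nu> g = 0"
      using Gamma_spaceD(2)[OF g ps \<nu>(1)] \<nu>(2) by (simp add: pair_gt_def)
    then have "peval (\<lambda>v. y (gmap k ps \<nu> v)) g = 0" by (metis peval_phi peval_0)
    moreover have "peval (\<lambda>v. \<zeta> (perm_xy id \<pi> v)) g = peval (\<lambda>v. y (gmap k ps \<nu> v)) g"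
    proof (rule peval_cong)
      fix v assume v: "v \<in> vars g"
      show "\<zeta> (perm_xy id \<pi> v) = y (gmap k ps \<nu> v)"
      proof (cases v)
        case (X i)
        then show ?thesis using rest[OF v] by (auto simp: y_def)
      next
        case (Y j)
        then show ?thesis using v sym_xy_vars[OF g_sym] z' by (auto simp: y_def)
      qed
    qed
    moreover have "peval (\<lambda>v. \<zeta> (perm_xy id \<pi> v)) g = peval \<zeta> g"
      by (rule sym_xy_peval_perm[OF g_sym permutes_id \<pi>(1)])
    ultimately show ?thesis by simp
  next
    case False
    then have k: "fst f = k" using groups_le[OF ef(2)] by simp
    let ?F = "{i \<in> {1..l2}. grouping k qs i = f}"
    have "card ?F = k"
      using card_grouping[OF restricted_partitionD(1)[OF qs] ef(2)] restricted_partitionD(2)[OF qs] k by simp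
    moreover have "u \<notin> ?F" using u ef by auto
    ultimately have "card (insert u ?F) = k + 1" by simp
    then show ?thesis
      using u w by (intro I_space_vanish[OF Gamma_spaceD(1)[OF g], of "{}" "insert u ?F" \<zeta> w]) auto
  qed
qed (simp_all add: inj_def)

text \<open>Applied twice: with the variable of a y-group for \<open>b\<close> and
  \<open>c = k + 1 - fst f\<close>, which gives the mixed exponent, and with \<open>0\<close> for
  \<open>b\<close> and \<open>c = b0 + 1\<close>, which gives the exponent of the power of
  x.\<close>

lemma coincidence_dvd:
  assumes e: "e \<in> groups k ps" and c: "c \<le> fst e" and b: "X e \<notin> vars b"
    and van: "\<And>\<zeta> C z. C \<subseteq> {i \<in> {1..l1}. grouping k ps i = e} \<Longrightarrow> card C = c \<Longrightarrow>
       (\<And>i. i \<in> C \<Longrightarrow> \<zeta> (X i) = peval z b) \<Longrightarrow> (\<And>j. \<zeta> (Y j) = z (Y (grouping k qs j))) \<Longrightarrow> peval \<zeta> g = 0"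
  shows "(Var (X e) - b) ^ (fst e + 1 - c) dvd phi k ps qs g"
proof (rule linear_power_dvdI)
  fix z :: "(nat \<times> nat) xy \<Rightarrow> complex"
  let ?F = "{i \<in> {1..l1}. grouping k ps i = e}"
  let ?A = "X ` ?F"
  have cardA: "card ?A = fst e"
    using card_grouping[OF restricted_partitionD(1)[OF ps] e] restricted_partitionD(2)[OF ps]
    by (simp add: card_image inj_on_def)
  have "\<exists>q. \<forall>t. peval (\<lambda>v. if v \<in> ?A then peval z b + t else z (gmap k ps qs v)) g =
      t ^ (card ?A + 1 - c) * poly q t"
  proof (rule order_of_coincidence)
    fix \<zeta> C
    assume C: "C \<subseteq> ?A" "card C = c" "\<And>v. v \<in> C \<Longrightarrow> \<zeta> v = peval z b"
      and rest: "\<And>v. v \<notin> ?A \<Longrightarrow> \<zeta> v = z (gmap k ps qs v)"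
    obtain D where D: "D \<subseteq> ?F" "C = X ` D" using C(1) by (meson subset_imageE)
    show "peval \<zeta> g = 0"
    proof (rule van[OF D(1)])
      show "card D = c" using C(2) D(2) by (simp add: card_image inj_on_def)
      show "\<zeta> (X i) = peval z b" if "i \<in> D" for i using that C(3) D(2) by blast
      show "\<zeta> (Y j) = z (Y (grouping k qs j))" for j using rest[of "Y j"] by auto
    qed
  qed (use c cardA in auto)
  moreover have "peval (z(X e := peval z b + t)) (phi k ps qs g) =
      peval (\<lambda>v. if v \<in> ?A then peval z b + t else z (gmap k ps qs v)) g" for t
    unfolding peval_phi using sym_xy_vars[OF g_sym] by (intro peval_cong) fastforce
  ultimately show "\<exists>q. \<forall>t. peval (z(X e := peval z b + t)) (phi k ps qs g) = t ^ (fst e + 1 - c) * poly q t"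
    by (simp only: cardA)
qed

lemma Gamma_dvd_XY:
  assumes e: "e \<in> groups k ps" and f: "f \<in> groups k qs"
  shows "(Var (X e) - Var (Y f)) ^ (fst e + fst f - k) dvd phi k ps qs g"
proof (cases "fst e + fst f > k")
  case True
  have f': "fst f \<le> k" using groups_le[OF f] .
  have "(Var (X e) - Var (Y f)) ^ (fst e + 1 - (k + 1 - fst f)) dvd phi k ps qs g"
  proof (rule coincidence_dvd[OF e])
    fix \<zeta> C and z :: "(nat \<times> nat) xy \<Rightarrow> complex"
    assume C: "C \<subseteq> {i \<in> {1..l1}. grouping k ps i = e}" "card C = k + 1 - fst f"
      "\<And>i. i \<in> C \<Longrightarrow> \<zeta> (X i) = peval z (Var (Y f))" "\<And>j. \<zeta> (Y j) = z (Y (grouping k qs j))"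
    let ?F = "{j \<in> {1..l2}. grouping k qs j = f}"
    have "card ?F = fst f"
      using card_grouping[OF restricted_partitionD(1)[OF qs] f] restricted_partitionD(2)[OF qs] by simp
    then show "peval \<zeta> g = 0"
      using C f' by (intro I_space_vanish[OF Gamma_spaceD(1)[OF g], of C ?F \<zeta> "z (Y f)"]) auto
  qed (use True in auto)
  moreover have "fst e + 1 - (k + 1 - fst f) = fst e + fst f - k" using f' by simp
  ultimately show ?thesis by simp
qed simp

lemma Gamma_dvd_X:
  assumes e: "e \<in> groups k ps"
  shows "Var (X e) ^ (fst e - b0) dvd phi k ps qs g"
proof (cases "b0 < fst e")
  case True
  have "(Var (X e) - 0) ^ (fst e + 1 - (b0 + 1)) dvd phi k ps qs g"
  proof (rule coincidence_dvd[OF e])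
    fix \<zeta> C and z :: "(nat \<times> nat) xy \<Rightarrow> complex"
    assume C: "C \<subseteq> {i \<in> {1..l1}. grouping k ps i = e}" "card C = b0 + 1"
      "\<And>i. i \<in> C \<Longrightarrow> \<zeta> (X i) = peval z 0"
    then show "peval \<zeta> g = 0"
      by (intro I_space_vanish_0[OF Gamma_spaceD(1)[OF g], of C \<zeta>]) auto
  qed (use True in auto)
  then show ?thesis by simp
qed simp

lemma G_poly_dvd_phi: "G_poly k b0 ps qs dvd phi k ps qs g"
  unfolding G_poly_eq
proof (rule prod_differences_dvd)
  show "finite (lin_pairs k ps qs)" by (simp add: lin_pairs_def)
  show "u \<noteq> v \<and> (v, u) \<notin> lin_pairs k ps qs" if "(u, v) \<in> lin_pairs k ps qs" for u v
    using that by (auto simp: lin_pairs_def lex_pairs_def lex_less_def)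
  show "(Var u - Var v) ^ expo k u v dvd phi k ps qs g" if uv: "(u, v) \<in> lin_pairs k ps qs" for u v
  proof -
    consider e f where "u = X e" "v = X f" "(e, f) \<in> lex_pairs k ps"
      | e f where "u = Y e" "v = Y f" "(e, f) \<in> lex_pairs k qs"
      | e f where "u = X e" "v = Y f" "e \<in> groups k ps" "f \<in> groups k qs"
      using uv unfolding lin_pairs_def by auto
    then show ?thesis
    proof cases
      case 1
      then have "e \<in> groups k ps" "f \<in> groups k ps" "e \<noteq> f" "fst e \<le> fst f"
        by (auto simp: lex_pairs_def lex_less_def)
      then show ?thesis using Gamma_dvd_XX[of e f] 1 by (simp add: min_absorb1)
    next
      case 2
      then have "e \<in> groups k qs" "f \<in> groups k qs" "e \<noteq> f" "fst e \<le> fst f"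
        by (auto simp: lex_pairs_def lex_less_def)
      then show ?thesis using Gamma_dvd_YY[of e f] 2 by (simp add: min_absorb1)
    next
      case 3
      then show ?thesis using Gamma_dvd_XY[of e f] by simp
    qed
  qed
  show "Var u ^ (case u of X e \<Rightarrow> fst e - b0 | Y e \<Rightarrow> 0) dvd phi k ps qs g" if "u \<in> X ` groups k ps" for u
    using that Gamma_dvd_X by auto
qed simp

text \<open>A permutation of group variables of equal size and sort lifts to a permutation of the
  original variables, under which \<open>g\<close> is invariant.\<close>

lemma act_phi:
  assumes a: "a \<in> {1..k}" and \<pi>: "\<pi> permutes group_vars X ps a \<or> \<pi> permutes group_vars Y qs a"
  shows "act \<pi> (phi k ps qs g) = phi k ps qs g"
proof (rule mpoly_eqI)
  fix z :: "(nat \<times> nat) xy \<Rightarrow> complex"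
  let ?\<gamma> = "gmap k ps qs"
  note lev = group_vars_permutes[OF a \<pi>]
  have bij: "bij \<pi>" using \<pi> by (auto intro: permutes_bij)
  \<comment> \<open>Turns the fibre of the permuted specialization over \<open>v\<close> into a
    fibre of the original one over \<open>inv \<pi> v\<close>, which has the same size.\<close>
  have inv: "\<pi> w = v \<longleftrightarrow> w = inv \<pi> v" for v w using bij by (metis bij_inv_eq_iff)
  have lev': "var_level (inv \<pi> v) = var_level v"
    "inv \<pi> v \<in> group_var_set k ps qs \<longleftrightarrow> v \<in> group_var_set k ps qs" for v
    using lev[of "inv \<pi> v"] inv by metis+
  have "\<exists>\<rho>. \<rho> permutes {1..l1} \<and> (\<forall>i\<in>{1..l1}. ?\<gamma> (X (\<rho> i)) = \<pi> (?\<gamma> (X i)))"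
    by (rule permutes_matching)
      (simp_all only: inv card_fibre_X[OF ps] lev' var_level_is_X[OF lev'(1)] finite_atLeastAtMost)
  then obtain \<rho> where \<rho>: "\<rho> permutes {1..l1}" "\<And>i. i \<in> {1..l1} \<Longrightarrow> ?\<gamma> (X (\<rho> i)) = \<pi> (?\<gamma> (X i))" by blast
  have "\<exists>\<sigma>. \<sigma> permutes {1..l2} \<and> (\<forall>i\<in>{1..l2}. ?\<gamma> (Y (\<sigma> i)) = \<pi> (?\<gamma> (Y i)))"
    by (rule permutes_matching)
      (simp_all only: inv card_fibre_Y[OF qs] lev' var_level_is_X[OF lev'(1)] finite_atLeastAtMost)
  then obtain \<sigma> where \<sigma>: "\<sigma> permutes {1..l2}" "\<And>i. i \<in> {1..l2} \<Longrightarrow> ?\<gamma> (Y (\<sigma> i)) = \<pi> (?\<gamma> (Y i))" by blast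
  have "peval z (act \<pi> (phi k ps qs g)) = peval (\<lambda>v. z (\<pi> (?\<gamma> v))) g"
    by (simp add: peval_phi)
  also have "\<dots> = peval (\<lambda>v. z (?\<gamma> (perm_xy \<rho> \<sigma> v))) g"
  proof (rule peval_cong)
    fix v assume "v \<in> vars g"
    then have "v \<in> X ` {1..l1} \<union> Y ` {1..l2}" using sym_xy_vars[OF g_sym] by blast
    then have "?\<gamma> (perm_xy \<rho> \<sigma> v) = \<pi> (?\<gamma> v)"
    proof
      assume "v \<in> X ` {1..l1}"
      then obtain i where "v = X i" "i \<in> {1..l1}" by blast
      then show ?thesis using \<rho>(2) by (simp only: perm_xy_simps)
    next
      assume "v \<in> Y ` {1..l2}"
      then obtain i where "v = Y i" "i \<in> {1..l2}" by blast
      then show ?thesis using \<sigma>(2) by (simp only: perm_xy_simps)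
    qed
    then show "z (\<pi> (?\<gamma> v)) = z (?\<gamma> (perm_xy \<rho> \<sigma> v))" by simp
  qed
  also have "\<dots> = peval z (phi k ps qs g)"
    using sym_xy_peval_perm[OF g_sym \<rho>(1) \<sigma>(1), of "\<lambda>v. z (?\<gamma> v)"] by (simp add: peval_phi)
  finally show "peval z (act \<pi> (phi k ps qs g)) = peval z (phi k ps qs g)" .
qed

text \<open>The cofactor inherits its invariance from the specialization and from
  \<open>G_poly\<close> by cancelling \<open>G_poly\<close>.\<close>

lemma phi_in_G_poly_multiples:
  "phi k ps qs g \<in> (\<lambda>h. G_poly k b0 ps qs * h) ` tensor (S_space k X ps) (S_space k Y qs)"
proof -
  let ?V = "group_var_set k ps qs"
  obtain s where s: "s \<noteq> 0" "G_ord k b0 ps qs = Const s * G_poly k b0 ps qs"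
    using G_ord_eq by blast
  have Gne: "G_poly k b0 ps qs \<noteq> 0" using G_ord_nonzero s by (metis mult_zero_right)
  have G: "G_poly k b0 ps qs = Const (1 / s) * G_ord k b0 ps qs"
    by (rule mpoly_eqI) (simp add: s)
  obtain Q0 where Q0: "phi k ps qs g = G_poly k b0 ps qs * Q0" using G_poly_dvd_phi by (auto simp: dvd_def)
  \<comment> \<open>Divisibility holds in the ring with all variables of the type, so the cofactor
    may contain foreign ones; setting these to zero changes neither the specialization nor
    \<open>G_poly\<close>.\<close>
  let ?r = "psubst (\<lambda>v. if v \<in> ?V then Var v else 0)"
  have r: "?r p = p" if "vars p \<subseteq> ?V" for p
  proof -
    have "?r p = psubst Var p" using that by (intro psubst_cong) auto
    then show ?thesis by simp
  qed
  have varsG: "vars (G_poly k b0 ps qs) \<subseteq> ?V"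
    unfolding G by (intro vars_multI vars_G_ord) simp
  have "vars (phi k ps qs g) \<subseteq> ?V"
    unfolding phi_eq using sym_xy_vars[OF g_sym] gmap_in[OF ps qs] by (intro vars_psubstI) auto
  then have "phi k ps qs g = ?r (phi k ps qs g)" by (simp only: r)
  also have "\<dots> = G_poly k b0 ps qs * ?r Q0"
    by (simp only: Q0 psubst_mult r[OF varsG])
  finally have Q: "phi k ps qs g = G_poly k b0 ps qs * ?r Q0" .
  have inv: "act \<pi> (?r Q0) = ?r Q0"
    if a: "a \<in> {1..k}" and \<pi>: "\<pi> permutes group_vars X ps a \<or> \<pi> permutes group_vars Y qs a" for a \<pi>
  proof -
    have "inj \<pi>" using \<pi> by (auto intro: permutes_inj)
    then have "act \<pi> (G_poly k b0 ps qs) = G_poly k b0 ps qs"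
      unfolding G using act_G_ord[OF _ group_vars_permutes[OF a \<pi>]] by simp
    then have "G_poly k b0 ps qs * act \<pi> (?r Q0) = G_poly k b0 ps qs * ?r Q0"
      using act_phi[OF a \<pi>] by (simp only: Q psubst_mult)
    then show ?thesis using Gne by (rule mpoly_mult_left_cancel)
  qed
  have "?r Q0 \<in> tensor (S_space k X ps) (S_space k Y qs)"
  proof (rule in_tensor_S_space)
    show "vars (?r Q0) \<subseteq> X ` groups k ps \<union> Y ` groups k qs"
      unfolding group_var_set_def[symmetric] by (rule vars_psubstI) simp
  qed (use inv in blast)+
  with Q show ?thesis by blast
qed

end

section \<open>Columns\<close>

context
  fixes k n :: nat and ps \<nu> :: "nat list" and d :: "nat \<Rightarrow> nat"
  assumes ps: "restricted_partition k n ps" and \<nu>: "restricted_partition k n \<nu>"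
    and d: "\<And>i. i \<in> {1..n} \<Longrightarrow> d i \<in> {1..k}"
    and height: "\<And>c. c \<in> {1..k} \<Longrightarrow> card {i \<in> {1..n}. d i = c} = length (filter (\<lambda>p. c \<le> p) ps)"
    and inj: "\<And>i j. i \<in> {1..n} \<Longrightarrow> j \<in> {1..n} \<Longrightarrow> grouping k \<nu> i = grouping k \<nu> j \<Longrightarrow> d i = d j \<Longrightarrow> i = j"
begin

lemma card_fibre: "e \<in> groups k \<nu> \<Longrightarrow> card {i \<in> {1..n}. grouping k \<nu> i = e} = fst e"
  using card_grouping[of k \<nu> e] restricted_partitionD[OF \<nu>] by simp

lemma card_fibre_le:
  assumes "e \<in> groups k \<nu>"
  shows "card {i \<in> {1..n}. grouping k \<nu> i = e \<and> d i \<le> r} \<le> min (fst e) r"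
proof -
  let ?S = "{i \<in> {1..n}. grouping k \<nu> i = e \<and> d i \<le> r}"
  have "card ?S \<le> card {i \<in> {1..n}. grouping k \<nu> i = e}" by (rule card_mono) auto
  moreover have "card ?S \<le> card {1..r}"
  proof (rule card_inj_on_le)
    show "inj_on d ?S"
      by (rule inj_onI, rule inj) simp_all
    show "d ` ?S \<subseteq> {1..r}"
    proof
      fix c assume "c \<in> d ` ?S"
      then obtain i where "c = d i" "i \<in> {1..n}" "d i \<le> r" by blast
      then show "c \<in> {1..r}" using d[of i] by simp
    qed
  qed simp
  ultimately show ?thesis using card_fibre[OF assms] by simp
qed

lemma sum_card_fibre:
  assumes "r \<le> k"
  shows "(\<Sum>e\<in>groups k \<nu>. card {i \<in> {1..n}. grouping k \<nu> i = e \<and> d i \<le> r}) =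
    sum_list (map (\<lambda>x. min x r) ps)"
proof -
  have "(\<Sum>e\<in>groups k \<nu>. card {i \<in> {1..n}. grouping k \<nu> i = e \<and> d i \<le> r}) =
      card (\<Union>e\<in>groups k \<nu>. {i \<in> {1..n}. grouping k \<nu> i = e \<and> d i \<le> r})"
    by (rule card_UN_disjoint[symmetric]) auto
  also have "(\<Union>e\<in>groups k \<nu>. {i \<in> {1..n}. grouping k \<nu> i = e \<and> d i \<le> r}) =
      (\<Union>c\<in>{1..r}. {i \<in> {1..n}. d i = c})"
  proof (intro equalityI subsetI)
    fix i assume "i \<in> (\<Union>c\<in>{1..r}. {i \<in> {1..n}. d i = c})"
    then have i: "i \<in> {1..n}" "d i \<le> r" by auto
    then show "i \<in> (\<Union>e\<in>groups k \<nu>. {i \<in> {1..n}. grouping k \<nu> i = e \<and> d i \<le> r})"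
      using grouping_in[of k \<nu> i] restricted_partitionD[OF \<nu>] by simp
  next
    fix i assume "i \<in> (\<Union>e\<in>groups k \<nu>. {i \<in> {1..n}. grouping k \<nu> i = e \<and> d i \<le> r})"
    then have "i \<in> {1..n}" "d i \<le> r" by auto
    then show "i \<in> (\<Union>c\<in>{1..r}. {i \<in> {1..n}. d i = c})" using d[of i] by simp
  qed
  also have "card \<dots> = (\<Sum>c\<in>{1..r}. card {i \<in> {1..n}. d i = c})"
    by (rule card_UN_disjoint) auto
  also have "\<dots> = (\<Sum>c\<in>{1..r}. length (filter (\<lambda>p. c \<le> p) ps))"
    using assms by (intro sum.cong refl height) auto
  also have "\<dots> = sum_list (map (\<lambda>x. min x r) ps)"
    by (rule sum_list_min_conjugate[symmetric])
  finally show ?thesis .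
qed

text \<open>Injectivity bounds the share of each group in the first \<open>r\<close> columns by its
  truncated size. Summed over the groups, this contradicts the strict inequality of
  \<open>lex_gt_min_sum\<close>.\<close>

lemma columns_not_lex_gt: "\<not> lex_gt \<nu> ps"
proof
  assume "lex_gt \<nu> ps"
  then obtain r where r: "sum_list (map (\<lambda>x. min x r) \<nu>) < sum_list (map (\<lambda>x. min x r) ps)"
    using lex_gt_min_sum restricted_partitionD[OF ps] restricted_partitionD[OF \<nu>] by metis
  \<comment> \<open>The \<open>r\<close> obtained may exceed \<open>k\<close>, whereas heights are
    known only for the columns up to \<open>k\<close>. Truncating at \<open>k\<close> is harmless
    because no part exceeds \<open>k\<close>.\<close>
  have *: "sum_list (map (\<lambda>x. min x r) xs) = sum_list (map (\<lambda>x. min x (min r k)) xs)"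
    if "parts_in k xs" for xs
  proof -
    have "map (\<lambda>x. min x r) xs = map (\<lambda>x. min x (min r k)) xs"
      using that by (intro map_cong refl) (auto simp: parts_in_def min_def)
    then show ?thesis by (rule arg_cong)
  qed
  let ?r = "min r k"
  have "sum_list (map (\<lambda>x. min x ?r) ps) \<le> (\<Sum>e\<in>groups k \<nu>. min (fst e) ?r)"
  proof -
    have "(\<Sum>e\<in>groups k \<nu>. card {i \<in> {1..n}. grouping k \<nu> i = e \<and> d i \<le> ?r}) \<le> (\<Sum>e\<in>groups k \<nu>. min (fst e) ?r)"
      by (rule sum_mono) (rule card_fibre_le)
    then show ?thesis by (simp only: sum_card_fibre[of ?r, OF min.cobounded2])
  qed
  also have "\<dots> = sum_list (map (\<lambda>x. min x ?r) \<nu>)"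
    by (rule sum_groups[OF restricted_partitionD(1)[OF \<nu>]])
  finally show False
    using r *[OF restricted_partitionD(1)[OF ps]] *[OF restricted_partitionD(1)[OF \<nu>]] by simp
qed

text \<open>For equal partitions the termwise bounds have equal sums, so each is attained. With
  \<open>r\<close> the size of \<open>e\<close>, all variables of \<open>e\<close> lie in the first
  \<open>fst e\<close> columns, and injectivity makes them fill these columns.\<close>

lemma columns_bij:
  assumes eq: "\<nu> = ps" and e: "e \<in> groups k ps"
  shows "bij_betw d {i \<in> {1..n}. grouping k ps i = e} {1..fst e}"
proof -
  let ?F = "{i \<in> {1..n}. grouping k ps i = e}"
  have ek: "fst e \<le> k" using e by (rule groups_le)
  have "(\<Sum>e\<in>groups k \<nu>. min (fst e) (fst e0)) = sum_list (map (\<lambda>x. min x (fst e0)) \<nu>)" for e0 :: "nat \<times> nat"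
    by (rule sum_groups[OF restricted_partitionD(1)[OF \<nu>]])
  then have "(\<Sum>e'\<in>groups k \<nu>. card {i \<in> {1..n}. grouping k \<nu> i = e' \<and> d i \<le> fst e}) =
      (\<Sum>e'\<in>groups k \<nu>. min (fst e') (fst e))"
    using sum_card_fibre[OF ek] eq by simp
  from sum_mono_inv[OF this card_fibre_le] e eq
  have "card {i \<in> {1..n}. grouping k \<nu> i = e \<and> d i \<le> fst e} = min (fst e) (fst e)" by simp
  then have card: "card {i \<in> ?F. d i \<le> fst e} = card ?F"
    using card_fibre[of e] e eq by (simp add: conj_assoc)
  have "{i \<in> ?F. d i \<le> fst e} = ?F"
    by (rule card_subset_eq[OF _ _ card]) auto
  then have le: "d i \<le> fst e" if "i \<in> ?F" for i using that by blast
  have sub: "d ` ?F \<subseteq> {1..fst e}"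
  proof
    fix c assume "c \<in> d ` ?F"
    then obtain i where "c = d i" "i \<in> ?F" by blast
    then show "c \<in> {1..fst e}" using d[of i] le[of i] by simp
  qed
  have injF: "inj_on d ?F"
    by (rule inj_onI, rule inj) (simp_all add: eq)
  have "d ` ?F = {1..fst e}"
  proof (rule card_subset_eq[OF _ sub])
    show "card (d ` ?F) = card {1..fst e}" using card_image[OF injF] card_fibre[of e] e eq by simp
  qed simp
  with injF show ?thesis by (simp add: bij_betw_def)
qed

end

section \<open>The inverse construction\<close>

locale partition_pair =
  fixes k b0 l1 l2 :: nat and ps qs :: "nat list"
  assumes ps: "restricted_partition k l1 ps" and qs: "restricted_partition k l2 qs"
begin

abbreviation "W \<equiv> X ` {1..l1} \<union> Y ` {1..l2}"
abbreviation "\<gamma> \<equiv> gmap k ps qs"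
abbreviation "GV \<equiv> group_var_set k ps qs"

text \<open>Extensional functions are used so that the set is finite and can be summed over. The
  column heights are those of the conjugate partitions, read backwards for the y-variables.\<close>

definition colorings :: "(nat xy \<Rightarrow> nat) set" where
  "colorings = {\<kappa> \<in> W \<rightarrow>\<^sub>E {1..k}. \<forall>c\<in>{1..k}.
     card {u \<in> W. is_X u \<and> \<kappa> u = c} = length (filter (\<lambda>p. c \<le> p) ps) \<and>
     card {u \<in> W. \<not> is_X u \<and> \<kappa> u = c} = length (filter (\<lambda>p. k + 1 - c \<le> p) qs)}"

definition good_colorings :: "(nat xy \<Rightarrow> nat) set" where
  "good_colorings = {\<kappa> \<in> colorings. \<forall>e\<in>GV. bij_betw \<kappa> {u \<in> W. \<gamma> u = e} (columns k e)}"

definition col_pairs :: "(nat xy \<Rightarrow> nat) \<Rightarrow> (nat xy \<times> nat xy) set" where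
  "col_pairs \<kappa> = {(u, v) \<in> ord_pairs W is_X. \<kappa> u = \<kappa> v}"

definition T :: "(nat xy \<Rightarrow> nat) \<Rightarrow> nat xy mpoly" where
  "T \<kappa> = (\<Prod>(u, v)\<in>col_pairs \<kappa>. Var u - Var v) * (\<Prod>u\<in>{u \<in> W. is_X u \<and> b0 < \<kappa> u}. Var u)"

lemma finite_colorings [simp]: "finite colorings"
  by (rule finite_subset[OF _ finite_PiE[of W "\<lambda>_. {1..k}"]]) (auto simp: colorings_def)

lemma finite_col_pairs [simp]: "finite (col_pairs \<kappa>)"
  by (rule finite_subset[of _ "ord_pairs W is_X"]) (auto simp: col_pairs_def)

lemma coloring_range: "\<kappa> \<in> colorings \<Longrightarrow> u \<in> W \<Longrightarrow> \<kappa> u \<in> {1..k}"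
  unfolding colorings_def by (blast dest: PiE_mem)

lemma coloring_card:
  assumes "\<kappa> \<in> colorings" "c \<in> {1..k}"
  shows "card {u \<in> W. is_X u \<and> \<kappa> u = c} = length (filter (\<lambda>p. c \<le> p) ps)"
    and "card {u \<in> W. \<not> is_X u \<and> \<kappa> u = c} = length (filter (\<lambda>p. k + 1 - c \<le> p) qs)"
  using assms unfolding colorings_def by blast+

section \<open>Vanishing of the column products\<close>

lemma T_zero:
  assumes "u \<in> W" "v \<in> W" "u \<noteq> v" "\<kappa> u = \<kappa> v" "\<zeta> u = \<zeta> v"
  shows "peval \<zeta> (T \<kappa>) = 0"
proof -
  have "(u, v) \<in> col_pairs \<kappa> \<or> (v, u) \<in> col_pairs \<kappa>"
    using assms by (auto simp: col_pairs_def ord_pairs_def simp del: Un_iff)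
  then have "\<exists>p\<in>col_pairs \<kappa>. peval \<zeta> (case p of (u, v) \<Rightarrow> Var u - Var v) = 0"
  proof (elim disjE)
    assume "(u, v) \<in> col_pairs \<kappa>"
    then show "\<exists>p\<in>col_pairs \<kappa>. peval \<zeta> (case p of (u, v) \<Rightarrow> Var u - Var v) = 0"
      by (rule rev_bexI) (simp add: assms(5))
  next
    assume "(v, u) \<in> col_pairs \<kappa>"
    then show "\<exists>p\<in>col_pairs \<kappa>. peval \<zeta> (case p of (u, v) \<Rightarrow> Var u - Var v) = 0"
      by (rule rev_bexI) (simp add: assms(5))
  qed
  then have "(\<Prod>p\<in>col_pairs \<kappa>. peval \<zeta> (case p of (u, v) \<Rightarrow> Var u - Var v)) = 0"
    by (rule prod_zero[OF finite_col_pairs])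
  then show ?thesis by (simp add: T_def)
qed

lemma T_zero_X:
  assumes "u \<in> W" "is_X u" "b0 < \<kappa> u" "\<zeta> u = 0"
  shows "peval \<zeta> (T \<kappa>) = 0"
proof -
  have "(\<Prod>u\<in>{u \<in> W. is_X u \<and> b0 < \<kappa> u}. \<zeta> u) = 0"
    using assms by (intro prod_zero) auto
  then show ?thesis by (simp add: T_def)
qed

text \<open>Needed with \<open>m = k\<close> for the condition on \<open>k + 1\<close> equal
  variables and with \<open>m = b0\<close> for the condition at zero.\<close>

lemma T_pigeonhole:
  assumes S: "S \<subseteq> W" "\<And>u. u \<in> S \<Longrightarrow> \<zeta> u = t" and \<kappa>: "\<And>u. u \<in> S \<Longrightarrow> \<kappa> u \<in> {1..m}" "m < card S"
  shows "peval \<zeta> (T \<kappa>) = 0"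
proof -
  have "card (\<kappa> ` S) \<le> card {1..m}" using \<kappa>(1) by (intro card_mono) auto
  then have "\<not> inj_on \<kappa> S" using \<kappa>(2) by (intro pigeonhole) simp
  then obtain u v where "u \<in> S" "v \<in> S" "u \<noteq> v" "\<kappa> u = \<kappa> v" by (auto simp: inj_on_def)
  then show ?thesis using S by (intro T_zero[of u v]) auto
qed

text \<open>The reflection of the columns gives the y-variables the conjugate heights in increasing
  column order, so the results on columns apply to both sorts.\<close>

lemma coloring_heights:
  assumes "\<kappa> \<in> colorings" "c \<in> {1..k}"
  shows "card {i \<in> {1..l1}. \<kappa> (X i) = c} = length (filter (\<lambda>p. c \<le> p) ps)"
    and "card {j \<in> {1..l2}. k + 1 - \<kappa> (Y j) = c} = length (filter (\<lambda>p. c \<le> p) qs)"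
proof -
  have X: "card (X ` S) = card S" and Y: "card (Y ` S) = card S" for S :: "nat set"
    by (simp_all add: card_image inj_on_def)
  have "{u \<in> W. is_X u \<and> \<kappa> u = c} = X ` {i \<in> {1..l1}. \<kappa> (X i) = c}" by auto
  then show "card {i \<in> {1..l1}. \<kappa> (X i) = c} = length (filter (\<lambda>p. c \<le> p) ps)"
    using coloring_card(1)[OF assms] by (simp only: X)
  have "k + 1 - \<kappa> (Y j) = c \<longleftrightarrow> \<kappa> (Y j) = k + 1 - c" if "j \<in> {1..l2}" for j
    using coloring_range[OF assms(1), of "Y j"] that assms(2) by auto
  then have "{j \<in> {1..l2}. k + 1 - \<kappa> (Y j) = c} = {j \<in> {1..l2}. \<kappa> (Y j) = k + 1 - c}" by blast
  then have "{u \<in> W. \<not> is_X u \<and> \<kappa> u = k + 1 - c} = Y ` {j \<in> {1..l2}. k + 1 - \<kappa> (Y j) = c}"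
    by auto
  moreover have "k + 1 - c \<in> {1..k}" "k + 1 - (k + 1 - c) = c" using assms(2) by auto
  ultimately show "card {j \<in> {1..l2}. k + 1 - \<kappa> (Y j) = c} = length (filter (\<lambda>p. c \<le> p) qs)"
    using coloring_card(2)[OF assms(1), of "k + 1 - c"] by (simp only: Y)
qed

lemma injective_coloring:
  assumes \<kappa>: "\<kappa> \<in> colorings" and \<nu>: "restricted_partition k l1 \<nu>" "restricted_partition k l2 \<mu>"
    and inj_on: "inj_on (\<lambda>u. (gmap k \<nu> \<mu> u, \<kappa> u)) W"
  shows "\<not> lex_gt \<nu> ps" "\<not> lex_gt \<mu> qs" "\<nu> = ps \<Longrightarrow> \<mu> = qs \<Longrightarrow> \<kappa> \<in> good_colorings"
proof -
  have inj: "u = v" if "u \<in> W" "v \<in> W" "gmap k \<nu> \<mu> u = gmap k \<nu> \<mu> v" "\<kappa> u = \<kappa> v" for u v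
    using inj_onD[OF inj_on _ that(1,2)] that(3,4) by (simp only: prod.inject)
  have rX: "\<kappa> (X i) \<in> {1..k}" if "i \<in> {1..l1}" for i using coloring_range[OF \<kappa>, of "X i"] that by blast
  have rY: "\<kappa> (Y i) \<in> {1..k}" if "i \<in> {1..l2}" for i using coloring_range[OF \<kappa>, of "Y i"] that by blast
  then have rY': "k + 1 - \<kappa> (Y i) \<in> {1..k}" if "i \<in> {1..l2}" for i using that by fastforce
  have iX: "i = j" if "i \<in> {1..l1}" "j \<in> {1..l1}" "grouping k \<nu> i = grouping k \<nu> j" "\<kappa> (X i) = \<kappa> (X j)" for i j
    using inj[of "X i" "X j"] that by simp
  have iY: "i = j" if "i \<in> {1..l2}" "j \<in> {1..l2}" "grouping k \<mu> i = grouping k \<mu> j"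
    "k + 1 - \<kappa> (Y i) = k + 1 - \<kappa> (Y j)" for i j
  proof -
    have "\<kappa> (Y i) = \<kappa> (Y j)" using that(4) rY[OF that(1)] rY[OF that(2)] by auto
    then show ?thesis using inj[of "Y i" "Y j"] that by simp
  qed
  show "\<not> lex_gt \<nu> ps"
    by (rule columns_not_lex_gt[OF ps \<nu>(1) rX coloring_heights(1)[OF \<kappa>] iX])
  show "\<not> lex_gt \<mu> qs"
    by (rule columns_not_lex_gt[OF qs \<nu>(2) rY' coloring_heights(2)[OF \<kappa>] iY])
  assume eq: "\<nu> = ps" "\<mu> = qs"
  have "bij_betw \<kappa> {u \<in> W. \<gamma> u = v} (columns k v)" if "v \<in> GV" for v
  proof (cases v)
    case (X e)
    then have e: "e \<in> groups k ps" using that by (auto simp: group_var_set_def)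
    have "bij_betw (\<lambda>i. \<kappa> (X i)) {i \<in> {1..l1}. grouping k ps i = e} {1..fst e}"
      by (rule columns_bij[OF ps \<nu>(1) rX coloring_heights(1)[OF \<kappa>] iX eq(1) e])
    moreover have "bij_betw X {i \<in> {1..l1}. grouping k ps i = e} {u \<in> W. \<gamma> u = v}"
      using X by (auto simp: bij_betw_def inj_on_def)
    ultimately show ?thesis using X by (simp add: bij_betw_comp_iff[of X _ _ \<kappa>] o_def)
  next
    case (Y e)
    then have e: "e \<in> groups k qs" using that by (auto simp: group_var_set_def)
    let ?F = "{i \<in> {1..l2}. grouping k qs i = e}"
    \<comment> \<open>The y-columns are counted from the right; reflecting once more turns the first
      columns into the last ones.\<close>
    have "bij_betw (\<lambda>i. k + 1 - \<kappa> (Y i)) ?F {1..fst e}"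
      by (rule columns_bij[OF qs \<nu>(2) rY' coloring_heights(2)[OF \<kappa>] iY eq(2) e])
    moreover have "bij_betw (\<lambda>c. k + 1 - c) {1..fst e} {k + 1 - fst e..k}"
      using groups_le[OF e] by (intro bij_betw_byWitness[where f' = "\<lambda>c. k + 1 - c"]) auto
    ultimately have "bij_betw (\<lambda>i. k + 1 - (k + 1 - \<kappa> (Y i))) ?F {k + 1 - fst e..k}"
      using bij_betw_trans by (fastforce simp: o_def)
    moreover have "k + 1 - (k + 1 - \<kappa> (Y i)) = \<kappa> (Y i)" if "i \<in> ?F" for i
      using rY[of i] that by auto
    ultimately have "bij_betw (\<lambda>i. \<kappa> (Y i)) ?F {k + 1 - fst e..k}"
      using bij_betw_cong[of ?F] by (metis (no_types, lifting))
    moreover have "bij_betw Y ?F {u \<in> W. \<gamma> u = v}"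
      using Y by (auto simp: bij_betw_def inj_on_def)
    ultimately show ?thesis using Y by (simp add: bij_betw_comp_iff[of Y _ _ \<kappa>] o_def)
  qed
  then show "\<kappa> \<in> good_colorings" using \<kappa> by (simp add: good_colorings_def)
qed

text \<open>At a non-zero value, two variables of one column never share a group, so group and
  column together determine the variable. \<open>injective_coloring\<close> excludes this for a
  larger partition in either component.\<close>

lemma T_specialized_zero:
  assumes \<kappa>: "\<kappa> \<in> colorings" and \<nu>: "restricted_partition k l1 \<nu>" "restricted_partition k l2 \<mu>"
    and "pair_gt (\<nu>, \<mu>) (ps, qs)"
  shows "peval (\<lambda>v. z (gmap k \<nu> \<mu> v)) (T \<kappa>) = 0"
proof (rule ccontr)
  assume nz: "\<not> ?thesis"
  have inj: "u = v" if "u \<in> W" "v \<in> W" "gmap k \<nu> \<mu> u = gmap k \<nu> \<mu> v" "\<kappa> u = \<kappa> v" for u v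
  proof (rule ccontr)
    assume "u \<noteq> v"
    from T_zero[where \<zeta> = "\<lambda>v. z (gmap k \<nu> \<mu> v)", OF that(1,2) this that(4)] that(3) nz show False by simp
  qed
  have "inj_on (\<lambda>u. (gmap k \<nu> \<mu> u, \<kappa> u)) W"
    by (rule inj_onI, rule inj) simp_all
  from injective_coloring(1,2)[OF \<kappa> \<nu> this] show False using assms(4) by (auto simp: pair_gt_def)
qed

lemma T_bad_zero:
  assumes \<kappa>: "\<kappa> \<in> colorings" "\<kappa> \<notin> good_colorings"
  shows "peval (\<lambda>v. z (\<gamma> v)) (T \<kappa>) = 0"
proof (rule ccontr)
  assume nz: "\<not> ?thesis"
  have inj: "u = v" if "u \<in> W" "v \<in> W" "\<gamma> u = \<gamma> v" "\<kappa> u = \<kappa> v" for u v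
  proof (rule ccontr)
    assume "u \<noteq> v"
    from T_zero[where \<zeta> = "\<lambda>v. z (\<gamma> v)", OF that(1,2) this that(4)] that(3) nz show False by simp
  qed
  have "inj_on (\<lambda>u. (\<gamma> u, \<kappa> u)) W"
    by (rule inj_onI, rule inj) simp_all
  from injective_coloring(3)[OF \<kappa>(1) ps qs this] show False using \<kappa>(2) by simp
qed

lemma is_X_\<gamma> [simp]: "is_X (\<gamma> u) = is_X u"
  by (cases u) simp_all

lemma \<gamma>_in: "u \<in> W \<Longrightarrow> \<gamma> u \<in> GV"
  by (rule gmap_in[OF ps qs])

section \<open>Extremal arrangements\<close>

context
  fixes \<kappa> assumes good: "\<forall>e\<in>GV. bij_betw \<kappa> {u \<in> W. \<gamma> u = e} (columns k e)"
begin

lemma good_bij: "e \<in> GV \<Longrightarrow> bij_betw \<kappa> {u \<in> W. \<gamma> u = e} (columns k e)"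
  using good by (rule bspec)

lemma good_inj: "u \<in> W \<Longrightarrow> v \<in> W \<Longrightarrow> \<gamma> u = \<gamma> v \<Longrightarrow> \<kappa> u = \<kappa> v \<Longrightarrow> u = v"
  using inj_onD[OF bij_betw_imp_inj_on[OF good_bij[OF \<gamma>_in[of v]]], of u v] by simp

lemma good_column: "u \<in> W \<Longrightarrow> \<kappa> u \<in> columns k (\<gamma> u)"
  using bij_betwE[OF good_bij[OF \<gamma>_in[of u]]] by simp

lemma good_surj: "e \<in> GV \<Longrightarrow> c \<in> columns k e \<Longrightarrow> \<exists>u\<in>W. \<gamma> u = e \<and> \<kappa> u = c"
proof -
  assume "e \<in> GV" "c \<in> columns k e"
  then have "c \<in> \<kappa> ` {u \<in> W. \<gamma> u = e}" using bij_betw_imp_surj_on[OF good_bij[of e]] by simp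
  then obtain u where "u \<in> {u \<in> W. \<gamma> u = e}" "c = \<kappa> u" by (rule imageE)
  then show ?thesis by blast
qed

lemma good_column_bij:
  "bij_betw \<gamma> {u \<in> W. P (is_X u) \<and> \<kappa> u = c} {e \<in> GV. P (is_X e) \<and> c \<in> columns k e}"
  unfolding bij_betw_def
proof (intro conjI inj_onI equalityI subsetI)
  show "u = v" if "u \<in> {u \<in> W. P (is_X u) \<and> \<kappa> u = c}" "v \<in> {u \<in> W. P (is_X u) \<and> \<kappa> u = c}" "\<gamma> u = \<gamma> v" for u v
    using that good_inj[of u v] by simp
  show "e \<in> {e \<in> GV. P (is_X e) \<and> c \<in> columns k e}" if "e \<in> \<gamma> ` {u \<in> W. P (is_X u) \<and> \<kappa> u = c}" for e
    using that \<gamma>_in good_column by force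
  show "e \<in> \<gamma> ` {u \<in> W. P (is_X u) \<and> \<kappa> u = c}" if e: "e \<in> {e \<in> GV. P (is_X e) \<and> c \<in> columns k e}" for e
  proof -
    obtain u where u: "u \<in> W" "\<gamma> u = e" "\<kappa> u = c" using e good_surj[of e c] by blast
    then have "P (is_X u)" using e is_X_\<gamma>[of u] by simp
    then show ?thesis using u by blast
  qed
qed

text \<open>A pair of variables in a common column is the same as a pair of different groups
  together with a column they share. So each difference of group variables occurs once per shared
  column, and each x-group once per column beyond \<open>b0\<close>. The value does not depend on
  \<open>\<kappa>\<close>.\<close>

lemma T_good: "peval (\<lambda>v. z (\<gamma> v)) (T \<kappa>) = peval z (G_ord k b0 ps qs)"
proof -
  let ?O = "ord_pairs GV is_X"
  let ?C = "\<lambda>p. columns k (fst p) \<inter> columns k (snd p)"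
  have "bij_betw (\<lambda>(u, v). ((\<gamma> u, \<gamma> v), \<kappa> u)) (col_pairs \<kappa>) (Sigma ?O ?C)"
    unfolding bij_betw_def
  proof (intro conjI inj_onI equalityI subsetI)
    fix p q assume "p \<in> col_pairs \<kappa>" "q \<in> col_pairs \<kappa>"
      "(case p of (u, v) \<Rightarrow> ((\<gamma> u, \<gamma> v), \<kappa> u)) = (case q of (u, v) \<Rightarrow> ((\<gamma> u, \<gamma> v), \<kappa> u))"
    then show "p = q"
      using good_inj[of "fst p" "fst q"] good_inj[of "snd p" "snd q"]
      by (cases p; cases q) (simp add: col_pairs_def ord_pairs_def)
  next
    fix x assume "x \<in> (\<lambda>(u, v). ((\<gamma> u, \<gamma> v), \<kappa> u)) ` col_pairs \<kappa>"
    then obtain u v where x: "x = ((\<gamma> u, \<gamma> v), \<kappa> u)" "u \<in> W" "v \<in> W" "u \<noteq> v" "\<kappa> u = \<kappa> v" "is_X u \<or> \<not> is_X v"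
      by (auto simp: col_pairs_def ord_pairs_def simp del: Un_iff)
    have "\<gamma> u \<noteq> \<gamma> v" using good_inj[OF x(2,3) _ x(5)] x(4) by argo
    then show "x \<in> Sigma ?O ?C"
      using x \<gamma>_in good_column[of u] good_column[of v] by (simp add: ord_pairs_def)
  next
    fix x assume "x \<in> Sigma ?O ?C"
    then obtain e f c where x: "x = ((e, f), c)" "e \<in> GV" "f \<in> GV" "e \<noteq> f" "is_X e \<or> \<not> is_X f"
      "c \<in> columns k e" "c \<in> columns k f" by (auto simp: ord_pairs_def)
    obtain u v where uv: "u \<in> W" "\<gamma> u = e" "\<kappa> u = c" "v \<in> W" "\<gamma> v = f" "\<kappa> v = c"
      using good_surj x by metis
    then have "(u, v) \<in> col_pairs \<kappa>" using x by (auto simp: col_pairs_def ord_pairs_def simp del: Un_iff)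
    then show "x \<in> (\<lambda>(u, v). ((\<gamma> u, \<gamma> v), \<kappa> u)) ` col_pairs \<kappa>"
      using uv x by (intro image_eqI[of _ _ "(u, v)"]) auto
  qed
  from prod.reindex_bij_betw[OF this, of "\<lambda>(p, c). z (fst p) - z (snd p)"]
  have "(\<Prod>(u, v)\<in>col_pairs \<kappa>. z (\<gamma> u) - z (\<gamma> v)) = (\<Prod>(p, c)\<in>Sigma ?O ?C. z (fst p) - z (snd p))"
    by (simp add: case_prod_beta)
  also have "\<dots> = (\<Prod>p\<in>?O. \<Prod>c\<in>?C p. z (fst p) - z (snd p))"
  proof (rule prod.Sigma[symmetric])
    have "finite (columns k e)" for e by (cases e) simp_all
    then show "\<forall>p\<in>?O. finite (?C p)" by blast
  qed simp
  finally have 1: "(\<Prod>(u, v)\<in>col_pairs \<kappa>. z (\<gamma> u) - z (\<gamma> v)) =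
      (\<Prod>(u, v)\<in>?O. (z u - z v) ^ card (columns k u \<inter> columns k v))"
    by (simp add: case_prod_beta)
  let ?U = "X ` groups k ps :: (nat \<times> nat) xy set"
  let ?D = "\<lambda>e. columns k e \<inter> {b0<..}"
  have U: "e \<in> ?U \<longleftrightarrow> e \<in> GV \<and> is_X e" for e by (cases e) (auto simp: group_var_set_def)
  have "bij_betw (\<lambda>u. (\<gamma> u, \<kappa> u)) {u \<in> W. is_X u \<and> b0 < \<kappa> u} (Sigma ?U ?D)"
    unfolding bij_betw_def
  proof (intro conjI inj_onI equalityI subsetI)
    show "u = v" if "u \<in> {u \<in> W. is_X u \<and> b0 < \<kappa> u}" "v \<in> {u \<in> W. is_X u \<and> b0 < \<kappa> u}" "(\<gamma> u, \<kappa> u) = (\<gamma> v, \<kappa> v)" for u v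
      using that good_inj[of u v] by simp
    show "x \<in> Sigma ?U ?D" if xi: "x \<in> (\<lambda>u. (\<gamma> u, \<kappa> u)) ` {u \<in> W. is_X u \<and> b0 < \<kappa> u}" for x
    proof -
      obtain u where u: "x = (\<gamma> u, \<kappa> u)" "u \<in> W" "is_X u" "b0 < \<kappa> u" using xi by blast
      then have "\<gamma> u \<in> ?U" unfolding U using \<gamma>_in by simp
      then show ?thesis using u good_column[of u] by simp
    qed
    show "x \<in> (\<lambda>u. (\<gamma> u, \<kappa> u)) ` {u \<in> W. is_X u \<and> b0 < \<kappa> u}" if xs: "x \<in> Sigma ?U ?D" for x
    proof -
      obtain e c where x: "x = (e, c)" "e \<in> GV" "is_X e" "c \<in> columns k e" "b0 < c"
        using xs U by (cases x) auto
      then obtain u where "u \<in> W" "\<gamma> u = e" "\<kappa> u = c" using good_surj[OF x(2,4)] by blast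
      then show ?thesis using x by (intro image_eqI[of _ _ u]) auto
    qed
  qed
  from prod.reindex_bij_betw[OF this, of "\<lambda>(e, c). z e"]
  have "(\<Prod>u\<in>{u \<in> W. is_X u \<and> b0 < \<kappa> u}. z (\<gamma> u)) = (\<Prod>(e, c)\<in>Sigma ?U ?D. z e)"
    by simp
  also have "\<dots> = (\<Prod>e\<in>?U. \<Prod>c\<in>?D e. z e)"
  proof (rule prod.Sigma[symmetric])
    have "finite (columns k e)" for e by (cases e) simp_all
    then show "\<forall>e\<in>?U. finite (?D e)" by blast
  qed simp
  finally have 2: "(\<Prod>u\<in>{u \<in> W. is_X u \<and> b0 < \<kappa> u}. z (\<gamma> u)) = (\<Prod>e\<in>?U. z e ^ card (?D e))"
    by simp
  show ?thesis
    unfolding T_def G_ord_def peval_mult peval_prod case_prod_beta peval_diff peval_Var peval_power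
    using 1[unfolded case_prod_beta'] 2 by (simp only:)
qed

end

lemma card_GV:
  assumes "c \<in> {1..k}"
  shows "card {e \<in> GV. is_X e \<and> c \<in> columns k e} = length (filter (\<lambda>p. c \<le> p) ps)"
    and "card {e \<in> GV. \<not> is_X e \<and> c \<in> columns k e} = length (filter (\<lambda>p. k + 1 - c \<le> p) qs)"
proof -
  have "{e \<in> GV. is_X e \<and> c \<in> columns k e} = X ` {e \<in> groups k ps. c \<le> fst e}"
    using assms by (auto simp: group_var_set_def)
  then show "card {e \<in> GV. is_X e \<and> c \<in> columns k e} = length (filter (\<lambda>p. c \<le> p) ps)"
    using card_groups[OF restricted_partitionD(1)[OF ps], of "\<lambda>a. c \<le> a"]
    by (simp add: card_image inj_on_def)
  have "{e \<in> GV. \<not> is_X e \<and> c \<in> columns k e} = Y ` {e \<in> groups k qs. k + 1 - c \<le> fst e}"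
    using assms by (auto simp: group_var_set_def)
  then show "card {e \<in> GV. \<not> is_X e \<and> c \<in> columns k e} = length (filter (\<lambda>p. k + 1 - c \<le> p) qs)"
    using card_groups[OF restricted_partitionD(1)[OF qs], of "\<lambda>a. k + 1 - c \<le> a"]
    by (simp add: card_image inj_on_def)
qed

end

context partition_pair
begin

text \<open>The number of good colorings is a factor of the specialized sum and has to be
  invertible. Any choice of bijections from the groups to their columns is good; the column heights
  come out right by \<open>card_GV\<close>.\<close>

lemma good_colorings_exist: "good_colorings \<noteq> {}"
proof -
  have "\<exists>h. bij_betw h {u \<in> W. \<gamma> u = e} (columns k e)" if e: "e \<in> GV" for e
  proof (rule finite_same_card_bij)
    show "finite (columns k e)" by (cases e) simp_all
    show "card {u \<in> W. \<gamma> u = e} = card (columns k e)"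
    proof (cases e)
      case (X x)
      have "{u \<in> W. \<gamma> u = e} = X ` {i \<in> {1..l1}. \<gamma> (X i) = e}" using X by auto
      then have "card {u \<in> W. \<gamma> u = e} = card {i \<in> {1..l1}. \<gamma> (X i) = e}"
        by (simp only:) (rule card_image, simp add: inj_on_def)
      then show ?thesis using card_fibre_X[OF ps, of qs e] e X by simp
    next
      case (Y x)
      have "{u \<in> W. \<gamma> u = e} = Y ` {i \<in> {1..l2}. \<gamma> (Y i) = e}" using Y by auto
      then have "card {u \<in> W. \<gamma> u = e} = card {i \<in> {1..l2}. \<gamma> (Y i) = e}"
        by (simp only:) (rule card_image, simp add: inj_on_def)
      moreover have "fst x \<le> k" using e Y groups_le by (auto simp: group_var_set_def)
      ultimately show ?thesis using card_fibre_Y[OF qs, of ps e] e Y by simp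
    qed
  qed simp
  then have "\<exists>h. \<forall>e\<in>GV. bij_betw (h e) {u \<in> W. \<gamma> u = e} (columns k e)"
    by (intro bchoice ballI)
  then obtain h where h: "\<And>e. e \<in> GV \<Longrightarrow> bij_betw (h e) {u \<in> W. \<gamma> u = e} (columns k e)" by blast
  define \<kappa> where "\<kappa> = restrict (\<lambda>u. h (\<gamma> u) u) W"
  have bij: "\<forall>e\<in>GV. bij_betw \<kappa> {u \<in> W. \<gamma> u = e} (columns k e)"
  proof
    fix e assume "e \<in> GV"
    from h[OF this] show "bij_betw \<kappa> {u \<in> W. \<gamma> u = e} (columns k e)"
      by (rule bij_betw_cong[THEN iffD1, rotated]) (simp add: \<kappa>_def)
  qed
  have "\<kappa> \<in> W \<rightarrow>\<^sub>E {1..k}"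
  proof (rule PiE_I)
    fix u assume u: "u \<in> W"
    have "columns k e \<subseteq> {1..k}" if "e \<in> GV" for e
      using that groups_le[of _ k ps] groups_le[of _ k qs] by (fastforce simp: group_var_set_def)
    from subsetD[OF this[OF \<gamma>_in[OF u]] good_column[OF bij u]] show "\<kappa> u \<in> {1..k}" .
  qed (auto simp: \<kappa>_def restrict_def)
  moreover have "card {u \<in> W. is_X u \<and> \<kappa> u = c} = length (filter (\<lambda>p. c \<le> p) ps)"
    "card {u \<in> W. \<not> is_X u \<and> \<kappa> u = c} = length (filter (\<lambda>p. k + 1 - c \<le> p) qs)" if "c \<in> {1..k}" for c
    using bij_betw_same_card[OF good_column_bij[OF bij, of "\<lambda>x. x" c]]
      bij_betw_same_card[OF good_column_bij[OF bij, of Not c]] card_GV[OF that] by simp_all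
  ultimately have "\<kappa> \<in> good_colorings" using bij by (simp add: good_colorings_def colorings_def)
  then show ?thesis by blast
qed

section \<open>Equivariance under permutations of the x- and of the y-variables\<close>

definition sort_perm :: "(nat xy \<Rightarrow> nat xy) \<Rightarrow> bool" where
  "sort_perm \<pi> \<longleftrightarrow> \<pi> permutes X ` {1..l1} \<or> \<pi> permutes Y ` {1..l2}"

lemma sort_perm:
  assumes "sort_perm \<pi>"
  shows "bij \<pi>" "\<pi> v \<in> W \<longleftrightarrow> v \<in> W" "is_X (\<pi> v) = is_X v"
proof -
  show "bij \<pi>" using assms permutes_bij unfolding sort_perm_def by blast
  have "\<pi> v = v \<or> v \<in> X ` {1..l1} \<and> \<pi> v \<in> X ` {1..l1} \<or> v \<in> Y ` {1..l2} \<and> \<pi> v \<in> Y ` {1..l2}"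
    using assms permutes_cases[of \<pi> "X ` {1..l1}" v] permutes_cases[of \<pi> "Y ` {1..l2}" v]
    unfolding sort_perm_def by meson
  then show "\<pi> v \<in> W \<longleftrightarrow> v \<in> W" "is_X (\<pi> v) = is_X v" by auto
qed

lemma sort_perm_bij_betw:
  assumes "sort_perm \<pi>"
  shows "bij_betw \<pi> {u \<in> W. P (is_X u) \<and> Q (\<kappa> (\<pi> u))} {u \<in> W. P (is_X u) \<and> Q (\<kappa> u)}"
  unfolding bij_betw_def
proof (intro conjI equalityI subsetI)
  show "inj_on \<pi> {u \<in> W. P (is_X u) \<and> Q (\<kappa> (\<pi> u))}"
    using bij_is_inj[OF sort_perm(1)[OF assms]] by (rule inj_on_subset) simp
  fix u
  show "u \<in> {u \<in> W. P (is_X u) \<and> Q (\<kappa> u)}" if u: "u \<in> \<pi> ` {u \<in> W. P (is_X u) \<and> Q (\<kappa> (\<pi> u))}"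
  proof -
    obtain v where "u = \<pi> v" "v \<in> {u \<in> W. P (is_X u) \<and> Q (\<kappa> (\<pi> u))}" using u by (rule imageE)
    then show ?thesis using sort_perm(2,3)[OF assms, of v] by simp
  qed
  show "u \<in> \<pi> ` {u \<in> W. P (is_X u) \<and> Q (\<kappa> (\<pi> u))}" if u: "u \<in> {u \<in> W. P (is_X u) \<and> Q (\<kappa> u)}"
  proof -
    obtain v where v: "u = \<pi> v" using bij_is_surj[OF sort_perm(1)[OF assms]] by (rule surjE)
    then have "v \<in> {u \<in> W. P (is_X u) \<and> Q (\<kappa> (\<pi> u))}" using u sort_perm(2,3)[OF assms, of v] by simp
    then show ?thesis using v by blast
  qed
qed

lemma coloring_comp:
  assumes \<pi>: "sort_perm \<pi>" and \<kappa>: "\<kappa> \<in> colorings"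
  shows "\<kappa> \<circ> \<pi> \<in> colorings"
proof -
  have "\<kappa> \<in> W \<rightarrow>\<^sub>E {1..k}" using \<kappa> unfolding colorings_def by blast
  then have "\<kappa> \<circ> \<pi> \<in> W \<rightarrow>\<^sub>E {1..k}"
  proof (intro PiE_I)
    show "(\<kappa> \<circ> \<pi>) u \<in> {1..k}" if "u \<in> W" for u
      using coloring_range[OF \<kappa>, of "\<pi> u"] that sort_perm(2)[OF \<pi>, of u] by (simp only: o_apply)
    show "(\<kappa> \<circ> \<pi>) u = undefined" if "u \<notin> W" for u
      using PiE_arb[OF \<open>\<kappa> \<in> W \<rightarrow>\<^sub>E {1..k}\<close>, of "\<pi> u"] that sort_perm(2)[OF \<pi>, of u] by (simp only: o_apply not_False_eq_True)
  qed
  moreover have "card {u \<in> W. is_X u \<and> (\<kappa> \<circ> \<pi>) u = c} = length (filter (\<lambda>p. c \<le> p) ps)"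
    "card {u \<in> W. \<not> is_X u \<and> (\<kappa> \<circ> \<pi>) u = c} = length (filter (\<lambda>p. k + 1 - c \<le> p) qs)"
    if "c \<in> {1..k}" for c
    using bij_betw_same_card[OF sort_perm_bij_betw[OF \<pi>, of "\<lambda>x. x" "\<lambda>x. x = c" \<kappa>]]
      bij_betw_same_card[OF sort_perm_bij_betw[OF \<pi>, of Not "\<lambda>x. x = c" \<kappa>]] coloring_card[OF \<kappa> that]
    by (simp_all only: o_apply)
  ultimately show ?thesis unfolding colorings_def by blast
qed

lemma sum_colorings_comp:
  assumes \<pi>: "sort_perm \<pi>"
  shows "(\<Sum>\<kappa>\<in>colorings. F \<kappa>) = (\<Sum>\<kappa>\<in>colorings. F (\<kappa> \<circ> \<pi>))"
proof -
  let ?c = "\<lambda>\<kappa> :: nat xy \<Rightarrow> nat. \<kappa> \<circ> \<pi>"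
  have inj: "inj_on ?c colorings"
  proof (rule inj_onI)
    fix \<kappa> \<kappa>' assume "\<kappa> \<circ> \<pi> = \<kappa>' \<circ> \<pi>"
    then show "\<kappa> = \<kappa>'"
      using bij_is_surj[OF sort_perm(1)[OF \<pi>]] by (metis surj_fun_eq)
  qed
  then have "?c ` colorings = colorings"
    using coloring_comp[OF \<pi>] by (intro endo_inj_surj) auto
  with inj have "bij_betw ?c colorings colorings" by (simp add: bij_betw_def)
  then show ?thesis by (rule sum.reindex_bij_betw[symmetric])
qed

lemma act_T:
  assumes \<pi>: "sort_perm \<pi>"
  shows "act \<pi> (T (\<kappa> \<circ> \<pi>)) = T \<kappa>"
proof -
  note bij = sort_perm(1)[OF \<pi>]
  have "bij_betw (map_prod \<pi> \<pi>) (col_pairs (\<kappa> \<circ> \<pi>)) (col_pairs \<kappa>)"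
    unfolding bij_betw_def
  proof (intro conjI equalityI subsetI)
    show "inj_on (map_prod \<pi> \<pi>) (col_pairs (\<kappa> \<circ> \<pi>))"
      using injD[OF bij_is_inj[OF bij]] by (auto simp: inj_on_def)
    have mem: "(\<pi> u, \<pi> v) \<in> col_pairs \<kappa> \<longleftrightarrow> (u, v) \<in> col_pairs (\<kappa> \<circ> \<pi>)" for u v
      using injD[OF bij_is_inj[OF bij], of u v] sort_perm(2,3)[OF \<pi>]
      by (auto simp: col_pairs_def ord_pairs_def simp del: Un_iff)
    fix p
    show "p \<in> col_pairs \<kappa>" if "p \<in> map_prod \<pi> \<pi> ` col_pairs (\<kappa> \<circ> \<pi>)"
      using that mem by auto
    show "p \<in> map_prod \<pi> \<pi> ` col_pairs (\<kappa> \<circ> \<pi>)" if p: "p \<in> col_pairs \<kappa>"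
    proof -
      obtain u v where "fst p = \<pi> u" "snd p = \<pi> v" using bij_is_surj[OF bij] by (meson surjE)
      then have uv: "p = (\<pi> u, \<pi> v)" by (simp add: prod_eq_iff)
      then have "(u, v) \<in> col_pairs (\<kappa> \<circ> \<pi>)" using p mem by simp
      then show ?thesis using uv by force
    qed
  qed
  from prod.reindex_bij_betw[OF this, of "\<lambda>(u, v). Var u - Var v"]
  have 1: "(\<Prod>p\<in>col_pairs (\<kappa> \<circ> \<pi>). Var (\<pi> (fst p)) - Var (\<pi> (snd p))) =
      (\<Prod>p\<in>col_pairs \<kappa>. Var (fst p) - Var (snd p))"
    by (simp add: case_prod_beta')
  have "{u \<in> W. is_X u \<and> b0 < (\<kappa> \<circ> \<pi>) u} = {u \<in> W. is_X u \<and> b0 < \<kappa> (\<pi> u)}" by simp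
  then have 2: "(\<Prod>u\<in>{u \<in> W. is_X u \<and> b0 < (\<kappa> \<circ> \<pi>) u}. Var (\<pi> u)) = (\<Prod>u\<in>{u \<in> W. is_X u \<and> b0 < \<kappa> u}. Var u)"
    using prod.reindex_bij_betw[OF sort_perm_bij_betw[OF \<pi>, of "\<lambda>x. x" "\<lambda>x. b0 < x" \<kappa>], of Var] by (simp only:)
  show ?thesis
    unfolding T_def by (simp only: psubst_mult psubst_prod psubst_diff psubst_Var case_prod_beta' 1 2)
qed

lemma vars_T: "vars (T \<kappa>) \<subseteq> W"
  unfolding T_def
proof (intro vars_multI vars_prodI)
  fix p assume "p \<in> col_pairs \<kappa>"
  then show "vars (case p of (u, v) \<Rightarrow> Var u - Var v) \<subseteq> W"
    by (cases p) (simp add: col_pairs_def ord_pairs_def vars_diffI)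
qed auto

text \<open>\<open>H\<close> attaches a cofactor to each coloring: the second condition makes the
  sum of \<open>T \<kappa> * H \<kappa>\<close> symmetric, the third makes its extremal terms
  specialize to multiples of \<open>h\<close>. At the other colorings \<open>T\<close> already
  specializes to zero.\<close>

definition realizes :: "((nat xy \<Rightarrow> nat) \<Rightarrow> nat xy mpoly) \<Rightarrow> (nat \<times> nat) xy mpoly \<Rightarrow> bool" where
  "realizes H h \<longleftrightarrow> (\<forall>\<kappa>\<in>colorings. vars (H \<kappa>) \<subseteq> W) \<and>
     (\<forall>\<pi>. sort_perm \<pi> \<longrightarrow> (\<forall>\<kappa>\<in>colorings. act \<pi> (H (\<kappa> \<circ> \<pi>)) = H \<kappa>)) \<and>
     (\<forall>\<kappa>\<in>good_colorings. \<forall>z. peval (\<lambda>v. z (\<gamma> v)) (H \<kappa>) = peval z h)"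

lemma realizes_Const: "realizes (\<lambda>_. Const c) (Const c)"
  by (simp add: realizes_def)

lemma realizes_add: "realizes H h \<Longrightarrow> realizes H' h' \<Longrightarrow> realizes (\<lambda>\<kappa>. H \<kappa> + H' \<kappa>) (h + h')"
  by (simp add: realizes_def vars_addI)

lemma realizes_diff: "realizes H h \<Longrightarrow> realizes H' h' \<Longrightarrow> realizes (\<lambda>\<kappa>. H \<kappa> - H' \<kappa>) (h - h')"
  by (simp add: realizes_def vars_diffI)

lemma realizes_mult: "realizes H h \<Longrightarrow> realizes H' h' \<Longrightarrow> realizes (\<lambda>\<kappa>. H \<kappa> * H' \<kappa>) (h * h')"
  by (simp add: realizes_def vars_multI)

text \<open>The basic cofactors: in an extremal arrangement, the variables of one sort in column
  \<open>c\<close> represent the groups of that sort meeting \<open>c\<close>, once each.\<close>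

lemma realizes_column_power_sum:
  "realizes (\<lambda>\<kappa>. \<Sum>u\<in>{u \<in> W. P (is_X u) \<and> \<kappa> u = c}. Var u ^ m)
     (\<Sum>e\<in>{e \<in> GV. P (is_X e) \<and> c \<in> columns k e}. Var e ^ m)"
  unfolding realizes_def
proof (intro conjI ballI allI impI)
  fix \<kappa>
  show "vars (\<Sum>u\<in>{u \<in> W. P (is_X u) \<and> \<kappa> u = c}. Var u ^ m) \<subseteq> W"
    by (intro vars_sumI vars_powerI) auto
  show "act \<pi> (\<Sum>u\<in>{u \<in> W. P (is_X u) \<and> (\<kappa> \<circ> \<pi>) u = c}. Var u ^ m) =
      (\<Sum>u\<in>{u \<in> W. P (is_X u) \<and> \<kappa> u = c}. Var u ^ m)" if \<pi>: "sort_perm \<pi>" for \<pi>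
    using sum.reindex_bij_betw[OF sort_perm_bij_betw[OF \<pi>, of P "\<lambda>x. x = c" \<kappa>], of "\<lambda>u. Var u ^ m"]
    by (simp only: psubst_sum psubst_power psubst_Var o_apply)
  fix z :: "(nat \<times> nat) xy \<Rightarrow> complex"
  assume "\<kappa> \<in> good_colorings"
  then have "\<forall>e\<in>GV. bij_betw \<kappa> {u \<in> W. \<gamma> u = e} (columns k e)" by (simp add: good_colorings_def)
  from sum.reindex_bij_betw[OF good_column_bij[OF this, of P c], of "\<lambda>e. z e ^ m"]
  show "peval (\<lambda>v. z (\<gamma> v)) (\<Sum>u\<in>{u \<in> W. P (is_X u) \<and> \<kappa> u = c}. Var u ^ m) =
      peval z (\<Sum>e\<in>{e \<in> GV. P (is_X e) \<and> c \<in> columns k e}. Var e ^ m)"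
    by (simp only: peval_sum peval_power peval_Var)
qed

lemma group_vars_eq: "a \<in> {1..k} \<Longrightarrow> group_vars V rs a = V ` {e \<in> groups k rs. fst e = a}"
  by (auto simp: groups_def image_iff)

lemma tensor_realizable:
  assumes "h \<in> tensor (S_space k X ps) (S_space k Y qs)"
  shows "\<exists>H. realizes H h"
proof -
  have "tensor (S_space k X ps) (S_space k Y qs) \<subseteq> {h. \<exists>H. realizes H h}"
  proof (rule tensor_S_space_subset)
    show "Const c \<in> {h. \<exists>H. realizes H h}" for c using realizes_Const by blast
    show "p + q \<in> {h. \<exists>H. realizes H h}" "p * q \<in> {h. \<exists>H. realizes H h}"
      if "p \<in> {h. \<exists>H. realizes H h}" "q \<in> {h. \<exists>H. realizes H h}" for p q
      using that realizes_add realizes_mult by blast+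
    \<comment> \<open>To be used for neighbouring columns, where \<open>C\<close> consists of the
      groups that meet the first but not the second, that is, the groups of one size.\<close>
    have diff: "(\<Sum>v\<in>C. Var v ^ m) \<in> {h. \<exists>H. realizes H h}"
      if "{e \<in> GV. P (is_X e) \<and> c \<in> columns k e} = C \<union> {e \<in> GV. P (is_X e) \<and> c' \<in> columns k e}"
        "C \<inter> {e \<in> GV. P (is_X e) \<and> c' \<in> columns k e} = {}" for C c c' P m
    proof -
      have "finite {e \<in> GV. P (is_X e) \<and> c \<in> columns k e}" by simp
      then have fin: "finite C" "finite {e \<in> GV. P (is_X e) \<and> c' \<in> columns k e}"
        unfolding that(1) by simp_all
      have "(\<Sum>v\<in>C. Var v ^ m) = (\<Sum>e\<in>{e \<in> GV. P (is_X e) \<and> c \<in> columns k e}. Var e ^ m) -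
          (\<Sum>e\<in>{e \<in> GV. P (is_X e) \<and> c' \<in> columns k e}. Var e ^ m)"
        unfolding that(1) sum.union_disjoint[OF fin that(2)] by simp
      then show ?thesis
        using realizes_diff[OF realizes_column_power_sum[where P = P and c = c and m = m]
            realizes_column_power_sum[where P = P and c = c' and m = m]]
        by (simp only: mem_Collect_eq) (rule exI)
    qed
    fix a m assume a: "a \<in> {1..k}"
    show "(\<Sum>v\<in>group_vars X ps a. Var v ^ m) \<in> {h. \<exists>H. realizes H h}"
    proof (rule diff)
      show "{e \<in> GV. is_X e \<and> a \<in> columns k e} = group_vars X ps a \<union> {e \<in> GV. is_X e \<and> Suc a \<in> columns k e}"
        unfolding group_vars_eq[OF a] using a by (auto simp: group_var_set_def)
      show "group_vars X ps a \<inter> {e \<in> GV. is_X e \<and> Suc a \<in> columns k e} = {}" by auto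
    qed
    show "(\<Sum>v\<in>group_vars Y qs a. Var v ^ m) \<in> {h. \<exists>H. realizes H h}"
    proof (rule diff)
      \<comment> \<open>For \<open>a = k\<close> the neighbour is column 0, which no y-group meets,
        so the formula needs no case distinction.\<close>
      have "k + 1 - a \<in> columns k (Y x) \<longleftrightarrow> fst x = a \<or> k - a \<in> columns k (Y x)" if "x \<in> groups k qs" for x
        using groups_le[OF that] a by auto
      then show "{e \<in> GV. \<not> is_X e \<and> k + 1 - a \<in> columns k e} =
          group_vars Y qs a \<union> {e \<in> GV. \<not> is_X e \<and> k - a \<in> columns k e}"
        unfolding group_vars_eq[OF a] by (auto simp: group_var_set_def simp del: columns.simps)
      show "group_vars Y qs a \<inter> {e \<in> GV. \<not> is_X e \<and> k - a \<in> columns k e} = {}" using a by auto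
    qed
  qed
  then show ?thesis using assms by blast
qed

lemma realized_in_Gamma:
  assumes H: "realizes H h"
  shows "(\<Sum>\<kappa>\<in>colorings. T \<kappa> * H \<kappa>) \<in> Gamma_space k b0 l1 l2 ps qs" (is "?g \<in> _")
proof -
  have zero: "peval z ?g = 0" if "\<And>\<kappa>. \<kappa> \<in> colorings \<Longrightarrow> peval z (T \<kappa>) = 0" for z
    using that by simp
  have sym: "?g \<in> sym_xy l1 l2"
    unfolding sym_xy_iff sort_perm_def[symmetric]
  proof (intro conjI allI impI)
    show "vars ?g \<subseteq> W"
      using H by (intro vars_sumI vars_multI vars_T) (simp add: realizes_def)
    fix \<pi> assume \<pi>: "sort_perm \<pi>"
    have "act \<pi> ?g = act \<pi> (\<Sum>\<kappa>\<in>colorings. T (\<kappa> \<circ> \<pi>) * H (\<kappa> \<circ> \<pi>))"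
      by (simp only: sum_colorings_comp[OF \<pi>, of "\<lambda>\<kappa>. T \<kappa> * H \<kappa>"])
    also have "\<dots> = ?g"
      using H \<pi> by (simp only: psubst_sum psubst_mult act_T) (intro sum.cong refl, simp add: realizes_def)
    finally show "act \<pi> ?g = ?g" .
  qed
  have I: "?g \<in> I_space k b0 l1 l2"
    unfolding I_space_def
  proof (intro CollectI conjI allI impI sym)
    fix a b t and z :: "nat xy \<Rightarrow> complex"
    assume ab: "a + b = k + 1 \<and> a \<le> l1 \<and> b \<le> l2"
      and z: "(\<forall>i\<in>{1..a}. z (X i) = t) \<and> (\<forall>j\<in>{1..b}. z (Y j) = t)"
    let ?S = "X ` {1..a} \<union> Y ` {1..b} :: nat xy set"
    have "card ?S = card (X ` {1..a} :: nat xy set) + card (Y ` {1..b} :: nat xy set)"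
      by (rule card_Un_disjoint) auto
    then have "card ?S = k + 1" using ab by (simp add: card_image inj_on_def)
    then have card: "k < card ?S" by simp
    have sub: "?S \<subseteq> W" using ab by auto
    have t: "z u = t" if "u \<in> ?S" for u using that z by auto
    show "peval z ?g = 0"
      by (rule zero, rule T_pigeonhole[OF sub t _ card], assumption, rule coloring_range, assumption, rule subsetD[OF sub])
  next
    fix z :: "nat xy \<Rightarrow> complex"
    assume b0: "b0 + 1 \<le> l1" and z: "\<forall>i\<in>{1..b0 + 1}. z (X i) = 0"
    let ?S = "X ` {1..b0 + 1} :: nat xy set"
    have card: "card ?S = b0 + 1" by (simp add: card_image inj_on_def)
    have sub: "?S \<subseteq> W" using b0 by auto
    show "peval z ?g = 0"
    proof (rule zero)
      fix \<kappa> assume \<kappa>: "\<kappa> \<in> colorings"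
      show "peval z (T \<kappa>) = 0"
      \<comment> \<open>Either a variable at zero lies beyond column \<open>b0\<close> and is itself
        a factor of \<open>T\<close>, or all \<open>b0 + 1\<close> of them share \<open>b0\<close>
        columns.\<close>
      proof (cases "\<exists>u\<in>?S. b0 < \<kappa> u")
        case True
        then obtain u where u: "u \<in> ?S" "b0 < \<kappa> u" by blast
        then have "is_X u" "z u = 0" using z by auto
        then show ?thesis using u sub by (intro T_zero_X[of u]) auto
      next
        case False
        show ?thesis
        proof (rule T_pigeonhole[OF sub])
          show "z u = 0" if "u \<in> ?S" for u using that z by auto
          show "\<kappa> u \<in> {1..b0}" if "u \<in> ?S" for u
          proof -
            have "\<kappa> u \<le> b0" using False that by (metis not_le)
            then show ?thesis using coloring_range[OF \<kappa> subsetD[OF sub that]] by simp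
          qed
          show "b0 < card ?S" using card by simp
        qed
      qed
    qed
  qed
  have "phi k \<nu> \<mu> ?g = 0"
    if "restricted_partition k l1 \<nu>" "restricted_partition k l2 \<mu>" "pair_gt (\<nu>, \<mu>) (ps, qs)" for \<nu> \<mu>
  proof (rule peval_eq_0_imp)
    show "peval z (phi k \<nu> \<mu> ?g) = 0" for z
      unfolding peval_phi using that by (intro zero T_specialized_zero)
  qed
  then show ?thesis using I sym by (auto simp: Gamma_space_def ker_phi_def)
qed

lemma phi_realized:
  assumes H: "realizes H h"
  shows "phi k ps qs (\<Sum>\<kappa>\<in>colorings. T \<kappa> * H \<kappa>) =
    Const (of_nat (card good_colorings)) * G_ord k b0 ps qs * h"
proof (rule mpoly_eqI)
  fix z :: "(nat \<times> nat) xy \<Rightarrow> complex"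
  have good: "good_colorings \<subseteq> colorings" by (auto simp: good_colorings_def)
  have "peval z (phi k ps qs (\<Sum>\<kappa>\<in>colorings. T \<kappa> * H \<kappa>)) =
      (\<Sum>\<kappa>\<in>colorings. peval (\<lambda>v. z (\<gamma> v)) (T \<kappa>) * peval (\<lambda>v. z (\<gamma> v)) (H \<kappa>))"
    by (simp add: peval_phi)
  also have "\<dots> = (\<Sum>\<kappa>\<in>good_colorings. peval (\<lambda>v. z (\<gamma> v)) (T \<kappa>) * peval (\<lambda>v. z (\<gamma> v)) (H \<kappa>))"
    using good by (intro sum.mono_neutral_right) (auto simp: T_bad_zero)
  also have "\<dots> = (\<Sum>\<kappa>\<in>good_colorings. peval z (G_ord k b0 ps qs) * peval z h)"
    using H T_good by (intro sum.cong refl) (simp add: realizes_def good_colorings_def)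
  finally show "peval z (phi k ps qs (\<Sum>\<kappa>\<in>colorings. T \<kappa> * H \<kappa>)) =
      peval z (Const (of_nat (card good_colorings)) * G_ord k b0 ps qs * h)"
    by simp
qed

lemma G_poly_multiples_in_image:
  assumes h: "h \<in> tensor (S_space k X ps) (S_space k Y qs)"
  shows "G_poly k b0 ps qs * h \<in> phi k ps qs ` Gamma_space k b0 l1 l2 ps qs"
proof -
  obtain s where s: "s \<noteq> 0" "G_ord k b0 ps qs = Const s * G_poly k b0 ps qs"
    using G_ord_eq by blast
  define N where "N = (of_nat (card good_colorings) :: complex)"
  have "finite good_colorings" by (rule finite_subset[OF _ finite_colorings]) (auto simp: good_colorings_def)
  then have N: "N \<noteq> 0" using good_colorings_exist by (simp add: N_def)
  \<comment> \<open>Scaling \<open>h\<close> in advance compensates for the number of good colorings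
    and the sign relating \<open>G_ord\<close> to \<open>G_poly\<close>.\<close>
  have "smul (1 / (N * s)) h \<in> tensor (S_space k X ps) (S_space k Y qs)"
    using h unfolding tensor_def by (rule mpoly.span_scale)
  then obtain H where H: "realizes H (smul (1 / (N * s)) h)" using tensor_realizable by blast
  have "phi k ps qs (\<Sum>\<kappa>\<in>colorings. T \<kappa> * H \<kappa>) = G_poly k b0 ps qs * h"
    unfolding phi_realized[OF H] N_def[symmetric] s(2) using N s(1) by (intro mpoly_eqI) simp
  from this[symmetric] show ?thesis by (rule image_eqI) (rule realized_in_Gamma[OF H])
qed

end

theorem corollary8p7:
  fixes k b0 l1 l2 :: nat and ps qs :: "nat list"
  assumes "1 \<le> k" and "b0 \<le> k"
    and "restricted_partition k l1 ps" and "restricted_partition k l2 qs"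
  shows "phi k ps qs ` Gamma_space k b0 l1 l2 ps qs =
         (\<lambda>h. G_poly k b0 ps qs * h) ` tensor (S_space k X ps) (S_space k Y qs)"
proof -
  interpret partition_pair k b0 l1 l2 ps qs
    using assms(3,4) by unfold_locales
  show ?thesis
    using phi_in_G_poly_multiples[OF assms(3,4)] G_poly_multiples_in_image by blast
qed

end
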